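(* Let $G=\mathrm{PSL}_2(\mathbb{F}_8)$ and $H\simeq(C_2)^3\rtimes C_7$ the normalizer of a Sylow $2$-subgroup. There is a flabby resolution $0\to J_{G/H}\to P\to F\to0$ with $\mathrm{rank}_{\mathbb{Z}}F=64$ such that there is an isomorphism of $G$-lattices $$\mathbb{Z}[G/C_3]\oplus\mathbb{Z}[G/C_9]\oplus\mathbb{Z}[G/D_7]\simeq\mathbb{Z}[G/C_3]\oplus\mathbb{Z}[G/D_9]\oplus F$$ (rank $260$). In particular $F$ is stably permutation.
   Context: A $G$-lattice is a finitely generated $\mathbb{Z}[G]$-module free over $\mathbb{Z}$. A permutation $G$-lattice is one isomorphic to $\bigoplus_i\mathbb{Z}[G/H_i]$. Stably permutation: $M\oplus P\simeq P'$ with $P,P'$ permutation. $F$ is flabby if $\widehat H^{-1}(H',F)=0$ for all subgroups $H'\le G$. A flabby resolution of $M$ is an exact sequence $0\to M\to P\to F\to0$ with $P$ permutation and $F$ flabby. The Chevalley module is $J_{G/H}=\mathrm{Hom}_{\mathbb{Z}}(I_{G/H},\mathbb{Z})$ where $I_{G/H}=\ker(\mathbb{Z}[G/H]\to\mathbb{Z})$. $D_n$ is dihedral of order $2n$; in $\mathrm{PSL}_2(\mathbb{F}_8)$ the subgroups isomorphic to $C_3$, $C_9$, $D_7$, $D_9$ are each unique up to conjugacy. *)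

theory Defs
  imports "HOL-Algebra.Group_Action" "HOL-Algebra.Left_Coset" "HOL-Algebra.Elementary_Groups"
          "HOL-Algebra.Ring" "Jordan_Normal_Form.Matrix"
begin

text \<open>F_8 = F_2[x]/(x^3+x+1); an element c0 + c1 x + c2 x^2 is encoded as the
  natural number c0 + 2 c1 + 4 c2 in {0..7}.  Addition is bitwise xor,
  multiplication is carry-less multiplication followed by reduction mod x^3+x+1.\<close>

definition gf8_clmul :: "nat \<Rightarrow> nat \<Rightarrow> nat" where
  "gf8_clmul a b =
     xor (if bit b 0 then a else 0)
         (xor (if bit b 1 then push_bit 1 a else 0) (if bit b 2 then push_bit 2 a else 0))"

definition gf8_reduce :: "nat \<Rightarrow> nat" where
  "gf8_reduce c =
     (let c1 = (if bit c 4 then xor c 22 else c) in (if bit c1 3 then xor c1 11 else c1))"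

definition GF8 :: "nat ring" where
  "GF8 = \<lparr>carrier = {0..<8}, monoid.mult = (\<lambda>a b. gf8_reduce (gf8_clmul a b)), one = 1,
          zero = 0, add = (\<lambda>a b. xor a b)\<rparr>"

definition SL2 :: "('a, 'b) ring_scheme \<Rightarrow> ('a \<times> 'a \<times> 'a \<times> 'a) monoid" where
  "SL2 K = \<lparr>carrier = {(a,b,c,d). a \<in> carrier K \<and> b \<in> carrier K \<and> c \<in> carrier K \<and> d \<in> carrier K
                    \<and> (a \<otimes>\<^bsub>K\<^esub> d) \<ominus>\<^bsub>K\<^esub> (b \<otimes>\<^bsub>K\<^esub> c) = \<one>\<^bsub>K\<^esub>},
     monoid.mult = (\<lambda>(a,b,c,d) (a',b',c',d').
        ((a \<otimes>\<^bsub>K\<^esub> a') \<oplus>\<^bsub>K\<^esub> (b \<otimes>\<^bsub>K\<^esub> c'), (a \<otimes>\<^bsub>K\<^esub> b') \<oplus>\<^bsub>K\<^esub> (b \<otimes>\<^bsub>K\<^esub> d'),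
         (c \<otimes>\<^bsub>K\<^esub> a') \<oplus>\<^bsub>K\<^esub> (d \<otimes>\<^bsub>K\<^esub> c'), (c \<otimes>\<^bsub>K\<^esub> b') \<oplus>\<^bsub>K\<^esub> (d \<otimes>\<^bsub>K\<^esub> d'))),
     one = (\<one>\<^bsub>K\<^esub>, \<zero>\<^bsub>K\<^esub>, \<zero>\<^bsub>K\<^esub>, \<one>\<^bsub>K\<^esub>)\<rparr>"

definition SL2_center :: "('a, 'b) ring_scheme \<Rightarrow> ('a \<times> 'a \<times> 'a \<times> 'a) set" where
  "SL2_center K = {(a, \<zero>\<^bsub>K\<^esub>, \<zero>\<^bsub>K\<^esub>, a) | a. a \<in> carrier K \<and> a \<otimes>\<^bsub>K\<^esub> a = \<one>\<^bsub>K\<^esub>}"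

definition PSL2 :: "('a, 'b) ring_scheme \<Rightarrow> ('a \<times> 'a \<times> 'a \<times> 'a) set monoid" where
  "PSL2 K = SL2 K Mod SL2_center K"

text \<open>Dihedral group D_n of order 2n: pairs (k, s) = r^k s^[s], with s r s = r^{-1}.\<close>

definition dihedral_group :: "nat \<Rightarrow> (int \<times> bool) monoid" where
  "dihedral_group n = \<lparr>carrier = {0..<int n} \<times> UNIV,
     monoid.mult = (\<lambda>(a,s) (b,t). ((a + (if s then - b else b)) mod int n, s \<noteq> t)),
     one = (0, False)\<rparr>"

definition sylow_subgroup :: "('g, 'c) monoid_scheme \<Rightarrow> nat \<Rightarrow> 'g set \<Rightarrow> bool" where
  "sylow_subgroup G p P \<longleftrightarrow> subgroup P G \<and> (\<exists>a. card P = p ^ a) \<and> card P dvd order G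
     \<and> \<not> p dvd (order G div card P)"

text \<open>A G-lattice of rank n is Z^n (column vectors) with a G-action given by
  rho :: g => int mat; it is encoded as the pair (n, rho).\<close>

type_synonym 'g lattice = "nat \<times> ('g \<Rightarrow> int mat)"

definition G_lattice :: "('g, 'c) monoid_scheme \<Rightarrow> 'g lattice \<Rightarrow> bool" where
  "G_lattice G L \<longleftrightarrow>
     (\<forall>g\<in>carrier G. snd L g \<in> carrier_mat (fst L) (fst L)) \<and>
     snd L \<one>\<^bsub>G\<^esub> = 1\<^sub>m (fst L) \<and>
     (\<forall>g\<in>carrier G. \<forall>h\<in>carrier G. snd L (g \<otimes>\<^bsub>G\<^esub> h) = snd L g * snd L h)"

definition lat_rank :: "'g lattice \<Rightarrow> nat" where
  "lat_rank L = fst L"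

definition G_hom :: "('g, 'c) monoid_scheme \<Rightarrow> 'g lattice \<Rightarrow> 'g lattice \<Rightarrow> int mat \<Rightarrow> bool" where
  "G_hom G L1 L2 A \<longleftrightarrow> A \<in> carrier_mat (fst L2) (fst L1) \<and>
     (\<forall>g\<in>carrier G. A * snd L1 g = snd L2 g * A)"

definition lat_iso :: "('g, 'c) monoid_scheme \<Rightarrow> 'g lattice \<Rightarrow> 'g lattice \<Rightarrow> bool" where
  "lat_iso G L1 L2 \<longleftrightarrow> (\<exists>A B. G_hom G L1 L2 A \<and> B \<in> carrier_mat (fst L1) (fst L2) \<and>
     A * B = 1\<^sub>m (fst L2) \<and> B * A = 1\<^sub>m (fst L1))"

definition lat_dsum :: "'g lattice list \<Rightarrow> 'g lattice" where
  "lat_dsum Ls = (sum_list (map fst Ls), \<lambda>g. diag_block_mat (map (\<lambda>L. snd L g) Ls))"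

definition coset_enum :: "('g, 'c) monoid_scheme \<Rightarrow> 'g set \<Rightarrow> nat \<Rightarrow> 'g set" where
  "coset_enum G H = (SOME e. bij_betw e {..<card (lcosets\<^bsub>G\<^esub> H)} (lcosets\<^bsub>G\<^esub> H))"

definition coset_lattice :: "('g, 'c) monoid_scheme \<Rightarrow> 'g set \<Rightarrow> 'g lattice" where
  "coset_lattice G H = (let n = card (lcosets\<^bsub>G\<^esub> H); e = coset_enum G H in
     (n, \<lambda>g. mat n n (\<lambda>(i,j). if g <#\<^bsub>G\<^esub> e j = e i then 1 else 0)))"

text \<open>The augmentation ideal I_{G/H} = ker(Z[G/H] -> Z), with Z-basis
  b_k = e_k - e_{n-1} (k < n-1); in this basis g b_k = sum_i (rho(g)_{ik} - rho(g)_{i,n-1}) b_i.\<close>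
definition augmentation_lattice :: "('g, 'c) monoid_scheme \<Rightarrow> 'g set \<Rightarrow> 'g lattice" where
  "augmentation_lattice G H = (let n = fst (coset_lattice G H); \<rho> = snd (coset_lattice G H) in
     (n - 1, \<lambda>g. mat (n - 1) (n - 1) (\<lambda>(i,k). \<rho> g $$ (i,k) - \<rho> g $$ (i, n - 1))))"

definition dual_lattice :: "('g, 'c) monoid_scheme \<Rightarrow> 'g lattice \<Rightarrow> 'g lattice" where
  "dual_lattice G L = (fst L, \<lambda>g. transpose_mat (snd L (inv\<^bsub>G\<^esub> g)))"

definition chevalley_lattice :: "('g, 'c) monoid_scheme \<Rightarrow> 'g set \<Rightarrow> 'g lattice" where
  "chevalley_lattice G H = dual_lattice G (augmentation_lattice G H)"

definition perm_lattice :: "('g, 'c) monoid_scheme \<Rightarrow> 'g lattice \<Rightarrow> bool" where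
  "perm_lattice G L \<longleftrightarrow> G_lattice G L \<and>
     (\<exists>Hs. (\<forall>H\<in>set Hs. subgroup H G) \<and> lat_iso G L (lat_dsum (map (coset_lattice G) Hs)))"

definition stably_perm_lattice :: "('g, 'c) monoid_scheme \<Rightarrow> 'g lattice \<Rightarrow> bool" where
  "stably_perm_lattice G M \<longleftrightarrow> G_lattice G M \<and>
     (\<exists>P P'. perm_lattice G P \<and> perm_lattice G P' \<and> lat_iso G (lat_dsum [M, P]) P')"

text \<open>Flabby: hat H^{-1}(K, F) = ker(N_K) / I_K F vanishes for every subgroup K,
  where N_K = sum_{h in K} h and I_K F is spanned by the (h - 1) y.\<close>
definition flabby :: "('g, 'c) monoid_scheme \<Rightarrow> 'g lattice \<Rightarrow> bool" where
  "flabby G F \<longleftrightarrow> G_lattice G F \<and>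
     (\<forall>K. subgroup K G \<longrightarrow> (\<forall>x\<in>carrier_vec (fst F).
        vec (fst F) (\<lambda>i. \<Sum>h\<in>K. (snd F h *\<^sub>v x) $ i) = 0\<^sub>v (fst F) \<longrightarrow>
        (\<exists>y. (\<forall>h\<in>K. y h \<in> carrier_vec (fst F)) \<and>
             x = vec (fst F) (\<lambda>i. \<Sum>h\<in>K. ((snd F h - 1\<^sub>m (fst F)) *\<^sub>v y h) $ i))))"

definition short_exact :: "('g, 'c) monoid_scheme \<Rightarrow> 'g lattice \<Rightarrow> 'g lattice \<Rightarrow> 'g lattice
    \<Rightarrow> int mat \<Rightarrow> int mat \<Rightarrow> bool" where
  "short_exact G M P F i p \<longleftrightarrow> G_lattice G M \<and> G_lattice G P \<and> G_lattice G F \<and>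
     G_hom G M P i \<and> G_hom G P F p \<and>
     (\<forall>v\<in>carrier_vec (fst M). i *\<^sub>v v = 0\<^sub>v (fst P) \<longrightarrow> v = 0\<^sub>v (fst M)) \<and>
     (\<forall>w\<in>carrier_vec (fst F). \<exists>v\<in>carrier_vec (fst P). p *\<^sub>v v = w) \<and>
     (\<forall>v\<in>carrier_vec (fst P). p *\<^sub>v v = 0\<^sub>v (fst F) \<longleftrightarrow> (\<exists>u\<in>carrier_vec (fst M). v = i *\<^sub>v u))"

definition flabby_resolution :: "('g, 'c) monoid_scheme \<Rightarrow> 'g lattice \<Rightarrow> 'g lattice \<Rightarrow> 'g lattice
    \<Rightarrow> int mat \<Rightarrow> int mat \<Rightarrow> bool" where
  "flabby_resolution G M P F i p \<longleftrightarrow> short_exact G M P F i p \<and> perm_lattice G P \<and> flabby G F"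

end

theory Submission
  imports Defs "Jordan_Normal_Form.Determinant" "HOL-Algebra.Multiplicative_Group"
begin

text \<open>The group \<open>G\<close> acts sharply 3-transitively on the nine points of the projective line, and \<open>H\<close> is
  the stabilizer of a point. Sending a function on points to its difference along pairs embeds
  \<open>J\<close> into the permutation lattice \<open>P\<close> on ordered pairs of distinct points, and the quotient \<open>F\<close> has
  rank \<open>72 - 8 = 64\<close>. A homomorphism from \<open>F\<close> is a vector fixed by the stabilizer \<open>T\<close> of a pair whose
  translates satisfy one linear relation.

  The lattice \<open>U = Z[G/C\<^sub>3] \<oplus> Z[G/C\<^sub>9] \<oplus> Z[G/D\<^sub>7]\<close> contains explicit vectors \<open>B\<^sub>0\<close>, \<open>B\<^sub>1\<close>, \<open>B\<^sub>2\<close> that are fixed by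
  \<open>C\<^sub>3\<close>, \<open>D\<^sub>9\<close>, \<open>T\<close>, where \<open>B\<^sub>2\<close> satisfies that relation, and whose translates generate \<open>U\<close>. They define a
  surjection \<open>Z[G/C\<^sub>3] \<oplus> Z[G/D\<^sub>9] \<oplus> F \<rightarrow> U\<close>, which is an isomorphism because both ranks are 260.
  Finally \<open>F\<close> is flabby as a direct summand of the permutation lattice \<open>U\<close>. The claims on the \<open>B\<^sub>i\<close> are identities
  between finite formal sums of cosets, verified by rewriting.\<close>

section \<open>Lattices and their direct sums\<close>

text \<open>All homomorphisms are built with target U: one out of a coset lattice is a single
  invariant vector, and one out of F is a single vector satisfying the relation, so neither a basis
  of F nor an inverse matrix is ever written down. Surjectivity then only asks that the three base
  cosets of U be integral combinations of translates of \<open>B0\<close>, \<open>B1\<close>,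
  \<open>B2\<close>. The Sylow subgroup and the subgroups C3, C9, D7, D9 of the statement are
  arbitrary. The certificate is therefore computed for standard subgroups of one permutation group
  of degree nine, described by fixed points or by commutation with an element \<open>cyc\<close> of
  order 3; each given subgroup is conjugated into standard position, and the conjugating elements
  are carried into the lattices. The ranks are indices in a group of order 504: 168 + 56 + 36 = 260
  = 168 + 28 + 64. The stabilizer T of an ordered pair has order 7, so P has rank 72 = 9 *
  8.\<close>

lemma mat_eq_on_unit_vecs:
  fixes A B :: "'a::comm_ring_1 mat"
  assumes A: "A \<in> carrier_mat m n" and B: "B \<in> carrier_mat m n"
    and eq: "\<And>j. j < n \<Longrightarrow> A *\<^sub>v unit_vec n j = B *\<^sub>v unit_vec n j"
  shows "A = B"
proof (rule eq_matI)
  fix i j assume ij: "i < dim_row B" "j < dim_col B"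
  have "(A *\<^sub>v unit_vec n j) $ i = (B *\<^sub>v unit_vec n j) $ i"
    using eq[of j] ij B by simp
  then show "A $$ (i, j) = B $$ (i, j)"
    using ij A B by (auto simp: mat_of_cols_def)
qed (use A B in auto)

text \<open>Preimages of the unit vectors are the columns of a right inverse. It makes the
  determinant of B a unit, so the adjugate yields a left inverse, and the two coincide. This turns a
  surjection between lattices of equal rank into an isomorphism.\<close>

lemma two_sided_inverse_of_surj:
  fixes B :: "'a::comm_ring_1 mat"
  assumes B: "B \<in> carrier_mat n n"
    and surj: "\<And>w. w \<in> carrier_vec n \<Longrightarrow> \<exists>v\<in>carrier_vec n. B *\<^sub>v v = w"
  shows "\<exists>X\<in>carrier_mat n n. B * X = 1\<^sub>m n \<and> X * B = 1\<^sub>m n"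
proof -
  have "\<forall>j. \<exists>v\<in>carrier_vec n. B *\<^sub>v v = unit_vec n j"
    using surj by simp
  then obtain f where f: "\<And>j. f j \<in> carrier_vec n" "\<And>j. B *\<^sub>v f j = unit_vec n j"
    by metis
  define X where "X = mat n n (\<lambda>(i,j). f j $ i)"
  have X: "X \<in> carrier_mat n n" by (simp add: X_def)
  have colX: "col X j = f j" if "j < n" for j
    using that f(1)[of j] by (intro eq_vecI) (auto simp: X_def)
  have BX: "B * X = 1\<^sub>m n"
  proof (rule eq_matI)
    fix i j assume ij: "i < dim_row (1\<^sub>m n :: 'a mat)" "j < dim_col (1\<^sub>m n :: 'a mat)"
    then have "(B * X) $$ (i, j) = (B *\<^sub>v f j) $ i"
      using B X colX by simp
    then show "(B * X) $$ (i, j) = 1\<^sub>m n $$ (i, j)"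
      using f(2)[of j] ij by simp
  qed (use B X in auto)
  have d: "det B * det X = 1"
    using det_mult[OF B X] BX by simp
  define Y where "Y = det X \<cdot>\<^sub>m adj_mat B"
  have Y: "Y \<in> carrier_mat n n" using adj_mat(1)[OF B] by (simp add: Y_def)
  have YB: "Y * B = 1\<^sub>m n"
  proof -
    have "Y * B = det X \<cdot>\<^sub>m (det B \<cdot>\<^sub>m 1\<^sub>m n)"
      using adj_mat[OF B] B by (simp add: Y_def mult_smult_assoc_mat)
    also have "\<dots> = 1\<^sub>m n" using d by (intro eq_matI) (auto simp: mult.commute)
    finally show ?thesis .
  qed
  have "X = (Y * B) * X" using X YB by simp
  also have "\<dots> = Y * (B * X)" using Y B X by simp
  also have "\<dots> = Y" using BX Y by simp
  finally show ?thesis using X BX YB by blast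
qed

lemma G_lattice_carrier: "G_lattice G L \<Longrightarrow> g \<in> carrier G \<Longrightarrow> snd L g \<in> carrier_mat (fst L) (fst L)"
  by (simp add: G_lattice_def)

lemma G_lattice_mult_vec:
  assumes "G_lattice G L" "g \<in> carrier G" "h \<in> carrier G" "x \<in> carrier_vec (fst L)"
  shows "snd L (g \<otimes>\<^bsub>G\<^esub> h) *\<^sub>v x = snd L g *\<^sub>v (snd L h *\<^sub>v x)"
  using assms assoc_mult_mat_vec[OF G_lattice_carrier[OF assms(1,2)] G_lattice_carrier[OF assms(1,3)] assms(4)]
  by (simp add: G_lattice_def)

text \<open>Maps out of a direct sum are easier to handle on vectors \<open>x @\<^sub>v y\<close>
  than as block matrices; conversely the unit vectors determine the matrix identity.\<close>

lemma G_hom_iff_vec: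
  assumes L: "G_lattice G L1" and M: "G_lattice G L2"
  shows "G_hom G L1 L2 A \<longleftrightarrow> A \<in> carrier_mat (fst L2) (fst L1) \<and>
     (\<forall>g\<in>carrier G. \<forall>x\<in>carrier_vec (fst L1). A *\<^sub>v (snd L1 g *\<^sub>v x) = snd L2 g *\<^sub>v (A *\<^sub>v x))"
    (is "?L \<longleftrightarrow> ?R")
proof
  assume H: ?L
  then have A: "A \<in> carrier_mat (fst L2) (fst L1)" by (simp add: G_hom_def)
  show ?R
  proof (intro conjI ballI A)
    fix g and x :: "int vec" assume g: "g \<in> carrier G" and x: "x \<in> carrier_vec (fst L1)"
    have "A *\<^sub>v (snd L1 g *\<^sub>v x) = (A * snd L1 g) *\<^sub>v x"
      using A x G_lattice_carrier[OF L g] by simp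
    also have "\<dots> = (snd L2 g * A) *\<^sub>v x" using H g by (simp add: G_hom_def)
    also have "\<dots> = snd L2 g *\<^sub>v (A *\<^sub>v x)"
      using A x G_lattice_carrier[OF M g] by simp
    finally show "A *\<^sub>v (snd L1 g *\<^sub>v x) = snd L2 g *\<^sub>v (A *\<^sub>v x)" .
  qed
next
  assume R: ?R
  then have A: "A \<in> carrier_mat (fst L2) (fst L1)" by simp
  have "A * snd L1 g = snd L2 g * A" if g: "g \<in> carrier G" for g
  proof (rule mat_eq_on_unit_vecs)
    show "A * snd L1 g \<in> carrier_mat (fst L2) (fst L1)" "snd L2 g * A \<in> carrier_mat (fst L2) (fst L1)"
      using A G_lattice_carrier[OF L g] G_lattice_carrier[OF M g] by auto
    fix j
    show "(A * snd L1 g) *\<^sub>v unit_vec (fst L1) j = (snd L2 g * A) *\<^sub>v unit_vec (fst L1) j"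
      using R g A G_lattice_carrier[OF L g] G_lattice_carrier[OF M g] by simp
  qed
  then show ?L using A by (simp add: G_hom_def)
qed

lemma G_hom_mult_vec:
  assumes "G_lattice G L1" "G_lattice G L2" "G_hom G L1 L2 A"
    "g \<in> carrier G" "x \<in> carrier_vec (fst L1)"
  shows "A *\<^sub>v (snd L1 g *\<^sub>v x) = snd L2 g *\<^sub>v (A *\<^sub>v x)"
  using assms by (simp add: G_hom_iff_vec)

lemma G_hom_inverse:
  assumes L: "G_lattice G L1" "G_lattice G L2" and A: "G_hom G L1 L2 A"
    and B: "B \<in> carrier_mat (fst L1) (fst L2)" and AB: "A * B = 1\<^sub>m (fst L2)" and BA: "B * A = 1\<^sub>m (fst L1)"
  shows "G_hom G L2 L1 B"
proof -
  have cA: "A \<in> carrier_mat (fst L2) (fst L1)" using A by (simp add: G_hom_def)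
  have "B * snd L2 g = snd L1 g * B" if g: "g \<in> carrier G" for g
  proof -
    note c1 = G_lattice_carrier[OF L(1) g] and c2 = G_lattice_carrier[OF L(2) g]
    have "B * snd L2 g = B * snd L2 g * (A * B)" using c2 B AB by simp
    also have "\<dots> = (B * snd L2 g * A) * B"
      by (rule assoc_mult_mat[symmetric]) (use c2 B cA in auto)
    also have "B * snd L2 g * A = B * (snd L2 g * A)"
      by (rule assoc_mult_mat) (use c2 B cA in auto)
    also have "snd L2 g * A = A * snd L1 g" using A g by (simp add: G_hom_def)
    also have "B * (A * snd L1 g) = (B * A) * snd L1 g"
      by (rule assoc_mult_mat[symmetric]) (use c1 B cA in auto)
    also have "(B * A) * snd L1 g = snd L1 g" using c1 BA by simp
    finally show ?thesis .
  qed
  then show ?thesis using B by (simp add: G_hom_def)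
qed

lemma lat_iso_sym:
  assumes L: "G_lattice G L1" "G_lattice G L2" and iso: "lat_iso G L1 L2"
  shows "lat_iso G L2 L1"
proof -
  obtain A B where "G_hom G L1 L2 A" "B \<in> carrier_mat (fst L1) (fst L2)"
    "A * B = 1\<^sub>m (fst L2)" "B * A = 1\<^sub>m (fst L1)"
    using iso by (auto simp: lat_iso_def)
  with G_hom_inverse[OF L this] show ?thesis
    unfolding lat_iso_def G_hom_def by blast
qed

lemma lat_iso_refl: "G_lattice G L \<Longrightarrow> lat_iso G L L"
  unfolding lat_iso_def G_hom_def G_lattice_def
  by (intro exI[of _ "1\<^sub>m (fst L)"]) (simp, metis left_mult_one_mat right_mult_one_mat)

lemma lat_iso_of_surj:
  assumes A: "G_hom G L1 L2 A" and r: "fst L1 = fst L2"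
    and surj: "\<And>w. w \<in> carrier_vec (fst L2) \<Longrightarrow> \<exists>v\<in>carrier_vec (fst L1). A *\<^sub>v v = w"
  shows "lat_iso G L1 L2"
proof -
  have "A \<in> carrier_mat (fst L2) (fst L2)" using A r by (simp add: G_hom_def)
  from two_sided_inverse_of_surj[OF this] surj r
  obtain X where "X \<in> carrier_mat (fst L2) (fst L2)" "A * X = 1\<^sub>m (fst L2)" "X * A = 1\<^sub>m (fst L2)"
    by metis
  then show ?thesis using A r by (auto simp: lat_iso_def)
qed

lemma fst_lat_dsum_Nil [simp]: "fst (lat_dsum []) = 0"
  and fst_lat_dsum_Cons [simp]: "fst (lat_dsum (L # Ls)) = fst L + fst (lat_dsum Ls)"
  by (simp_all add: lat_dsum_def)

lemma snd_lat_dsum_Cons: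
  assumes "snd L g \<in> carrier_mat (fst L) (fst L)"
    and "snd (lat_dsum Ls) g \<in> carrier_mat (fst (lat_dsum Ls)) (fst (lat_dsum Ls))"
  shows "snd (lat_dsum (L # Ls)) g = four_block_mat (snd L g) (0\<^sub>m (fst L) (fst (lat_dsum Ls)))
     (0\<^sub>m (fst (lat_dsum Ls)) (fst L)) (snd (lat_dsum Ls) g)"
  using assms by (simp add: lat_dsum_def Let_def)

lemma four_block_diag_mult:
  fixes A :: "'a::comm_ring_1 mat"
  assumes "A \<in> carrier_mat m m" "A' \<in> carrier_mat m m" "B \<in> carrier_mat n n" "B' \<in> carrier_mat n n"
  shows "four_block_mat A (0\<^sub>m m n) (0\<^sub>m n m) B * four_block_mat A' (0\<^sub>m m n) (0\<^sub>m n m) B' =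
    four_block_mat (A * A') (0\<^sub>m m n) (0\<^sub>m n m) (B * B')"
proof -
  have z: "A * 0\<^sub>m m n = 0\<^sub>m m n" "B * 0\<^sub>m n m = 0\<^sub>m n m" "0\<^sub>m m n * B' = 0\<^sub>m m n" "0\<^sub>m n m * A' = 0\<^sub>m n m"
    "0\<^sub>m m n * 0\<^sub>m n m = (0\<^sub>m m m :: 'a mat)" "0\<^sub>m n m * 0\<^sub>m m n = (0\<^sub>m n n :: 'a mat)"
    using assms by auto
  have c: "A * A' \<in> carrier_mat m m" "B * B' \<in> carrier_mat n n" using assms by auto
  show ?thesis
    unfolding mult_four_block_mat[OF assms(1) zero_carrier_mat zero_carrier_mat assms(3)
      assms(2) zero_carrier_mat zero_carrier_mat assms(4)] z
    using c by simp
qed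

lemma G_lattice_dsum_Cons:
  assumes L: "G_lattice G L" and M: "G_lattice G (lat_dsum Ls)" and G: "group G"
  shows "G_lattice G (lat_dsum (L # Ls))"
proof -
  interpret group G by (rule G)
  let ?m = "fst L" and ?n = "fst (lat_dsum Ls)"
  note c = G_lattice_carrier[OF L] G_lattice_carrier[OF M]
  note blk = snd_lat_dsum_Cons[OF c]
  show ?thesis unfolding G_lattice_def
  proof (intro conjI ballI)
    fix g assume g: "g \<in> carrier G"
    show "snd (lat_dsum (L # Ls)) g \<in> carrier_mat (fst (lat_dsum (L # Ls))) (fst (lat_dsum (L # Ls)))"
      unfolding blk[OF g g] fst_lat_dsum_Cons using c[OF g] by (intro four_block_carrier_mat)
    fix h assume h: "h \<in> carrier G"
    show "snd (lat_dsum (L # Ls)) (g \<otimes>\<^bsub>G\<^esub> h) = snd (lat_dsum (L # Ls)) g * snd (lat_dsum (L # Ls)) h"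
      unfolding blk[OF g g] blk[OF h h] blk[OF m_closed[OF g h] m_closed[OF g h]]
      four_block_diag_mult[OF c(1)[OF g] c(1)[OF h] c(2)[OF g] c(2)[OF h]]
      using L M g h by (simp add: G_lattice_def)
  next
    show "snd (lat_dsum (L # Ls)) \<one>\<^bsub>G\<^esub> = 1\<^sub>m (fst (lat_dsum (L # Ls)))"
      unfolding blk[OF one_closed one_closed] using L M by (simp add: G_lattice_def)
  qed
qed

lemma G_lattice_dsum:
  assumes G: "group G" and "\<And>L. L \<in> set Ls \<Longrightarrow> G_lattice G L"
  shows "G_lattice G (lat_dsum Ls)"
  using assms(2)
proof (induction Ls)
  case Nil
  show ?case by (auto simp: G_lattice_def lat_dsum_def)
next
  case (Cons L Ls)
  then show ?case using G_lattice_dsum_Cons[OF _ _ G] by simp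
qed

lemma dsum_action:
  assumes L: "G_lattice G L" and M: "G_lattice G (lat_dsum Ls)" and g: "g \<in> carrier G"
    and x: "x \<in> carrier_vec (fst L)" and y: "y \<in> carrier_vec (fst (lat_dsum Ls))"
  shows "snd (lat_dsum (L # Ls)) g *\<^sub>v (x @\<^sub>v y) = (snd L g *\<^sub>v x) @\<^sub>v (snd (lat_dsum Ls) g *\<^sub>v y)"
  unfolding snd_lat_dsum_Cons[OF G_lattice_carrier[OF L g] G_lattice_carrier[OF M g]]
  by (rule mult_mat_vec_split[OF G_lattice_carrier[OF L g] G_lattice_carrier[OF M g] x y])

lemma append_vec_zero: "(v :: 'a vec) \<in> carrier_vec n \<Longrightarrow> w \<in> carrier_vec 0 \<Longrightarrow> v @\<^sub>v w = v"
  by (intro eq_vecI) auto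

lemma split_append_vec:
  assumes "v \<in> carrier_vec (m + n)"
  obtains x y where "x \<in> carrier_vec m" "y \<in> carrier_vec n" "v = x @\<^sub>v y"
  using assms vec_first_last_append[OF assms] vec_first_carrier vec_last_carrier by metis

lemma dsum_hom:
  assumes G: "group G" and L: "G_lattice G L" and Ls: "G_lattice G (lat_dsum Ls)" and M: "G_lattice G M"
    and A: "G_hom G L M A" and B: "G_hom G (lat_dsum Ls) M B"
  obtains C where "G_hom G (lat_dsum (L # Ls)) M C"
    "\<And>x y. x \<in> carrier_vec (fst L) \<Longrightarrow> y \<in> carrier_vec (fst (lat_dsum Ls)) \<Longrightarrow>
       C *\<^sub>v (x @\<^sub>v y) = A *\<^sub>v x + B *\<^sub>v y"
proof -
  let ?a = "fst L" and ?b = "fst (lat_dsum Ls)" and ?m = "fst M"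
  have cA: "A \<in> carrier_mat ?m ?a" and cB: "B \<in> carrier_mat ?m ?b"
    using A B by (auto simp: G_hom_def)
  \<comment> \<open>The row [A B], written as a block matrix whose lower half is empty.\<close>
  define C where "C = four_block_mat A B (0\<^sub>m 0 ?a) (0\<^sub>m 0 ?b)"
  have cC: "C \<in> carrier_mat ?m (?a + ?b)"
    using cA cB by (auto simp: C_def)
  have C: "C *\<^sub>v (x @\<^sub>v y) = A *\<^sub>v x + B *\<^sub>v y" if x: "x \<in> carrier_vec ?a" and y: "y \<in> carrier_vec ?b" for x y
    unfolding C_def
    apply (subst four_block_mat_mult_vec[OF cA cB zero_carrier_mat zero_carrier_mat x y])
    apply (rule append_vec_zero[where n = ?m])
    using cA cB x y by (auto intro!: carrier_vecI)
  have "G_hom G (lat_dsum (L # Ls)) M C"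
    unfolding G_hom_iff_vec[OF G_lattice_dsum_Cons[OF L Ls G] M]
  proof (intro conjI ballI)
    show "C \<in> carrier_mat ?m (fst (lat_dsum (L # Ls)))" using cC by simp
    fix g and v :: "int vec" assume g: "g \<in> carrier G" and v: "v \<in> carrier_vec (fst (lat_dsum (L # Ls)))"
    obtain x y where xy: "x \<in> carrier_vec ?a" "y \<in> carrier_vec ?b" "v = x @\<^sub>v y"
      using v split_append_vec by (metis fst_lat_dsum_Cons)
    have gx: "snd L g *\<^sub>v x \<in> carrier_vec ?a" and gy: "snd (lat_dsum Ls) g *\<^sub>v y \<in> carrier_vec ?b"
      using G_lattice_carrier[OF L g] G_lattice_carrier[OF Ls g] xy by auto
    have "C *\<^sub>v (snd (lat_dsum (L # Ls)) g *\<^sub>v v) = A *\<^sub>v (snd L g *\<^sub>v x) + B *\<^sub>v (snd (lat_dsum Ls) g *\<^sub>v y)"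
      unfolding xy(3) dsum_action[OF L Ls g xy(1,2)] by (rule C[OF gx gy])
    also have "\<dots> = snd M g *\<^sub>v (A *\<^sub>v x) + snd M g *\<^sub>v (B *\<^sub>v y)"
      using G_hom_mult_vec[OF L M A g xy(1)] G_hom_mult_vec[OF Ls M B g xy(2)] by simp
    also have "\<dots> = snd M g *\<^sub>v (A *\<^sub>v x + B *\<^sub>v y)"
      using G_lattice_carrier[OF M g] cA cB xy by (simp add: mult_add_distrib_mat_vec[where nr = ?m and nc = ?m])
    finally show "C *\<^sub>v (snd (lat_dsum (L # Ls)) g *\<^sub>v v) = snd M g *\<^sub>v (C *\<^sub>v v)"
      unfolding xy(3) C[OF xy(1,2)] .
  qed
  with C that show ?thesis by blast
qed

section \<open>Coset lattices\<close>

no_notation subset_mset (infix \<open><#\<close> 50)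

text \<open>Subgroups of Z^n. That vectors generate is expressed by saying that a submodule
  containing them is all of \<open>carrier_vec n\<close>, so no coefficients have to be carried
  along.\<close>

definition int_submodule :: "nat \<Rightarrow> int vec set \<Rightarrow> bool" where
  "int_submodule n S \<longleftrightarrow> S \<subseteq> carrier_vec n \<and> 0\<^sub>v n \<in> S \<and> (\<forall>x\<in>S. \<forall>y\<in>S. x + y \<in> S) \<and>
     (\<forall>c. \<forall>x\<in>S. c \<cdot>\<^sub>v x \<in> S)"

lemma int_submodule_sum:
  fixes m :: nat
  assumes S: "int_submodule n S" and f: "\<And>i. i < m \<Longrightarrow> f i \<in> S"
  shows "vec n (\<lambda>a. \<Sum>i<m. c i * f i $ a) \<in> S"
  using f
proof (induction m)
  case 0
  have "vec n (\<lambda>a. \<Sum>i<0. c i * f i $ a) = 0\<^sub>v n" by (intro eq_vecI) auto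
  then show ?case using S by (simp add: int_submodule_def)
next
  case (Suc m)
  have c: "f m \<in> carrier_vec n" using Suc.prems[of m] S by (auto simp: int_submodule_def)
  have "vec n (\<lambda>a. \<Sum>i<Suc m. c i * f i $ a) = vec n (\<lambda>a. \<Sum>i<m. c i * f i $ a) + c m \<cdot>\<^sub>v f m"
    using c by (intro eq_vecI) auto
  then show ?case using Suc S by (simp add: int_submodule_def)
qed

lemma int_submodule_eq_carrier:
  assumes S: "int_submodule n S" and u: "\<And>j. j < n \<Longrightarrow> unit_vec n j \<in> S"
  shows "S = carrier_vec n"
proof -
  have "x \<in> S" if x: "x \<in> carrier_vec n" for x
  proof -
    have "vec n (\<lambda>a. \<Sum>i<n. x $ i * unit_vec n i $ a) \<in> S"
      by (rule int_submodule_sum[OF S]) (use u in auto)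
    also have "vec n (\<lambda>a. \<Sum>i<n. x $ i * unit_vec n i $ a) = x"
      using x by (intro eq_vecI) (auto simp: unit_vec_def if_distrib sum.delta cong: if_cong)
    finally show ?thesis .
  qed
  then show ?thesis using S by (auto simp: int_submodule_def)
qed

lemma int_submodule_range:
  assumes A: "A \<in> carrier_mat m n"
  shows "int_submodule m {A *\<^sub>v x |x. x \<in> carrier_vec n}"
  unfolding int_submodule_def
proof (intro conjI ballI allI)
  show "{A *\<^sub>v x |x. x \<in> carrier_vec n} \<subseteq> carrier_vec m" using A by auto
  have "A *\<^sub>v 0\<^sub>v n = 0\<^sub>v m" using A by (intro eq_vecI) auto
  then show "0\<^sub>v m \<in> {A *\<^sub>v x |x. x \<in> carrier_vec n}" unfolding mem_Collect_eq by (metis zero_carrier_vec)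
next
  fix x y assume "x \<in> {A *\<^sub>v x |x. x \<in> carrier_vec n}" "y \<in> {A *\<^sub>v x |x. x \<in> carrier_vec n}"
  then obtain x' y' where xy: "x' \<in> carrier_vec n" "y' \<in> carrier_vec n" "x = A *\<^sub>v x'" "y = A *\<^sub>v y'" by blast
  then have "x + y = A *\<^sub>v (x' + y')" using mult_add_distrib_mat_vec[OF A] by simp
  moreover have "x' + y' \<in> carrier_vec n" using xy by simp
  ultimately show "x + y \<in> {A *\<^sub>v x |x. x \<in> carrier_vec n}" unfolding mem_Collect_eq by metis
next
  fix c x assume "x \<in> {A *\<^sub>v x |x. x \<in> carrier_vec n}"
  then obtain x' where x: "x' \<in> carrier_vec n" "x = A *\<^sub>v x'" by blast
  then have "c \<cdot>\<^sub>v x = A *\<^sub>v (c \<cdot>\<^sub>v x')" using A by (intro eq_vecI) auto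
  moreover have "c \<cdot>\<^sub>v x' \<in> carrier_vec n" using x by simp
  ultimately show "c \<cdot>\<^sub>v x \<in> {A *\<^sub>v x |x. x \<in> carrier_vec n}" unfolding mem_Collect_eq by metis
qed

lemma append_vec_add:
  "(x :: int vec) \<in> carrier_vec m \<Longrightarrow> x' \<in> carrier_vec m \<Longrightarrow> y \<in> carrier_vec n \<Longrightarrow> y' \<in> carrier_vec n \<Longrightarrow>
    (x @\<^sub>v y) + (x' @\<^sub>v y') = (x + x') @\<^sub>v (y + y')"
  by (intro eq_vecI) auto

lemma unit_vec_append:
  "j < m + n \<Longrightarrow> (unit_vec (m + n) j :: int vec) =
    (if j < m then unit_vec m j @\<^sub>v 0\<^sub>v n else 0\<^sub>v m @\<^sub>v unit_vec n (j - m))"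
  by (intro eq_vecI) auto

lemma mult_zero_vec: "(A :: int mat) \<in> carrier_mat m n \<Longrightarrow> A *\<^sub>v 0\<^sub>v n = 0\<^sub>v m"
  by (intro eq_vecI) auto

text \<open>The basis vector of Z[G/K] at the coset C. Addressing it by the coset hides the
  enumeration that \<open>coset_enum\<close> picks by choice.\<close>

definition coset_vec :: "('g, 'c) monoid_scheme \<Rightarrow> 'g set \<Rightarrow> 'g set \<Rightarrow> int vec" where
  "coset_vec G K C = vec (card (lcosets\<^bsub>G\<^esub> K)) (\<lambda>i. if coset_enum G K i = C then 1 else 0)"

lemma fst_coset_lattice [simp]: "fst (coset_lattice G K) = card (lcosets\<^bsub>G\<^esub> K)"
  by (simp add: coset_lattice_def Let_def)

lemma coset_vec_carrier [simp]: "coset_vec G K C \<in> carrier_vec (card (lcosets\<^bsub>G\<^esub> K))"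
  by (simp add: coset_vec_def)

lemma snd_coset_lattice_carrier:
  "snd (coset_lattice G K) g \<in> carrier_mat (card (lcosets\<^bsub>G\<^esub> K)) (card (lcosets\<^bsub>G\<^esub> K))"
  by (simp add: coset_lattice_def Let_def)

context group
begin

lemma coset_enum_bij:
  assumes "finite (carrier G)"
  shows "bij_betw (coset_enum G K) {..<card (lcosets K)} (lcosets K)"
proof -
  have "finite (lcosets K)" using assms by (simp add: LCOSETS_def)
  then obtain h where "bij_betw h {0..<card (lcosets K)} (lcosets K)"
    using ex_bij_betw_nat_finite by blast
  then have "\<exists>h. bij_betw h {..<card (lcosets K)} (lcosets K)" by (auto simp: lessThan_atLeast0)
  then show ?thesis unfolding coset_enum_def by (rule someI_ex)
qed

lemma lcosets_iff: "C \<in> lcosets K \<longleftrightarrow> (\<exists>x\<in>carrier G. C = x <# K)"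
  by (auto simp: LCOSETS_def)

lemma lcosets_translate:
  assumes "subgroup K G" "C \<in> lcosets K" "g \<in> carrier G"
  shows "g <# C \<in> lcosets K"
proof -
  obtain x where x: "x \<in> carrier G" "C = x <# K" using assms(2) lcosets_iff by blast
  then have "g <# C = (g \<otimes> x) <# K" using lcos_m_assoc[OF subgroup.subset[OF assms(1)] assms(3)] by simp
  then show ?thesis using x assms(3) lcosets_iff by blast
qed

lemma lcos_one:
  assumes "subgroup K G" "C \<in> lcosets K"
  shows "\<one> <# C = C"
proof -
  obtain x where "x \<in> carrier G" "C = x <# K" using assms(2) lcosets_iff by blast
  then show ?thesis using lcos_m_assoc[OF subgroup.subset[OF assms(1)] one_closed] by simp
qed

lemma lcos_mult:
  assumes "subgroup K G" "C \<in> lcosets K" "g \<in> carrier G" "h \<in> carrier G"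
  shows "g <# (h <# C) = (g \<otimes> h) <# C"
proof -
  obtain x where x: "x \<in> carrier G" "C = x <# K" using assms(2) lcosets_iff by blast
  note a = lcos_m_assoc[OF subgroup.subset[OF assms(1)]]
  show ?thesis using x assms(3,4) by (simp add: a m_assoc)
qed

lemma lcos_inv_iff:
  assumes "subgroup K G" "C \<in> lcosets K" "D \<in> lcosets K" "g \<in> carrier G"
  shows "inv g <# C = D \<longleftrightarrow> C = g <# D"
proof
  show "C = g <# D" if "inv g <# C = D"
    using lcos_mult[OF assms(1,2,4) inv_closed[OF assms(4)]] lcos_one[OF assms(1,2)] that assms(4) by simp
  show "inv g <# C = D" if "C = g <# D"
    using lcos_mult[OF assms(1,3) inv_closed[OF assms(4)] assms(4)] lcos_one[OF assms(1,3)] that assms(4) by simp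
qed

lemma lcos_eq_iff:
  assumes "subgroup K G" "x \<in> carrier G" "y \<in> carrier G"
  shows "x <# K = y <# K \<longleftrightarrow> inv x \<otimes> y \<in> K"
proof
  assume "x <# K = y <# K"
  then have "y \<in> x <# K" using lcos_self[OF assms(3,1)] by simp
  then show "inv x \<otimes> y \<in> K" using subgroup.lcos_module_imp[OF assms(1) is_group assms(2)] by simp
next
  assume "inv x \<otimes> y \<in> K"
  moreover have "y = x \<otimes> (inv x \<otimes> y)" using assms by (simp add: m_assoc[symmetric])
  ultimately have "y \<in> x <# K" unfolding l_coset_def by blast
  then show "x <# K = y <# K" using l_repr_independence[OF _ assms(2,1)] by simp
qed

lemma lcoset_rep:
  assumes "C \<in> lcosets K"
  obtains x where "x \<in> carrier G" "C = x <# K"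
  using assms by (auto simp: lcosets_iff)

context
  fixes K assumes fin: "finite (carrier G)" and K: "subgroup K G"
begin

lemma coset_enum_in: "j < card (lcosets K) \<Longrightarrow> coset_enum G K j \<in> lcosets K"
  using coset_enum_bij[OF fin, of K] by (auto simp: bij_betw_def)

lemma coset_enum_eq_iff: "i < card (lcosets K) \<Longrightarrow> j < card (lcosets K) \<Longrightarrow>
    coset_enum G K i = coset_enum G K j \<longleftrightarrow> i = j"
  using coset_enum_bij[OF fin, of K] by (auto simp: bij_betw_def inj_on_def)

lemma coset_enum_ex: "C \<in> lcosets K \<Longrightarrow> \<exists>j<card (lcosets K). C = coset_enum G K j"
  using coset_enum_bij[OF fin, of K] by (auto simp: bij_betw_def)

lemma coset_vec_enum: "j < card (lcosets K) \<Longrightarrow> coset_vec G K (coset_enum G K j) = unit_vec (card (lcosets K)) j"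
  by (intro eq_vecI) (auto simp: coset_vec_def coset_enum_eq_iff)

lemma coset_lattice_action:
  assumes g: "g \<in> carrier G" and C: "C \<in> lcosets K"
  shows "snd (coset_lattice G K) g *\<^sub>v coset_vec G K C = coset_vec G K (g <# C)"
proof -
  let ?n = "card (lcosets K)" and ?e = "coset_enum G K"
  obtain j where j: "j < ?n" "C = ?e j" using coset_enum_ex[OF C] by blast
  have "snd (coset_lattice G K) g *\<^sub>v unit_vec ?n j = col (snd (coset_lattice G K) g) j"
    using j snd_coset_lattice_carrier[of G K g] by (intro eq_vecI) auto
  also have "\<dots> = coset_vec G K (g <# C)"
    using j by (intro eq_vecI) (auto simp: coset_lattice_def Let_def coset_vec_def)
  finally show ?thesis using j coset_vec_enum by simp
qed

lemma G_lattice_coset: "G_lattice G (coset_lattice G K)"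
  unfolding G_lattice_def
proof (intro conjI ballI)
  let ?n = "card (lcosets K)" and ?\<rho> = "snd (coset_lattice G K)"
  show c: "?\<rho> g \<in> carrier_mat (fst (coset_lattice G K)) (fst (coset_lattice G K))" for g
    using snd_coset_lattice_carrier[of G K g] by simp
  show "?\<rho> \<one> = 1\<^sub>m (fst (coset_lattice G K))"
  proof (rule mat_eq_on_unit_vecs[OF c])
    fix j assume "j < fst (coset_lattice G K)"
    then show "?\<rho> \<one> *\<^sub>v unit_vec (fst (coset_lattice G K)) j = 1\<^sub>m (fst (coset_lattice G K)) *\<^sub>v unit_vec (fst (coset_lattice G K)) j"
      using coset_lattice_action[of \<one> "coset_enum G K j"] coset_enum_in[of j] lcos_one[OF K]
      by (simp add: coset_vec_enum)
  qed simp
  fix g h assume g: "g \<in> carrier G" and h: "h \<in> carrier G"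
  show "?\<rho> (g \<otimes> h) = ?\<rho> g * ?\<rho> h"
  proof (rule mat_eq_on_unit_vecs[OF c])
    show "?\<rho> g * ?\<rho> h \<in> carrier_mat (fst (coset_lattice G K)) (fst (coset_lattice G K))"
      using c[of g] c[of h] by auto
    fix j assume j: "j < fst (coset_lattice G K)"
    then have C: "coset_enum G K j \<in> lcosets K" using coset_enum_in by simp
    have "?\<rho> (g \<otimes> h) *\<^sub>v coset_vec G K (coset_enum G K j) = ?\<rho> g *\<^sub>v (?\<rho> h *\<^sub>v coset_vec G K (coset_enum G K j))"
      using g h C by (simp add: coset_lattice_action lcosets_translate[OF K] lcos_mult[OF K])
    also have "\<dots> = (?\<rho> g * ?\<rho> h) *\<^sub>v coset_vec G K (coset_enum G K j)"
      by (rule assoc_mult_mat_vec[symmetric, OF snd_coset_lattice_carrier snd_coset_lattice_carrier]) simp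
    finally show "?\<rho> (g \<otimes> h) *\<^sub>v unit_vec (fst (coset_lattice G K)) j = (?\<rho> g * ?\<rho> h) *\<^sub>v unit_vec (fst (coset_lattice G K)) j"
      using j by (simp add: coset_vec_enum)
  qed
qed

lemma coset_lattice_span:
  assumes S: "int_submodule (card (lcosets K)) S" and "\<And>x. x \<in> carrier G \<Longrightarrow> coset_vec G K (x <# K) \<in> S"
  shows "S = carrier_vec (card (lcosets K))"
proof (rule int_submodule_eq_carrier[OF S])
  fix j assume j: "j < card (lcosets K)"
  obtain x where "x \<in> carrier G" "coset_enum G K j = x <# K" using coset_enum_in[OF j] lcoset_rep by blast
  then show "unit_vec (card (lcosets K)) j \<in> S" using assms(2) coset_vec_enum[OF j] by metis
qed

text \<open>Frobenius reciprocity: a homomorphism from Z[G/K] is determined by the image of the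
  coset K, and every vector fixed by K occurs as this image.\<close>

lemma coset_hom:
  assumes L: "G_lattice G L" and v: "v \<in> carrier_vec (fst L)" and inv: "\<And>k. k \<in> K \<Longrightarrow> snd L k *\<^sub>v v = v"
  obtains A where "G_hom G (coset_lattice G K) L A"
    "\<And>x. x \<in> carrier G \<Longrightarrow> A *\<^sub>v coset_vec G K (x <# K) = snd L x *\<^sub>v v"
proof -
  let ?n = "card (lcosets K)" and ?e = "coset_enum G K" and ?m = "fst L"
  have "\<forall>j. \<exists>x. j < ?n \<longrightarrow> x \<in> carrier G \<and> ?e j = x <# K"
    using coset_enum_in lcoset_rep by metis
  then obtain r where r: "\<And>j. j < ?n \<Longrightarrow> r j \<in> carrier G \<and> ?e j = r j <# K" by metis
  define A where "A = mat ?m ?n (\<lambda>(i,j). (snd L (r j) *\<^sub>v v) $ i)"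
  have cA: "A \<in> carrier_mat ?m ?n" by (simp add: A_def)
  have cv: "snd L g *\<^sub>v v \<in> carrier_vec ?m" if "g \<in> carrier G" for g
    using G_lattice_carrier[OF L that] v by simp
  have A: "A *\<^sub>v coset_vec G K (x <# K) = snd L x *\<^sub>v v" if x: "x \<in> carrier G" for x
  proof -
    have "x <# K \<in> lcosets K" using x lcosets_iff by blast
    then obtain j where j: "j < ?n" "x <# K = ?e j" using coset_enum_ex by blast
    have rj: "r j \<in> carrier G" "x <# K = r j <# K" using r j by auto
    \<comment> \<open>Two representatives of the same coset differ by an element of K, which fixes
      v; so the chosen \<open>r\<close> has no influence on the value.\<close>
    have k: "inv x \<otimes> r j \<in> K" using lcos_eq_iff[OF K x rj(1)] rj(2) by simp
    have kc: "inv x \<otimes> r j \<in> carrier G" using x rj by simp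
    have "A *\<^sub>v coset_vec G K (x <# K) = col A j"
      using j coset_vec_enum cA by (intro eq_vecI) auto
    also have "\<dots> = snd L (r j) *\<^sub>v v"
      using j carrier_vecD[OF cv[OF rj(1)]] by (intro eq_vecI) (simp_all add: A_def del: index_mult_mat_vec dim_mult_mat_vec)
    also have "r j = x \<otimes> (inv x \<otimes> r j)" using x rj(1) by (simp add: m_assoc[symmetric])
    also have "snd L \<dots> *\<^sub>v v = snd L x *\<^sub>v v"
      using G_lattice_mult_vec[OF L x kc v] inv[OF k] by simp
    finally show ?thesis .
  qed
  have "G_hom G (coset_lattice G K) L A" unfolding G_hom_def
  proof (intro conjI ballI)
    show "A \<in> carrier_mat (fst L) (fst (coset_lattice G K))" using cA by simp
    fix g assume g: "g \<in> carrier G"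
    note cg = snd_coset_lattice_carrier[of G K g]
    show "A * snd (coset_lattice G K) g = snd L g * A"
    proof (rule mat_eq_on_unit_vecs[of _ ?m ?n])
      show "A * snd (coset_lattice G K) g \<in> carrier_mat ?m ?n" using cA cg by simp
      show "snd L g * A \<in> carrier_mat ?m ?n" using cA G_lattice_carrier[OF L g] by simp
      fix j assume j: "j < ?n"
      obtain x where x: "x \<in> carrier G" "?e j = x <# K" using coset_enum_in[OF j] lcoset_rep by blast
      have u: "unit_vec ?n j = coset_vec G K (x <# K)" using coset_vec_enum[OF j] x by simp
      have "(A * snd (coset_lattice G K) g) *\<^sub>v coset_vec G K (x <# K) = A *\<^sub>v coset_vec G K (g <# (x <# K))"
        using assoc_mult_mat_vec[OF cA cg coset_vec_carrier] coset_lattice_action[OF g, of "x <# K"]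
          coset_enum_in[OF j] x by simp
      also have "g <# (x <# K) = (g \<otimes> x) <# K" using lcos_m_assoc subgroup.subset[OF K] g x by simp
      also have "A *\<^sub>v coset_vec G K \<dots> = snd L g *\<^sub>v (snd L x *\<^sub>v v)"
        using A g x G_lattice_mult_vec[OF L g x(1) v] by simp
      also have "\<dots> = (snd L g * A) *\<^sub>v coset_vec G K (x <# K)"
        using A[OF x(1)] assoc_mult_mat_vec[OF G_lattice_carrier[OF L g] cA coset_vec_carrier] by simp
      finally show "(A * snd (coset_lattice G K) g) *\<^sub>v unit_vec ?n j = (snd L g * A) *\<^sub>v unit_vec ?n j"
        by (simp add: u)
    qed
  qed
  with A that show ?thesis by blast
qed

end

end

section \<open>Quotients and flabby lattices\<close>

lemma minus_zero_mat: "(A :: int mat) \<in> carrier_mat m n \<Longrightarrow> A - 0\<^sub>m m n = A"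
  by (intro eq_matI) auto

lemma eq_of_minus_eq_zero:
  assumes "(v :: int vec) \<in> carrier_vec n" "w \<in> carrier_vec n" "v - w = 0\<^sub>v n"
  shows "v = w"
proof (rule eq_vecI)
  fix i assume "i < dim_vec w"
  then show "v $ i = w $ i" using arg_cong[OF assms(3), of "\<lambda>u. u $ i"] assms(1,2) by simp
qed (use assms in simp)

text \<open>The rows \<open>sel\<close> of i form an identity matrix, so the image of i is a direct
  summand and the quotient is free on the remaining coordinates. A homomorphism B that kills i
  factors through p, and the factor is B restricted along the section s.\<close>

lemma cokernel_lattice:
  assumes G: "group G" and M: "G_lattice G M" and P: "G_lattice G P" and i: "G_hom G M P i"
    and sel: "inj_on sel {..<fst M}" "sel ` {..<fst M} \<subseteq> {..<fst P}"
    and id: "\<And>a b. a < fst M \<Longrightarrow> b < fst M \<Longrightarrow> i $$ (sel a, b) = (if a = b then 1 else 0)"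
  obtains F p s where "short_exact G M P F i p" "fst F = fst P - fst M"
    "s \<in> carrier_mat (fst P) (fst F)"
    "\<And>L B. G_lattice G L \<Longrightarrow> G_hom G P L B \<Longrightarrow> B * i = 0\<^sub>m (fst L) (fst M) \<Longrightarrow>
       G_hom G F L (B * s) \<and> B * s * p = B"
proof -
  interpret group G by (rule G)
  let ?m = "fst M" and ?n = "fst P" and ?k = "fst P - fst M"
  let ?N = "{..<?n} - sel ` {..<?m}"
  have ci: "i \<in> carrier_mat ?n ?m" using i by (simp add: G_hom_def)
  have selb: "sel a < ?n" if "a < ?m" for a using sel(2) that by auto
  have "card ?N = card {..<?n} - card (sel ` {..<?m})"
    by (rule card_Diff_subset) (use sel(2) in auto)
  also have "\<dots> = ?k" unfolding card_image[OF sel(1)] by simp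
  finally obtain c where c: "bij_betw c {..<?k} ?N"
    using ex_bij_betw_nat_finite[of ?N] by (auto simp: lessThan_atLeast0)
  have cb: "c a < ?n" "c a \<notin> sel ` {..<?m}" if "a < ?k" for a
    using bij_betwE[OF c] that by auto
  have cinj: "c a = c b \<longleftrightarrow> a = b" if "a < ?k" "b < ?k" for a b
    using bij_betw_imp_inj_on[OF c] that by (auto simp: inj_on_def)
  \<comment> \<open>\<open>r\<close> reads off the coordinates \<open>sel\<close> and is a left
    inverse of i. The projection \<open>q\<close> kills the image of i; its rows at
    \<open>sel\<close> vanish, and the others form \<open>p\<close>. The matrix \<open>s\<close>
    puts the remaining coordinates back in place.\<close>
  define r :: "int mat" where "r = mat ?m ?n (\<lambda>(a,j). if j = sel a then 1 else 0)"
  define s :: "int mat" where "s = mat ?n ?k (\<lambda>(j,a). if j = c a then 1 else 0)"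
  define q where "q = 1\<^sub>m ?n - i * r"
  define p where "p = mat ?k ?n (\<lambda>(a,j). q $$ (c a, j))"
  have cr: "r \<in> carrier_mat ?m ?n" and cs: "s \<in> carrier_mat ?n ?k" and cq: "q \<in> carrier_mat ?n ?n"
    and cp: "p \<in> carrier_mat ?k ?n"
    using ci by (auto simp: r_def s_def q_def p_def)
  have cir: "i * r \<in> carrier_mat ?n ?n" using ci cr by simp
  have ri: "r * i = 1\<^sub>m ?m"
  proof (rule eq_matI)
    fix a b assume ab: "a < dim_row (1\<^sub>m ?m :: int mat)" "b < dim_col (1\<^sub>m ?m :: int mat)"
    have "(r * i) $$ (a, b) = (\<Sum>j<?n. r $$ (a, j) * i $$ (j, b))"
      using ab ci cr by (simp add: scalar_prod_def lessThan_atLeast0)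
    also have "\<dots> = (\<Sum>j<?n. (if j = sel a then i $$ (j, b) else 0))"
      using ab by (intro sum.cong) (auto simp: r_def)
    also have "\<dots> = i $$ (sel a, b)" using ab selb by (simp add: sum.delta)
    finally show "(r * i) $$ (a, b) = 1\<^sub>m ?m $$ (a, b)" using ab id by simp
  qed (use cr ci in auto)
  have q_sel: "q $$ (sel a, j) = 0" if a: "a < ?m" and j: "j < ?n" for a j
  proof -
    have "(i * r) $$ (sel a, j) = (\<Sum>b<?m. i $$ (sel a, b) * r $$ (b, j))"
      using a j ci cr selb[OF a] by (simp add: scalar_prod_def lessThan_atLeast0)
    also have "\<dots> = (\<Sum>b<?m. if b = a then r $$ (a, j) else 0)"
      using a id by (intro sum.cong) auto
    also have "\<dots> = r $$ (a, j)" using a by simp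
    finally show ?thesis using a j cir selb[OF a] by (auto simp: q_def r_def)
  qed
  have sp: "s * p = q"
  proof (rule eq_matI)
    fix j j' assume jj: "j < dim_row q" "j' < dim_col q"
    then have jn: "j < ?n" "j' < ?n" using cq by auto
    have sum: "(s * p) $$ (j, j') = (\<Sum>a<?k. if j = c a then q $$ (c a, j') else 0)"
    proof -
      have "(s * p) $$ (j, j') = (\<Sum>a<?k. s $$ (j, a) * p $$ (a, j'))"
        using jn cs cp by (simp add: scalar_prod_def lessThan_atLeast0)
      also have "\<dots> = (\<Sum>a<?k. if j = c a then q $$ (c a, j') else 0)"
        using jn by (intro sum.cong) (auto simp: s_def p_def)
      finally show ?thesis .
    qed
    show "(s * p) $$ (j, j') = q $$ (j, j')"
    proof (cases "j \<in> sel ` {..<?m}")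
      case True
      then have "j \<noteq> c a" if "a < ?k" for a using cb(2)[OF that] by metis
      then have "(s * p) $$ (j, j') = 0" unfolding sum by (intro sum.neutral) auto
      then show ?thesis using True q_sel jn by auto
    next
      case False
      then have "j \<in> c ` {..<?k}" using jn bij_betw_imp_surj_on[OF c] by simp
      then obtain a where a: "a < ?k" "j = c a" by auto
      have "(s * p) $$ (j, j') = (\<Sum>b<?k. if b = a then q $$ (c a, j') else 0)"
        unfolding sum using a cinj by (intro sum.cong) auto
      then show ?thesis using a by simp
    qed
  qed (use cs cp cq in auto)
  have ps: "p * s = 1\<^sub>m ?k"
  proof (rule eq_matI)
    fix a b assume ab: "a < dim_row (1\<^sub>m ?k :: int mat)" "b < dim_col (1\<^sub>m ?k :: int mat)"
    then have ab': "a < ?k" "b < ?k" by auto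
    have "(p * s) $$ (a, b) = (\<Sum>j<?n. p $$ (a, j) * s $$ (j, b))"
      using ab' cs cp by (simp add: scalar_prod_def lessThan_atLeast0)
    also have "\<dots> = (\<Sum>j<?n. if j = c b then q $$ (c a, j) else 0)"
      using ab' by (intro sum.cong) (auto simp: s_def p_def)
    also have "\<dots> = q $$ (c a, c b)" using cb[OF ab'(2)] by simp
    also have "\<dots> = (if a = b then 1 else 0)"
    proof -
      have "(i * r) $$ (c a, c b) = (\<Sum>l<?m. i $$ (c a, l) * r $$ (l, c b))"
        using cb(1)[OF ab'(1)] cb(1)[OF ab'(2)] ci cr by (simp add: scalar_prod_def lessThan_atLeast0)
      moreover have "r $$ (l, c b) = 0" if "l < ?m" for l
        using that cb[OF ab'(2)] by (auto simp: r_def)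
      ultimately have "(i * r) $$ (c a, c b) = 0" by simp
      moreover have "q $$ (c a, c b) = 1\<^sub>m ?n $$ (c a, c b) - (i * r) $$ (c a, c b)"
        unfolding q_def by (rule index_minus_mat(1)) (use cb(1)[OF ab'(1)] cb(1)[OF ab'(2)] ci cr in auto)
      ultimately show ?thesis
        using cb(1)[OF ab'(1)] cb(1)[OF ab'(2)] cinj[OF ab'] by simp
    qed
    finally show "(p * s) $$ (a, b) = 1\<^sub>m ?k $$ (a, b)" using ab by simp
  qed (use cs cp in auto)
  have pi0: "p * i = 0\<^sub>m ?k ?m"
  proof -
    have "p * i = (p * s) * (p * i)" using ps cp ci by simp
    also have "\<dots> = p * (s * p) * i"
      using assoc_mult_mat[OF cp cs mult_carrier_mat[OF cp ci]] assoc_mult_mat[OF cs cp ci]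
        assoc_mult_mat[OF cp mult_carrier_mat[OF cs cp] ci] by simp
    also have "\<dots> = p * (q * i)" using sp assoc_mult_mat[OF cp cq ci] by simp
    also have "q * i = i - i * r * i" unfolding q_def
      using minus_mult_distrib_mat[OF one_carrier_mat cir ci] left_mult_one_mat[OF ci] by simp
    also have "i * r * i = i" using assoc_mult_mat[OF ci cr ci] ri ci by simp
    also have "i - i = 0\<^sub>m ?n ?m" using ci by (intro eq_matI) auto
    also have "p * 0\<^sub>m ?n ?m = 0\<^sub>m ?k ?m" using cp by simp
    finally show ?thesis .
  qed
  define F where "F = (?k, \<lambda>g. p * snd P g * s)"
  have fstF: "fst F = ?k" by (simp add: F_def)
  note cP = G_lattice_carrier[OF P] and cM = G_lattice_carrier[OF M]
  have cF: "snd F g \<in> carrier_mat ?k ?k" if "g \<in> carrier G" for g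
    using cP[OF that] cp cs by (simp add: F_def)
  have pF: "p * snd P g = snd F g * p" if g: "g \<in> carrier G" for g
  proof -
    note cg = cP[OF g] and mg = cM[OF g]
    have cpg: "p * snd P g \<in> carrier_mat ?k ?n" using cp cg by simp
    have "snd F g * p = (p * snd P g) * (s * p)"
      unfolding F_def snd_conv by (rule assoc_mult_mat[OF cpg cs cp])
    \<comment> \<open>Equivariance of i enters here: p kills the image of i, which is stable under
      g, so the correction term i r contributes nothing.\<close>
    also have "\<dots> = p * snd P g - (p * snd P g) * (i * r)"
      unfolding sp q_def using mult_minus_distrib_mat[OF cpg one_carrier_mat cir] right_mult_one_mat[OF cpg] by simp
    also have "(p * snd P g) * (i * r) = p * (snd P g * i) * r"
      using assoc_mult_mat[OF cpg ci cr] assoc_mult_mat[OF cp cg ci] by simp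
    also have "snd P g * i = i * snd M g" using i g by (simp add: G_hom_def)
    also have "p * (i * snd M g) = 0\<^sub>m ?k ?m"
      using assoc_mult_mat[OF cp ci mg] pi0 mg by simp
    also have "0\<^sub>m ?k ?m * r = 0\<^sub>m ?k ?n" using cr by simp
    also have "p * snd P g - 0\<^sub>m ?k ?n = p * snd P g" by (rule minus_zero_mat[OF cpg])
    finally show ?thesis by simp
  qed
  have F: "G_lattice G F" unfolding G_lattice_def fstF
  proof (intro conjI ballI)
    show "snd F g \<in> carrier_mat ?k ?k" if "g \<in> carrier G" for g by (rule cF[OF that])
    show "snd F \<one>\<^bsub>G\<^esub> = 1\<^sub>m ?k" using P ps cp by (simp add: F_def G_lattice_def)
    fix g h assume g: "g \<in> carrier G" and h: "h \<in> carrier G"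
    have "snd F g * snd F h = snd F g * (p * (snd P h * s))"
      using assoc_mult_mat[OF cp cP[OF h] cs] by (simp add: F_def)
    also have "\<dots> = (snd F g * p) * (snd P h * s)"
      by (rule assoc_mult_mat[symmetric, OF cF[OF g] cp]) (use cP[OF h] cs in auto)
    also have "\<dots> = (p * snd P g) * (snd P h * s)" using pF[OF g] by simp
    also have "\<dots> = (p * snd P g * snd P h) * s"
      by (rule assoc_mult_mat[symmetric, OF _ cP[OF h] cs]) (use cP[OF g] cp in auto)
    also have "p * snd P g * snd P h = p * (snd P g * snd P h)"
      by (rule assoc_mult_mat[OF cp cP[OF g] cP[OF h]])
    also have "snd P g * snd P h = snd P (g \<otimes>\<^bsub>G\<^esub> h)" using P g h by (simp add: G_lattice_def)
    finally show "snd F (g \<otimes>\<^bsub>G\<^esub> h) = snd F g * snd F h" by (simp add: F_def)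
  qed
  have v_eq: "v = i *\<^sub>v (r *\<^sub>v v)" if v: "v \<in> carrier_vec ?n" and pv: "p *\<^sub>v v = 0\<^sub>v ?k" for v
  proof -
    have "q *\<^sub>v v = s *\<^sub>v (p *\<^sub>v v)" using assoc_mult_mat_vec[OF cs cp v] sp by simp
    also have "\<dots> = 0\<^sub>v ?n" using pv mult_zero_vec[OF cs] by simp
    finally have "q *\<^sub>v v = 0\<^sub>v ?n" .
    moreover have "q *\<^sub>v v = v - (i * r) *\<^sub>v v"
      unfolding q_def using minus_mult_distrib_mat_vec[OF one_carrier_mat cir v] v by simp
    moreover have "(i * r) *\<^sub>v v = i *\<^sub>v (r *\<^sub>v v)" by (rule assoc_mult_mat_vec[OF ci cr v])
    ultimately have "v - i *\<^sub>v (r *\<^sub>v v) = 0\<^sub>v ?n" by simp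
    moreover have c: "i *\<^sub>v (r *\<^sub>v v) \<in> carrier_vec ?n" using ci cr v by (meson mult_mat_vec_carrier)
    ultimately show ?thesis using eq_of_minus_eq_zero[OF v c] by simp
  qed
  have "short_exact G M P F i p" unfolding short_exact_def fstF
  proof (intro conjI ballI impI iffI M P F i)
    show "G_hom G P F p" using pF cp fstF by (simp add: G_hom_def)
    show "v = 0\<^sub>v ?m" if v: "v \<in> carrier_vec ?m" and "i *\<^sub>v v = 0\<^sub>v ?n" for v
    proof -
      have "v = (r * i) *\<^sub>v v" using ri v by simp
      also have "\<dots> = r *\<^sub>v (i *\<^sub>v v)" by (rule assoc_mult_mat_vec[OF cr ci v])
      finally show ?thesis using that mult_zero_vec[OF cr] by simp
    qed
    show "\<exists>v\<in>carrier_vec ?n. p *\<^sub>v v = w" if w: "w \<in> carrier_vec ?k" for w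
    proof
      show "s *\<^sub>v w \<in> carrier_vec ?n" using cs w by simp
      show "p *\<^sub>v (s *\<^sub>v w) = w" using assoc_mult_mat_vec[OF cp cs w] ps w by simp
    qed
    show "\<exists>u\<in>carrier_vec ?m. v = i *\<^sub>v u" if "v \<in> carrier_vec ?n" "p *\<^sub>v v = 0\<^sub>v ?k" for v
      using v_eq[OF that] cr that by (meson mult_mat_vec_carrier)
    show "p *\<^sub>v v = 0\<^sub>v ?k" if ex: "\<exists>u\<in>carrier_vec ?m. v = i *\<^sub>v u" for v
    proof -
      obtain u where u: "u \<in> carrier_vec ?m" "v = i *\<^sub>v u" using ex by blast
      have "p *\<^sub>v v = (p * i) *\<^sub>v u" using assoc_mult_mat_vec[OF cp ci u(1)] u by simp
      also have "\<dots> = 0\<^sub>v ?k" unfolding pi0 using u by (intro eq_vecI) auto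
      finally show ?thesis .
    qed
  qed
  moreover have "G_hom G F L (B * s) \<and> B * s * p = B"
    if L: "G_lattice G L" and B: "G_hom G P L B" and Bi: "B * i = 0\<^sub>m (fst L) ?m" for L B
  proof -
    have cB: "B \<in> carrier_mat (fst L) ?n" using B by (simp add: G_hom_def)
    have cBs: "B * s \<in> carrier_mat (fst L) ?k" using cB cs by simp
    have "B * s * p = B * q" using assoc_mult_mat[OF cB cs cp] sp by simp
    also have "\<dots> = B - B * (i * r)" unfolding q_def
      using mult_minus_distrib_mat[OF cB one_carrier_mat cir] right_mult_one_mat[OF cB] by simp
    also have "B * (i * r) = 0\<^sub>m (fst L) ?n" using assoc_mult_mat[OF cB ci cr] Bi cr by simp
    also have "B - 0\<^sub>m (fst L) ?n = B" by (rule minus_zero_mat[OF cB])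
    finally have Bsp: "B * s * p = B" .
    have "B * s * snd F g = snd L g * (B * s)" if g: "g \<in> carrier G" for g
    proof -
      have "B * s * snd F g = B * s * (p * (snd P g * s))"
        using assoc_mult_mat[OF cp cP[OF g] cs] by (simp add: F_def)
      also have "\<dots> = (B * s * p) * (snd P g * s)"
        by (rule assoc_mult_mat[symmetric, OF cBs cp]) (use cP[OF g] cs in auto)
      also have "\<dots> = B * snd P g * s" unfolding Bsp
        by (rule assoc_mult_mat[symmetric, OF cB cP[OF g] cs])
      also have "B * snd P g = snd L g * B" using B g by (simp add: G_hom_def)
      also have "snd L g * B * s = snd L g * (B * s)"
        by (rule assoc_mult_mat[OF G_lattice_carrier[OF L g] cB cs])
      finally show ?thesis .
    qed
    then have "G_hom G F L (B * s)" using cBs fstF by (simp add: G_hom_def)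
    then show ?thesis using Bsp by simp
  qed
  ultimately show ?thesis using that[of F p s] fstF cs by simp
qed

section \<open>Flabbiness of retracts and of permutation lattices\<close>

lemma mult_vec_sum_components:
  fixes A :: "int mat"
  assumes A: "A \<in> carrier_mat m n" and f: "\<And>h. h \<in> K \<Longrightarrow> f h \<in> carrier_vec n"
  shows "A *\<^sub>v vec n (\<lambda>a. \<Sum>h\<in>K. f h $ a) = vec m (\<lambda>a. \<Sum>h\<in>K. (A *\<^sub>v f h) $ a)"
proof (rule eq_vecI)
  fix a assume "a < dim_vec (vec m (\<lambda>a. \<Sum>h\<in>K. (A *\<^sub>v f h) $ a))"
  then have a: "a < m" by simp
  have "(A *\<^sub>v vec n (\<lambda>a. \<Sum>h\<in>K. f h $ a)) $ a = (\<Sum>b<n. A $$ (a, b) * (\<Sum>h\<in>K. f h $ b))"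
    using a A by (simp add: scalar_prod_def lessThan_atLeast0)
  also have "\<dots> = (\<Sum>b<n. \<Sum>h\<in>K. A $$ (a, b) * f h $ b)" by (simp add: sum_distrib_left)
  also have "\<dots> = (\<Sum>h\<in>K. \<Sum>b<n. A $$ (a, b) * f h $ b)" by (rule sum.swap)
  also have "\<dots> = (\<Sum>h\<in>K. (A *\<^sub>v f h) $ a)"
  proof (rule sum.cong[OF refl])
    fix h assume "h \<in> K"
    then have "dim_vec (f h) = n" using f by auto
    then show "(\<Sum>b<n. A $$ (a, b) * f h $ b) = (A *\<^sub>v f h) $ a"
      using a A by (auto simp: scalar_prod_def lessThan_atLeast0 intro!: sum.cong)
  qed
  finally show "(A *\<^sub>v vec n (\<lambda>a. \<Sum>h\<in>K. f h $ a)) $ a = vec m (\<lambda>a. \<Sum>h\<in>K. (A *\<^sub>v f h) $ a) $ a"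
    using a by simp
qed (use A in auto)

text \<open>The inclusion carries a vector of norm zero to a vector of norm zero of Q. There it is a
  sum of elements (h - 1) y, and the retraction carries this expression back to F.\<close>

lemma flabby_retract:
  assumes Q: "flabby G Q" and F: "G_lattice G F" and \<iota>: "G_hom G F Q \<iota>" and \<pi>: "G_hom G Q F \<pi>"
    and \<pi>\<iota>: "\<pi> * \<iota> = 1\<^sub>m (fst F)"
  shows "flabby G F"
  unfolding flabby_def
proof (intro conjI allI impI ballI F)
  let ?m = "fst Q" and ?n = "fst F"
  have LQ: "G_lattice G Q" using Q by (simp add: flabby_def)
  have c\<iota>: "\<iota> \<in> carrier_mat ?m ?n" and c\<pi>: "\<pi> \<in> carrier_mat ?n ?m" using \<iota> \<pi> by (auto simp: G_hom_def)
  fix K x assume K: "subgroup K G" and x: "x \<in> carrier_vec ?n"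
    and norm: "vec ?n (\<lambda>i. \<Sum>h\<in>K. (snd F h *\<^sub>v x) $ i) = 0\<^sub>v ?n"
  have KG: "h \<in> carrier G" if "h \<in> K" for h using subgroup.subset[OF K] that by blast
  have \<iota>x: "\<iota> *\<^sub>v x \<in> carrier_vec ?m" using c\<iota> x by simp
  have "vec ?m (\<lambda>i. \<Sum>h\<in>K. (snd Q h *\<^sub>v (\<iota> *\<^sub>v x)) $ i) = vec ?m (\<lambda>i. \<Sum>h\<in>K. (\<iota> *\<^sub>v (snd F h *\<^sub>v x)) $ i)"
    using G_hom_mult_vec[OF F LQ \<iota> KG x] by (intro eq_vecI) simp_all
  also have "\<dots> = \<iota> *\<^sub>v vec ?n (\<lambda>i. \<Sum>h\<in>K. (snd F h *\<^sub>v x) $ i)"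
    by (rule mult_vec_sum_components[symmetric, OF c\<iota>]) (use KG G_lattice_carrier[OF F] x in \<open>meson mult_mat_vec_carrier\<close>)
  also have "\<dots> = 0\<^sub>v ?m" unfolding norm by (rule mult_zero_vec[OF c\<iota>])
  finally obtain y where y: "\<And>h. h \<in> K \<Longrightarrow> y h \<in> carrier_vec ?m"
    and \<iota>y: "\<iota> *\<^sub>v x = vec ?m (\<lambda>i. \<Sum>h\<in>K. ((snd Q h - 1\<^sub>m ?m) *\<^sub>v y h) $ i)"
    using Q K \<iota>x unfolding flabby_def by blast
  have cQ1: "snd Q h - 1\<^sub>m ?m \<in> carrier_mat ?m ?m" if "h \<in> K" for h
    by (rule minus_carrier_mat) simp
  have "x = \<pi> *\<^sub>v (\<iota> *\<^sub>v x)" using assoc_mult_mat_vec[OF c\<pi> c\<iota> x] \<pi>\<iota> x by simp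
  also have "\<dots> = vec ?n (\<lambda>i. \<Sum>h\<in>K. (\<pi> *\<^sub>v ((snd Q h - 1\<^sub>m ?m) *\<^sub>v y h)) $ i)"
    unfolding \<iota>y by (rule mult_vec_sum_components[OF c\<pi>]) (use cQ1 y in \<open>meson mult_mat_vec_carrier\<close>)
  also have "\<dots> = vec ?n (\<lambda>i. \<Sum>h\<in>K. ((snd F h - 1\<^sub>m ?n) *\<^sub>v (\<pi> *\<^sub>v y h)) $ i)"
  proof -
    have "\<pi> *\<^sub>v ((snd Q h - 1\<^sub>m ?m) *\<^sub>v y h) = (snd F h - 1\<^sub>m ?n) *\<^sub>v (\<pi> *\<^sub>v y h)" if h: "h \<in> K" for h
    proof -
      note cQ = G_lattice_carrier[OF LQ KG[OF h]] and cF = G_lattice_carrier[OF F KG[OF h]]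
      have \<pi>y: "\<pi> *\<^sub>v y h \<in> carrier_vec ?n" using c\<pi> y[OF h] by simp
      have "\<pi> *\<^sub>v ((snd Q h - 1\<^sub>m ?m) *\<^sub>v y h) = \<pi> *\<^sub>v (snd Q h *\<^sub>v y h - y h)"
        using minus_mult_distrib_mat_vec[OF cQ one_carrier_mat y[OF h]] y[OF h] by simp
      also have "\<dots> = \<pi> *\<^sub>v (snd Q h *\<^sub>v y h) - \<pi> *\<^sub>v y h"
        by (rule mult_minus_distrib_mat_vec[OF c\<pi> _ y[OF h]]) (use cQ y[OF h] in simp)
      also have "\<dots> = snd F h *\<^sub>v (\<pi> *\<^sub>v y h) - \<pi> *\<^sub>v y h"
        using G_hom_mult_vec[OF LQ F \<pi> KG[OF h] y[OF h]] by simp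
      also have "\<dots> = (snd F h - 1\<^sub>m ?n) *\<^sub>v (\<pi> *\<^sub>v y h)"
        using minus_mult_distrib_mat_vec[OF cF one_carrier_mat \<pi>y] \<pi>y by simp
      finally show ?thesis .
    qed
    then show ?thesis by (intro eq_vecI) simp_all
  qed
  finally show "\<exists>y. (\<forall>h\<in>K. y h \<in> carrier_vec ?n) \<and>
             x = vec ?n (\<lambda>i. \<Sum>h\<in>K. ((snd F h - 1\<^sub>m ?n) *\<^sub>v y h) $ i)"
    using c\<pi> y by (intro exI[of _ "\<lambda>h. \<pi> *\<^sub>v y h"]) auto
qed

text \<open>A property of the given matrices, not of an isomorphism class. It passes to direct sums
  at once and suffices for flabbiness.\<close>

definition permutes_basis :: "('g, 'c) monoid_scheme \<Rightarrow> 'g lattice \<Rightarrow> bool" where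
  "permutes_basis G L \<longleftrightarrow> (\<forall>g\<in>carrier G. \<forall>j<fst L. \<exists>i<fst L. snd L g *\<^sub>v unit_vec (fst L) j = unit_vec (fst L) i)"

lemma (in group) permutes_basis_coset:
  assumes fin: "finite (carrier G)" and K: "subgroup K G"
  shows "permutes_basis G (coset_lattice G K)"
  unfolding permutes_basis_def
proof (intro ballI allI impI)
  fix g j assume g: "g \<in> carrier G" and "j < fst (coset_lattice G K)"
  then have j: "j < card (lcosets K)" by simp
  note C = coset_enum_in[OF fin K j]
  obtain i where i: "i < card (lcosets K)" "g <# coset_enum G K j = coset_enum G K i"
    using coset_enum_ex[OF fin K lcosets_translate[OF K C g]] by blast
  have "snd (coset_lattice G K) g *\<^sub>v unit_vec (card (lcosets K)) j = unit_vec (card (lcosets K)) i"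
    using coset_lattice_action[OF fin K g C] coset_vec_enum[OF fin K j] coset_vec_enum[OF fin K i(1)] i(2) by simp
  then show "\<exists>i<fst (coset_lattice G K). snd (coset_lattice G K) g *\<^sub>v unit_vec (fst (coset_lattice G K)) j = unit_vec (fst (coset_lattice G K)) i"
    using i(1) by auto
qed

lemma permutes_basis_dsum:
  assumes G: "group G" and "\<And>L. L \<in> set Ls \<Longrightarrow> G_lattice G L" "\<And>L. L \<in> set Ls \<Longrightarrow> permutes_basis G L"
  shows "permutes_basis G (lat_dsum Ls)"
  using assms(2,3)
proof (induction Ls)
  case Nil
  show ?case by (simp add: permutes_basis_def)
next
  case (Cons L Ls)
  have L: "G_lattice G L" "permutes_basis G L" and M: "G_lattice G (lat_dsum Ls)" "permutes_basis G (lat_dsum Ls)"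
    using Cons G_lattice_dsum[OF G] by auto
  let ?m = "fst L" and ?n = "fst (lat_dsum Ls)"
  show ?case unfolding permutes_basis_def fst_lat_dsum_Cons
  proof (intro ballI allI impI)
    fix g j assume g: "g \<in> carrier G" and j: "j < ?m + ?n"
    note cL = G_lattice_carrier[OF L(1) g] and cM = G_lattice_carrier[OF M(1) g]
    note act = dsum_action[OF L(1) M(1) g]
    show "\<exists>i<?m + ?n. snd (lat_dsum (L # Ls)) g *\<^sub>v unit_vec (?m + ?n) j = unit_vec (?m + ?n) i"
    proof (cases "j < ?m")
      case True
      then obtain i where i: "i < ?m" "snd L g *\<^sub>v unit_vec ?m j = unit_vec ?m i"
        using L(2) g by (auto simp: permutes_basis_def)
      then have "snd (lat_dsum (L # Ls)) g *\<^sub>v unit_vec (?m + ?n) j = unit_vec (?m + ?n) i"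
        using True act[of "unit_vec ?m j" "0\<^sub>v ?n"] mult_zero_vec[OF cM] by (simp add: unit_vec_append)
      then show ?thesis using i by (intro exI[of _ i]) simp
    next
      case False
      then have "j - ?m < ?n" using j by simp
      then obtain i where i: "i < ?n" "snd (lat_dsum Ls) g *\<^sub>v unit_vec ?n (j - ?m) = unit_vec ?n i"
        using M(2) g unfolding permutes_basis_def by blast
      then have "snd (lat_dsum (L # Ls)) g *\<^sub>v unit_vec (?m + ?n) j = unit_vec (?m + ?n) (?m + i)"
        using False j act[of "0\<^sub>v ?m" "unit_vec ?n (j - ?m)"] mult_zero_vec[OF cL] by (simp add: unit_vec_append)
      then show ?thesis using i by (intro exI[of _ "?m + i"]) simp
    qed
  qed
qed

text \<open>With \<open>A h\<close> the action of h minus the identity this is the subgroup I_K F in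
  the definition of \<open>flabby\<close>. One free vector \<open>y h\<close> for each h makes the
  set closed under addition.\<close>

lemma int_submodule_augmentation:
  assumes c: "\<And>h. h \<in> K \<Longrightarrow> A h \<in> carrier_mat n n"
  shows "int_submodule n {vec n (\<lambda>i. \<Sum>h\<in>K. (A h *\<^sub>v y h) $ i) |y. \<forall>h\<in>K. y h \<in> carrier_vec n}"
    (is "int_submodule n ?S")
  unfolding int_submodule_def
proof (intro conjI ballI allI)
  show "?S \<subseteq> carrier_vec n" by auto
  have "0\<^sub>v n = vec n (\<lambda>i. \<Sum>h\<in>K. (A h *\<^sub>v 0\<^sub>v n) $ i)"
  proof (rule eq_vecI)
    fix i assume "i < dim_vec (vec n (\<lambda>i. \<Sum>h\<in>K. (A h *\<^sub>v 0\<^sub>v n) $ i))"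
    then show "0\<^sub>v n $ i = vec n (\<lambda>i. \<Sum>h\<in>K. (A h *\<^sub>v 0\<^sub>v n) $ i) $ i"
      using mult_zero_vec[OF c] by (simp del: index_mult_mat_vec)
  qed simp
  then show "0\<^sub>v n \<in> ?S" unfolding mem_Collect_eq by (intro exI[of _ "\<lambda>h. 0\<^sub>v n"] conjI) auto
next
  fix x x' assume "x \<in> ?S" "x' \<in> ?S"
  then obtain y y' where y: "\<forall>h\<in>K. y h \<in> carrier_vec n" "x = vec n (\<lambda>i. \<Sum>h\<in>K. (A h *\<^sub>v y h) $ i)"
    and y': "\<forall>h\<in>K. y' h \<in> carrier_vec n" "x' = vec n (\<lambda>i. \<Sum>h\<in>K. (A h *\<^sub>v y' h) $ i)" by blast
  have "x + x' = vec n (\<lambda>i. \<Sum>h\<in>K. (A h *\<^sub>v (y h + y' h)) $ i)"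
  proof (rule eq_vecI)
    fix i assume "i < dim_vec (vec n (\<lambda>i. \<Sum>h\<in>K. (A h *\<^sub>v (y h + y' h)) $ i))"
    then have i: "i < n" by simp
    have "(A h *\<^sub>v (y h + y' h)) $ i = (A h *\<^sub>v y h) $ i + (A h *\<^sub>v y' h) $ i" if "h \<in> K" for h
    proof -
      have "A h *\<^sub>v (y h + y' h) = A h *\<^sub>v y h + A h *\<^sub>v y' h"
        using mult_add_distrib_mat_vec[OF c[OF that]] y(1) y'(1) that by blast
      then show ?thesis using i c[OF that] by simp
    qed
    then show "(x + x') $ i = vec n (\<lambda>i. \<Sum>h\<in>K. (A h *\<^sub>v (y h + y' h)) $ i) $ i"
      using i by (simp add: y(2) y'(2) sum.distrib del: index_mult_mat_vec)
  qed (simp add: y(2) y'(2))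
  then show "x + x' \<in> ?S" unfolding mem_Collect_eq
    using y(1) y'(1) by (intro exI[of _ "\<lambda>h. y h + y' h"] conjI) auto
next
  fix k x assume "x \<in> ?S"
  then obtain y where y: "\<forall>h\<in>K. y h \<in> carrier_vec n" "x = vec n (\<lambda>i. \<Sum>h\<in>K. (A h *\<^sub>v y h) $ i)" by blast
  have "k \<cdot>\<^sub>v x = vec n (\<lambda>i. \<Sum>h\<in>K. (A h *\<^sub>v (k \<cdot>\<^sub>v y h)) $ i)"
  proof (rule eq_vecI)
    fix i assume "i < dim_vec (vec n (\<lambda>i. \<Sum>h\<in>K. (A h *\<^sub>v (k \<cdot>\<^sub>v y h)) $ i))"
    then have i: "i < n" by simp
    have "(A h *\<^sub>v (k \<cdot>\<^sub>v y h)) $ i = k * (A h *\<^sub>v y h) $ i" if "h \<in> K" for h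
      using i c[OF that] bspec[OF y(1) that] by simp
    then show "(k \<cdot>\<^sub>v x) $ i = vec n (\<lambda>i. \<Sum>h\<in>K. (A h *\<^sub>v (k \<cdot>\<^sub>v y h)) $ i) $ i"
      using i by (simp add: y(2) sum_distrib_left del: index_mult_mat_vec)
  qed (simp add: y(2))
  then show "k \<cdot>\<^sub>v x \<in> ?S" unfolding mem_Collect_eq
    using y(1) by (intro exI[of _ "\<lambda>h. k \<cdot>\<^sub>v y h"] conjI) auto
qed

text \<open>On each orbit of a subgroup the coordinates of a vector of norm zero add up to zero, so the
  vector is a combination of differences of a basis vector and the representative of its orbit.\<close>

lemma (in group) flabby_permutes_basis:
  assumes fin: "finite (carrier G)" and L: "G_lattice G L" and perm: "permutes_basis G L"
  shows "flabby G L"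
  unfolding flabby_def
proof (intro conjI allI impI ballI L)
  let ?n = "fst L" and ?\<rho> = "snd L"
  fix K x assume K: "subgroup K G" and x: "x \<in> carrier_vec ?n"
    and norm: "vec ?n (\<lambda>i. \<Sum>h\<in>K. (?\<rho> h *\<^sub>v x) $ i) = 0\<^sub>v ?n"
  have KG: "h \<in> carrier G" if "h \<in> K" for h using subgroup.subset[OF K] that by blast
  have finK: "finite K" using finite_subset[OF subgroup.subset[OF K] fin] .
  note cL = G_lattice_carrier[OF L]
  have "\<forall>g j. \<exists>i. g \<in> carrier G \<and> j < ?n \<longrightarrow> i < ?n \<and> ?\<rho> g *\<^sub>v unit_vec ?n j = unit_vec ?n i"
    using perm unfolding permutes_basis_def by metis
  then obtain \<sigma> where \<sigma>: "\<And>g j. g \<in> carrier G \<Longrightarrow> j < ?n \<Longrightarrow> \<sigma> g j < ?n"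
    and \<rho>: "\<And>g j. g \<in> carrier G \<Longrightarrow> j < ?n \<Longrightarrow> ?\<rho> g *\<^sub>v unit_vec ?n j = unit_vec ?n (\<sigma> g j)"
    by metis
  have uv: "unit_vec ?n i = (unit_vec ?n j :: int vec) \<Longrightarrow> i < ?n \<Longrightarrow> j < ?n \<Longrightarrow> i = j" for i j
    by (metis index_unit_vec(1) zero_neq_one)
  have \<sigma>_mult: "\<sigma> (g \<otimes> h) j = \<sigma> g (\<sigma> h j)" if g: "g \<in> carrier G" and h: "h \<in> carrier G" and j: "j < ?n" for g h j
  proof (rule uv)
    have "unit_vec ?n (\<sigma> (g \<otimes> h) j) = ?\<rho> (g \<otimes> h) *\<^sub>v unit_vec ?n j" using \<rho> g h j by simp
    also have "\<dots> = ?\<rho> g *\<^sub>v (?\<rho> h *\<^sub>v unit_vec ?n j)" by (rule G_lattice_mult_vec[OF L g h]) simp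
    also have "\<dots> = unit_vec ?n (\<sigma> g (\<sigma> h j))" using \<rho> \<sigma> g h j by simp
    finally show "unit_vec ?n (\<sigma> (g \<otimes> h) j) = (unit_vec ?n (\<sigma> g (\<sigma> h j)) :: int vec)" .
  qed (use \<sigma> g h j in auto)
  have \<sigma>_one: "\<sigma> \<one> j = j" if j: "j < ?n" for j
  proof (rule uv)
    show "unit_vec ?n (\<sigma> \<one> j) = (unit_vec ?n j :: int vec)"
      using \<rho>[OF one_closed j] L by (simp add: G_lattice_def)
  qed (use \<sigma> j in auto)
  have \<sigma>_inv: "\<sigma> (inv g) i = j \<longleftrightarrow> i = \<sigma> g j" if "g \<in> carrier G" "i < ?n" "j < ?n" for g i j
    using \<sigma>_mult[of g "inv g" i] \<sigma>_mult[of "inv g" g j] \<sigma>_one that by auto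
  have entry: "(?\<rho> g *\<^sub>v x) $ a = x $ (\<sigma> (inv g) a)" if g: "g \<in> carrier G" and a: "a < ?n" for g a
  proof -
    have e: "?\<rho> g $$ (a, i) = (if \<sigma> (inv g) a = i then 1 else 0)" if i: "i < ?n" for i
    proof -
      have "?\<rho> g $$ (a, i) = (?\<rho> g *\<^sub>v unit_vec ?n i) $ a" using a i cL[OF g] by simp
      then show ?thesis using \<rho>[OF g i] a i \<sigma>[OF g i] \<sigma>_inv[OF g a i] by auto
    qed
    have "(?\<rho> g *\<^sub>v x) $ a = (\<Sum>i<?n. ?\<rho> g $$ (a, i) * x $ i)"
      using a x cL[OF g] by (simp add: scalar_prod_def lessThan_atLeast0)
    also have "\<dots> = (\<Sum>i<?n. if i = \<sigma> (inv g) a then x $ i else 0)" using e by (intro sum.cong) auto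
    finally show ?thesis using \<sigma>[of "inv g" a] g a by simp
  qed
  define orb where "orb a = (\<lambda>h. \<sigma> h a) ` K" for a
  have orb_n: "orb a \<subseteq> {..<?n}" if "a < ?n" for a using \<sigma> KG that by (auto simp: orb_def)
  have orb_self: "a \<in> orb a" if "a < ?n" for a
    unfolding orb_def using \<sigma>_one[OF that] subgroup.one_closed[OF K] by force
  have orb_sub: "orb b \<subseteq> orb a" if a: "a < ?n" and b: "b \<in> orb a" for a b
  proof
    fix c assume "c \<in> orb b"
    then obtain h k where hk: "h \<in> K" "k \<in> K" "c = \<sigma> h b" "b = \<sigma> k a" using b by (auto simp: orb_def)
    then have "c = \<sigma> (h \<otimes> k) a" using \<sigma>_mult KG a by simp
    then show "c \<in> orb a" using hk subgroup.m_closed[OF K] by (auto simp: orb_def)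
  qed
  have orb_sym: "a \<in> orb b" if a: "a < ?n" and b: "b \<in> orb a" for a b
  proof -
    obtain k where k: "k \<in> K" "b = \<sigma> k a" using b by (auto simp: orb_def)
    then have "\<sigma> (inv k) b = a" using \<sigma>_inv[OF KG[OF k(1)] _ a, of b] \<sigma> KG a by simp
    then show ?thesis unfolding orb_def using k subgroup.m_inv_closed[OF K] by blast
  qed
  have orb_eq: "orb b = orb a" if a: "a < ?n" and b: "b \<in> orb a" for a b
    using orb_sub[OF a b] orb_sub[OF _ orb_sym[OF a b]] orb_n[OF a] b by auto
  have orb_sum: "(\<Sum>b\<in>orb a. x $ b) = 0" if a: "a < ?n" for a
  proof -
    \<comment> \<open>Each point of the orbit of a is reached from a by the same number of elements
      of K, so the norm at a is this number times the sum of x over the orbit. The integers have no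
      torsion, hence the orbit sum itself vanishes.\<close>
    define stab where "stab = {h \<in> K. \<sigma> h a = a}"
    have fib: "card {h \<in> K. \<sigma> h a = b} = card stab" if b: "b \<in> orb a" for b
    proof -
      obtain k where k: "k \<in> K" "b = \<sigma> k a" using b by (auto simp: orb_def)
      have "bij_betw (\<lambda>h. k \<otimes> h) stab {h \<in> K. \<sigma> h a = b}"
      proof (rule bij_betwI[where g = "\<lambda>h. inv k \<otimes> h"])
        show "(\<lambda>h. k \<otimes> h) \<in> stab \<rightarrow> {h \<in> K. \<sigma> h a = b}"
          using k \<sigma>_mult KG a subgroup.m_closed[OF K] by (auto simp: stab_def)
        show "(\<lambda>h. inv k \<otimes> h) \<in> {h \<in> K. \<sigma> h a = b} \<rightarrow> stab"
        proof
          fix h assume h: "h \<in> {h \<in> K. \<sigma> h a = b}"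
          have "\<sigma> (inv k \<otimes> h) a = \<sigma> (inv k) b" using h \<sigma>_mult[of "inv k" h a] KG k a by simp
          also have "\<dots> = a" using \<sigma>_inv[OF KG[OF k(1)] _ a, of b] k \<sigma> KG a by simp
          finally show "inv k \<otimes> h \<in> stab"
            using h k subgroup.m_closed[OF K] subgroup.m_inv_closed[OF K] by (simp add: stab_def)
        qed
        show "inv k \<otimes> (k \<otimes> h) = h" if "h \<in> stab" for h
          using that k KG by (simp add: stab_def m_assoc[symmetric])
        show "k \<otimes> (inv k \<otimes> h) = h" if "h \<in> {h \<in> K. \<sigma> h a = b}" for h
          using that k KG by (simp add: m_assoc[symmetric])
      qed
      then show ?thesis by (simp add: bij_betw_same_card)
    qed
    have "0 = (\<Sum>h\<in>K. (?\<rho> h *\<^sub>v x) $ a)"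
      using arg_cong[OF norm, of "\<lambda>v. v $ a"] a by simp
    also have "\<dots> = (\<Sum>h\<in>K. x $ (\<sigma> (inv h) a))" using entry KG a by (intro sum.cong) auto
    also have "\<dots> = (\<Sum>h\<in>K. x $ (\<sigma> h a))"
      by (rule sum.reindex_bij_witness[where i = "\<lambda>h. inv h" and j = "\<lambda>h. inv h"])
        (use subgroup.m_inv_closed[OF K] KG in auto)
    also have "\<dots> = (\<Sum>b\<in>orb a. \<Sum>h\<in>{h \<in> K. \<sigma> h a = b}. x $ (\<sigma> h a))"
      unfolding orb_def by (rule sum.image_gen[OF finK])
    also have "\<dots> = (\<Sum>b\<in>orb a. int (card stab) * x $ b)"
      using fib by (intro sum.cong) auto
    also have "\<dots> = int (card stab) * (\<Sum>b\<in>orb a. x $ b)" by (simp add: sum_distrib_left)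
    finally have "int (card stab) * (\<Sum>b\<in>orb a. x $ b) = 0" by simp
    moreover have "card stab \<noteq> 0"
      using finK \<sigma>_one[OF a] subgroup.one_closed[OF K] by (auto simp: stab_def)
    ultimately show ?thesis by simp
  qed
  \<comment> \<open>The least element depends on the orbit only, which makes it a canonical
    representative.\<close>
  define r where "r a = (LEAST b. b \<in> orb a)" for a
  have r: "r a \<in> orb a" if "a < ?n" for a unfolding r_def using orb_self[OF that] by (rule LeastI)
  have rn: "r a < ?n" if "a < ?n" for a using r[OF that] orb_n[OF that] by auto
  have r_eq: "r a = r b \<longleftrightarrow> b \<in> orb a" if "a < ?n" "b < ?n" for a b
  proof
    assume eq: "r a = r b"
    have "r a \<in> orb a" by (rule r[OF that(1)])
    moreover have "r a \<in> orb b" unfolding eq by (rule r[OF that(2)])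
    ultimately have "orb a = orb b"
      using orb_eq[OF that(1), of "r a"] orb_eq[OF that(2), of "r a"] by simp
    then show "b \<in> orb a" using orb_self[OF that(2)] by simp
  next
    assume "b \<in> orb a"
    then show "r a = r b" using orb_eq[OF that(1)] by (simp add: r_def)
  qed
  define S where "S = {vec ?n (\<lambda>i. \<Sum>h\<in>K. ((?\<rho> h - 1\<^sub>m ?n) *\<^sub>v y h) $ i) |y. \<forall>h\<in>K. y h \<in> carrier_vec ?n}"
  have S: "int_submodule ?n S" unfolding S_def
    by (rule int_submodule_augmentation) (use KG cL in \<open>auto intro!: minus_carrier_mat\<close>)
  have gen: "unit_vec ?n a - unit_vec ?n (r a) \<in> S" if a: "a < ?n" for a
  proof -
    have ra: "r a < ?n" using r[OF a] orb_n[OF a] by auto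
    have "a \<in> orb (r a)" by (rule orb_sym[OF a r[OF a]])
    then obtain k where k: "k \<in> K" "a = \<sigma> k (r a)" by (auto simp: orb_def)
    define y :: "_ \<Rightarrow> int vec" where "y h = (if h = k then unit_vec ?n (r a) else 0\<^sub>v ?n)" for h
    have t: "(?\<rho> k - 1\<^sub>m ?n) *\<^sub>v unit_vec ?n (r a) = unit_vec ?n a - unit_vec ?n (r a)"
    proof -
      have "(?\<rho> k - 1\<^sub>m ?n) *\<^sub>v unit_vec ?n (r a) = ?\<rho> k *\<^sub>v unit_vec ?n (r a) - 1\<^sub>m ?n *\<^sub>v unit_vec ?n (r a)"
        by (rule minus_mult_distrib_mat_vec[OF cL[OF KG[OF k(1)]]]) auto
      then show ?thesis using \<rho>[OF KG[OF k(1)] ra] k(2) by simp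
    qed
    have z: "(?\<rho> h - 1\<^sub>m ?n) *\<^sub>v 0\<^sub>v ?n = 0\<^sub>v ?n" for h
      by (rule mult_zero_vec) (rule minus_carrier_mat, simp)
    have "unit_vec ?n a - unit_vec ?n (r a) = vec ?n (\<lambda>i. \<Sum>h\<in>K. ((?\<rho> h - 1\<^sub>m ?n) *\<^sub>v y h) $ i)"
    proof (rule eq_vecI)
      fix i assume "i < dim_vec (vec ?n (\<lambda>i. \<Sum>h\<in>K. ((?\<rho> h - 1\<^sub>m ?n) *\<^sub>v y h) $ i))"
      then have i: "i < ?n" by simp
      have "(\<Sum>h\<in>K. ((?\<rho> h - 1\<^sub>m ?n) *\<^sub>v y h) $ i) = (\<Sum>h\<in>K. if h = k then (unit_vec ?n a - unit_vec ?n (r a)) $ i else 0)"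
        using t z i by (intro sum.cong) (auto simp: y_def simp del: index_mult_mat_vec)
      then show "(unit_vec ?n a - unit_vec ?n (r a)) $ i = vec ?n (\<lambda>i. \<Sum>h\<in>K. ((?\<rho> h - 1\<^sub>m ?n) *\<^sub>v y h) $ i) $ i"
        using i finK k(1) by simp
    qed simp
    then show ?thesis unfolding S_def mem_Collect_eq by (intro exI[of _ y] conjI) (auto simp: y_def)
  qed
  have "vec ?n (\<lambda>a. \<Sum>i<?n. x $ i * (unit_vec ?n i - unit_vec ?n (r i)) $ a) \<in> S"
    by (rule int_submodule_sum[OF S gen])
  \<comment> \<open>The subtracted part vanishes: at a representative its coefficient is the sum of
    x over an orbit, elsewhere it is an empty sum.\<close>
  also have "vec ?n (\<lambda>a. \<Sum>i<?n. x $ i * (unit_vec ?n i - unit_vec ?n (r i)) $ a) = x"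
  proof (rule eq_vecI)
    fix a assume "a < dim_vec x"
    then have a: "a < ?n" using x by simp
    have "(\<Sum>i<?n. x $ i * (unit_vec ?n i - unit_vec ?n (r i)) $ a) =
        (\<Sum>i<?n. (if i = a then x $ i else 0) - (if r i = a then x $ i else 0))"
      using a rn by (intro sum.cong) auto
    also have "\<dots> = (\<Sum>i<?n. if i = a then x $ i else 0) - (\<Sum>i<?n. if r i = a then x $ i else 0)"
      by (rule sum_subtractf)
    also have "(\<Sum>i<?n. if i = a then x $ i else 0) = x $ a" using a by simp
    also have "(\<Sum>i<?n. if r i = a then x $ i else 0) = (\<Sum>i\<in>{i\<in>{..<?n}. r i = a}. x $ i)"
      by (rule sum.inter_filter[symmetric]) simp
    also have "\<dots> = 0"
    proof (cases "\<exists>i<?n. r i = a")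
      case True
      then obtain i where i: "i < ?n" "r i = a" by blast
      have "r j = a \<longleftrightarrow> j \<in> orb i" if "j < ?n" for j using r_eq[OF i(1) that] i(2) by metis
      then have "{j\<in>{..<?n}. r j = a} = orb i" using orb_n[OF i(1)] by blast
      then show ?thesis using orb_sum[OF i(1)] by simp
    next
      case False
      then have "{j\<in>{..<?n}. r j = a} = {}" by blast
      then show ?thesis by (simp only: sum.empty)
    qed
    finally show "vec ?n (\<lambda>a. \<Sum>i<?n. x $ i * (unit_vec ?n i - unit_vec ?n (r i)) $ a) $ a = x $ a"
      using a by simp
  qed (use x in simp)
  finally have "x \<in> S" .
  then show "\<exists>y. (\<forall>h\<in>K. y h \<in> carrier_vec ?n) \<and> x = vec ?n (\<lambda>i. \<Sum>h\<in>K. ((?\<rho> h - 1\<^sub>m ?n) *\<^sub>v y h) $ i)"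
    unfolding S_def by blast
qed

section \<open>The Chevalley module of a doubly transitive action\<close>

lemma chevalley_lattice_entry:
  assumes "i < card (lcosets\<^bsub>G\<^esub> H) - 1" "k < card (lcosets\<^bsub>G\<^esub> H) - 1"
  shows "snd (chevalley_lattice G H) g $$ (k, i) =
    (if (inv\<^bsub>G\<^esub> g) <#\<^bsub>G\<^esub> coset_enum G H k = coset_enum G H i then 1 else 0) -
    (if (inv\<^bsub>G\<^esub> g) <#\<^bsub>G\<^esub> coset_enum G H (card (lcosets\<^bsub>G\<^esub> H) - 1) = coset_enum G H i then 1 else 0)"
  using assms by (simp add: chevalley_lattice_def dual_lattice_def augmentation_lattice_def Let_def coset_lattice_def)

lemma fst_chevalley_lattice [simp]: "fst (chevalley_lattice G H) = card (lcosets\<^bsub>G\<^esub> H) - 1"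
  by (simp add: chevalley_lattice_def dual_lattice_def augmentation_lattice_def Let_def)

lemma snd_chevalley_lattice_carrier:
  "snd (chevalley_lattice G H) g \<in> carrier_mat (card (lcosets\<^bsub>G\<^esub> H) - 1) (card (lcosets\<^bsub>G\<^esub> H) - 1)"
  by (simp add: chevalley_lattice_def dual_lattice_def augmentation_lattice_def Let_def)

context group
begin

text \<open>A function f of sum zero is an element of the augmentation ideal; its coordinates in the
  basis e_k - e_(n-1) are the values at the first n - 1 cosets. The matrix of the dual at g is the
  transpose of the matrix of the ideal at g^-1, so the left side is coordinate i of the translate of
  f by g^-1.\<close>

lemma chevalley_apply:
  fixes f :: "'a set \<Rightarrow> int"
  assumes fin: "finite (carrier G)" and H: "subgroup H G" and g: "g \<in> carrier G"
    and f0: "(\<Sum>C\<in>lcosets H. f C) = 0" and i: "i < card (lcosets H) - 1"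
  shows "(\<Sum>k<card (lcosets H) - 1. f (coset_enum G H k) * snd (chevalley_lattice G H) g $$ (k, i))
    = f (g <# coset_enum G H i)"
proof -
  let ?e = "coset_enum G H" and ?n = "card (lcosets H)"
  have n: "?n = Suc (?n - 1)" using i by simp
  have i': "i < ?n" using i by simp
  have bij: "bij_betw ?e {..<?n} (lcosets H)" by (rule coset_enum_bij[OF fin])
  note eH = coset_enum_in[OF fin H]
  let ?A = "g <# ?e i"
  have A: "?A \<in> lcosets H" by (rule lcosets_translate[OF H eH[OF i'] g])
  have eq: "inv g <# ?e k = ?e i \<longleftrightarrow> ?e k = ?A" if "k < ?n" for k
    by (rule lcos_inv_iff[OF H eH[OF that] eH[OF i'] g])
  have s0: "(\<Sum>k<?n. f (?e k)) = 0" using sum.reindex_bij_betw[OF bij, of f] f0 by simp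
  then have last: "(\<Sum>k<?n - 1. f (?e k)) = - f (?e (?n - 1))"
    by (subst (asm) n) simp
  have "(\<Sum>k<?n - 1. f (?e k) * snd (chevalley_lattice G H) g $$ (k, i)) =
     (\<Sum>k<?n - 1. f (?e k) * ((if ?e k = ?A then 1 else 0) - (if ?e (?n - 1) = ?A then 1 else 0)))"
    using i n eq by (intro sum.cong refl) (simp add: chevalley_lattice_entry)
  also have "\<dots> = (\<Sum>k<?n - 1. if ?e k = ?A then f ?A else 0) - (\<Sum>k<?n - 1. f (?e k)) * (if ?e (?n - 1) = ?A then 1 else 0)"
    unfolding sum_distrib_right sum_subtractf[symmetric] by (intro sum.cong refl) auto
  also have "\<dots> = f ?A"
  proof -
    \<comment> \<open>If g carries coset i to the last coset, the first sum is empty and the second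
      term supplies the value of f there, by \<open>last\<close>.\<close>
    obtain j where j: "j < ?n" "?A = ?e j" using coset_enum_ex[OF fin H A] by blast
    have ej: "?e k = ?A \<longleftrightarrow> k = j" if "k < ?n" for k
      using coset_enum_eq_iff[OF fin H that j(1)] j(2) by simp
    have "(\<Sum>k<?n - 1. if ?e k = ?A then f ?A else 0) = (\<Sum>k<?n - 1. if k = j then f ?A else 0)"
      using n ej by (intro sum.cong) auto
    also have "\<dots> = (if j < ?n - 1 then f ?A else 0)" by simp
    finally have 1: "(\<Sum>k<?n - 1. if ?e k = ?A then f ?A else 0) = (if j < ?n - 1 then f ?A else 0)" .
    have "?e (?n - 1) = ?A \<longleftrightarrow> j = ?n - 1" using ej[of "?n - 1"] n i by auto
    moreover have "j < ?n - 1 \<or> j = ?n - 1" using j(1) by linarith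
    ultimately show ?thesis unfolding 1 last using j(2) by auto
  qed
  finally show ?thesis .
qed

text \<open>Each row of the matrix at g is itself a function of sum zero, a difference of two
  indicator functions, so \<open>chevalley_apply\<close> evaluates its product with the matrix at
  h.\<close>

lemma G_lattice_chevalley:
  assumes fin: "finite (carrier G)" and H: "subgroup H G"
  shows "G_lattice G (chevalley_lattice G H)"
  unfolding G_lattice_def
proof (intro conjI ballI)
  let ?e = "coset_enum G H" and ?n = "card (lcosets H)" and ?\<rho> = "snd (chevalley_lattice G H)"
  note c = snd_chevalley_lattice_carrier[of G H]
  note eH = coset_enum_in[OF fin H]
  show "?\<rho> g \<in> carrier_mat (fst (chevalley_lattice G H)) (fst (chevalley_lattice G H))" for g
    using c by simp
  have ent: "?\<rho> g $$ (k, i) = (if ?e k = g <# ?e i then 1 else 0) - (if ?e (?n - 1) = g <# ?e i then 1 else 0)"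
    if "k < ?n - 1" "i < ?n - 1" "g \<in> carrier G" for g i k
    using chevalley_lattice_entry[OF that(2,1), of g] that
      lcos_inv_iff[OF H eH eH that(3), of k i] lcos_inv_iff[OF H eH eH that(3), of "?n - 1" i] by simp
  show "?\<rho> \<one> = 1\<^sub>m (fst (chevalley_lattice G H))"
  proof (rule eq_matI)
    fix k i assume "k < dim_row (1\<^sub>m (fst (chevalley_lattice G H)) :: int mat)"
      "i < dim_col (1\<^sub>m (fst (chevalley_lattice G H)) :: int mat)"
    then have ki: "k < ?n - 1" "i < ?n - 1" by auto
    have "?e (?n - 1) = ?e i \<longleftrightarrow> ?n - 1 = i" by (rule coset_enum_eq_iff[OF fin H]) (use ki in auto)
    moreover have "?e k = ?e i \<longleftrightarrow> k = i" by (rule coset_enum_eq_iff[OF fin H]) (use ki in auto)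
    moreover have "\<one> <# ?e i = ?e i" by (rule lcos_one[OF H eH]) (use ki in auto)
    ultimately show "?\<rho> \<one> $$ (k, i) = 1\<^sub>m (fst (chevalley_lattice G H)) $$ (k, i)"
      using ki ent[OF ki one_closed] by simp
  qed (use c[of \<one>] in auto)
  fix g h assume g: "g \<in> carrier G" and h: "h \<in> carrier G"
  show "?\<rho> (g \<otimes> h) = ?\<rho> g * ?\<rho> h"
  proof (rule eq_matI)
    fix k i assume "k < dim_row (?\<rho> g * ?\<rho> h)" "i < dim_col (?\<rho> g * ?\<rho> h)"
    then have ki: "k < ?n - 1" "i < ?n - 1" using c[of g] c[of h] by auto
    have i': "i < ?n" using ki by simp
    define f :: "'a set \<Rightarrow> int" where
      "f C = (if ?e k = g <# C then 1 else 0) - (if ?e (?n - 1) = g <# C then 1 else 0)" for C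
    have f0: "(\<Sum>C\<in>lcosets H. f C) = 0"
    proof -
      have d: "(\<Sum>C\<in>lcosets H. if ?e l = g <# C then 1 else 0) = (1 :: int)" if l: "l < ?n" for l
      proof -
        have "?e l = g <# C \<longleftrightarrow> C = inv g <# ?e l" if "C \<in> lcosets H" for C
          using lcos_inv_iff[OF H eH[OF l] that g] by metis
        then have "(\<Sum>C\<in>lcosets H. if ?e l = g <# C then 1 else 0) = (\<Sum>C\<in>lcosets H. if C = inv g <# ?e l then 1 else (0 :: int))"
          by (intro sum.cong refl) simp
        moreover have "finite (lcosets H)" using fin by (simp add: LCOSETS_def)
        moreover have "inv g <# ?e l \<in> lcosets H" by (rule lcosets_translate[OF H eH[OF l]]) (use g in simp)
        ultimately show ?thesis by simp
      qed
      show ?thesis unfolding f_def sum_subtractf using d[of k] d[of "?n - 1"] ki by simp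
    qed
    have "(?\<rho> g * ?\<rho> h) $$ (k, i) = (\<Sum>l<?n - 1. ?\<rho> g $$ (k, l) * ?\<rho> h $$ (l, i))"
      using ki c[of g] c[of h] by (simp add: scalar_prod_def lessThan_atLeast0)
    also have "\<dots> = (\<Sum>l<?n - 1. f (?e l) * ?\<rho> h $$ (l, i))"
      using ki ent g by (intro sum.cong refl) (simp add: f_def)
    also have "\<dots> = f (h <# ?e i)" by (rule chevalley_apply[OF fin H h f0 ki(2)])
    also have "\<dots> = ?\<rho> (g \<otimes> h) $$ (k, i)"
      unfolding ent[OF ki m_closed[OF g h]] f_def lcos_mult[OF H eH[OF i'] g h] ..
    finally show "?\<rho> (g \<otimes> h) $$ (k, i) = (?\<rho> g * ?\<rho> h) $$ (k, i)" by simp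
  next
    show "dim_row (?\<rho> (g \<otimes> h)) = dim_row (?\<rho> g * ?\<rho> h)" "dim_col (?\<rho> (g \<otimes> h)) = dim_col (?\<rho> g * ?\<rho> h)"
      using carrier_matD[OF c[of g]] carrier_matD[OF c[of h]] carrier_matD[OF c[of "g \<otimes> h"]] by simp_all
  qed
qed

text \<open>For a doubly transitive action of \<open>G\<close> on \<open>G/H\<close> the ordered pairs of distinct points form
  \<open>G/T\<close>, and the class of the point \<open>x\<close> is sent to the sum of the pairs \<open>(x, y)\<close> minus the sum of
  the pairs \<open>(y, x)\<close>.\<close>

lemma chevalley_resolution:
  assumes fin: "finite (carrier G)" and H: "subgroup H G" and a: "a \<in> carrier G" and b: "b \<in> carrier G"
    and ab: "a <# H \<noteq> b <# H"
    and trans: "\<And>A B. A \<in> lcosets H \<Longrightarrow> B \<in> lcosets H \<Longrightarrow> A \<noteq> B \<Longrightarrow>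
      \<exists>x\<in>carrier G. A = x <# (a <# H) \<and> B = x <# (b <# H)"
    and T: "subgroup T G"
    and T_iff: "\<And>x. x \<in> carrier G \<Longrightarrow> x \<in> T \<longleftrightarrow> x <# (a <# H) = a <# H \<and> x <# (b <# H) = b <# H"
  obtains F i p where "short_exact G (chevalley_lattice G H) (coset_lattice G T) F i p"
    "fst F = (card (lcosets H) - 1)\<^sup>2"
    "\<And>L v xs ys. G_lattice G L \<Longrightarrow> v \<in> carrier_vec (fst L) \<Longrightarrow> (\<And>t. t \<in> T \<Longrightarrow> snd L t *\<^sub>v v = v) \<Longrightarrow>
       set xs \<subseteq> carrier G \<Longrightarrow> set ys \<subseteq> carrier G \<Longrightarrow>
       (\<And>x. x \<in> set xs \<Longrightarrow> x <# (a <# H) = a <# H) \<Longrightarrow> (\<And>y. y \<in> set ys \<Longrightarrow> y <# (b <# H) = a <# H) \<Longrightarrow>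
       bij_betw (\<lambda>x. x <# (b <# H)) (set xs) (lcosets H - {a <# H}) \<Longrightarrow>
       bij_betw (\<lambda>y. y <# (a <# H)) (set ys) (lcosets H - {a <# H}) \<Longrightarrow>
       (\<And>r. r < fst L \<Longrightarrow> (\<Sum>x\<in>set xs. (snd L x *\<^sub>v v) $ r) = (\<Sum>y\<in>set ys. (snd L y *\<^sub>v v) $ r)) \<Longrightarrow>
       \<exists>B. G_hom G F L B \<and> (\<forall>x\<in>carrier G. \<exists>z\<in>carrier_vec (fst F). B *\<^sub>v z = snd L x *\<^sub>v v)"
proof -
  let ?e = "coset_enum G H" and ?n = "card (lcosets H)"
  let ?f = "coset_enum G T" and ?N = "card (lcosets T)"
  note eH = coset_enum_in[OF fin H] and fT = coset_enum_in[OF fin T]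
  have aH: "a <# H \<in> lcosets H" and bH: "b <# H \<in> lcosets H" using a b lcosets_iff by auto
  have finH: "finite (lcosets H)" using fin by (simp add: LCOSETS_def)
  have "\<forall>j. \<exists>x. j < ?N \<longrightarrow> x \<in> carrier G \<and> ?f j = x <# T" using fT lcoset_rep by metis
  then obtain r where r: "\<And>j. j < ?N \<Longrightarrow> r j \<in> carrier G" "\<And>j. j < ?N \<Longrightarrow> ?f j = r j <# T" by metis
  \<comment> \<open>Coset j of T stands for the ordered pair (\<open>al j\<close>,
    \<open>be j\<close>) of distinct points; by \<open>coset_pair\<close> the pair does not depend
    on the representative \<open>r j\<close>.\<close>
  define al where "al j = r j <# (a <# H)" for j
  define be where "be j = r j <# (b <# H)" for j
  have coset_pair: "x <# T = y <# T \<longleftrightarrow> x <# (a <# H) = y <# (a <# H) \<and> x <# (b <# H) = y <# (b <# H)"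
    if x: "x \<in> carrier G" and y: "y \<in> carrier G" for x y
  proof -
    have t: "(inv x \<otimes> y) <# C = C \<longleftrightarrow> x <# C = y <# C" if C: "C \<in> lcosets H" for C
    proof -
      have "(inv x \<otimes> y) <# C = inv x <# (y <# C)" using lcos_mult[OF H C _ y] x by simp
      also have "\<dots> = C \<longleftrightarrow> y <# C = x <# C" by (rule lcos_inv_iff[OF H lcosets_translate[OF H C y] C x])
      finally show ?thesis by auto
    qed
    show ?thesis unfolding lcos_eq_iff[OF T x y] using T_iff[of "inv x \<otimes> y"] x y t[OF aH] t[OF bH] by simp
  qed
  have al_eq: "al j = x <# (a <# H)" and be_eq: "be j = x <# (b <# H)"
    if "j < ?N" "x \<in> carrier G" "?f j = x <# T" for j x
    using coset_pair[OF r(1)[OF that(1)] that(2)] r(2)[OF that(1)] that(3) by (auto simp: al_def be_def)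
  have al_in: "al j \<in> lcosets H" and be_in: "be j \<in> lcosets H" if "j < ?N" for j
    using lcosets_translate[OF H aH r(1)[OF that]] lcosets_translate[OF H bH r(1)[OF that]] by (auto simp: al_def be_def)
  have al_be: "al j \<noteq> be j" if j: "j < ?N" for j
  proof
    assume "al j = be j"
    then have "inv (r j) <# (r j <# (b <# H)) = a <# H"
      using lcos_inv_iff[OF H lcosets_translate[OF H bH r(1)[OF j]] aH r(1)[OF j]] by (simp add: al_def be_def)
    moreover have "inv (r j) <# (r j <# (b <# H)) = b <# H"
      using lcos_inv_iff[OF H lcosets_translate[OF H bH r(1)[OF j]] bH r(1)[OF j]] by simp
    ultimately show False using ab by simp
  qed
  have inj: "j = j'" if "j < ?N" "j' < ?N" "al j = al j'" "be j = be j'" for j j'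
  proof -
    have "?f j = ?f j'"
      using that r coset_pair[OF r(1)[OF that(1)] r(1)[OF that(2)]] by (simp add: al_def be_def)
    then show ?thesis using coset_enum_eq_iff[OF fin T that(1,2)] by simp
  qed
  have pair_ex: "\<exists>j<?N. al j = A \<and> be j = B" if AB: "A \<in> lcosets H" "B \<in> lcosets H" "A \<noteq> B" for A B
  proof -
    obtain x where x: "x \<in> carrier G" "A = x <# (a <# H)" "B = x <# (b <# H)" using trans[OF AB] by blast
    have "x <# T \<in> lcosets T" using x(1) lcosets_iff by blast
    then obtain j where j: "j < ?N" "x <# T = ?f j" using coset_enum_ex[OF fin T] by blast
    then show ?thesis using al_eq[OF j(1) x(1)] be_eq[OF j(1) x(1)] x by auto
  qed
  have N: "?N = ?n * (?n - 1)"
  proof -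
    have "bij_betw (\<lambda>j. (al j, be j)) {..<?N} ((lcosets H) \<times> (lcosets H) - (\<lambda>A. (A, A)) ` (lcosets H))"
      unfolding bij_betw_def
    proof
      show "inj_on (\<lambda>j. (al j, be j)) {..<?N}" using inj by (auto simp: inj_on_def)
      show "(\<lambda>j. (al j, be j)) ` {..<?N} = (lcosets H) \<times> (lcosets H) - (\<lambda>A. (A, A)) ` (lcosets H)"
      proof
        show "(\<lambda>j. (al j, be j)) ` {..<?N} \<subseteq> (lcosets H) \<times> (lcosets H) - (\<lambda>A. (A, A)) ` (lcosets H)"
          using al_in be_in al_be by auto
        show "(lcosets H) \<times> (lcosets H) - (\<lambda>A. (A, A)) ` (lcosets H) \<subseteq> (\<lambda>j. (al j, be j)) ` {..<?N}"
        proof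
          fix q assume q: "q \<in> (lcosets H) \<times> (lcosets H) - (\<lambda>A. (A, A)) ` (lcosets H)"
          then obtain A B where AB: "q = (A, B)" "A \<in> lcosets H" "B \<in> lcosets H" by auto
          then have "A \<noteq> B" using q by auto
          then obtain j where "j < ?N" "al j = A" "be j = B" using pair_ex[OF AB(2,3)] by blast
          then show "q \<in> (\<lambda>j. (al j, be j)) ` {..<?N}" using AB by auto
        qed
      qed
    qed
    then have "?N = card ((lcosets H) \<times> (lcosets H) - (\<lambda>A. (A, A)) ` (lcosets H))"
      using bij_betw_same_card by fastforce
    also have "\<dots> = card ((lcosets H) \<times> (lcosets H)) - card ((\<lambda>A. (A, A)) ` (lcosets H))"
      by (rule card_Diff_subset) (use finH in auto)
    also have "card ((\<lambda>A. (A, A)) ` (lcosets H)) = ?n" by (rule card_image) (auto simp: inj_on_def)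
    also have "card ((lcosets H) \<times> (lcosets H)) = ?n * ?n" by (rule card_cartesian_product)
    finally show ?thesis by (simp add: diff_mult_distrib2)
  qed
  \<comment> \<open>This is the difference of the points \<open>al j\<close> and \<open>be j\<close>
    as an element of the augmentation ideal. Row j of i evaluates a functional on that
    difference.\<close>
  define fj :: "nat \<Rightarrow> 'a set \<Rightarrow> int" where
    "fj j C = (if C = al j then 1 else 0) - (if C = be j then 1 else 0)" for j C
  have fj0: "(\<Sum>C\<in>lcosets H. fj j C) = 0" if "j < ?N" for j
    unfolding fj_def sum_subtractf using finH al_in[OF that] be_in[OF that] by simp
  define i :: "int mat" where "i = mat ?N (?n - 1) (\<lambda>(j,k). fj j (?e k))"
  have ci: "i \<in> carrier_mat ?N (?n - 1)" by (simp add: i_def)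
  let ?M = "chevalley_lattice G H" and ?P = "coset_lattice G T"
  have LM: "G_lattice G ?M" by (rule G_lattice_chevalley[OF fin H])
  have LP: "G_lattice G ?P" by (rule G_lattice_coset[OF fin T])
  have i_hom: "G_hom G ?M ?P i" unfolding G_hom_def
  proof (intro conjI ballI)
    show "i \<in> carrier_mat (fst ?P) (fst ?M)" using ci by simp
    fix g assume g: "g \<in> carrier G"
    note cM = snd_chevalley_lattice_carrier[of G H g] and cP = snd_coset_lattice_carrier[of G T g]
    show "i * snd ?M g = snd ?P g * i"
    proof (rule eq_matI)
      fix j l assume "j < dim_row (snd ?P g * i)" "l < dim_col (snd ?P g * i)"
      then have j: "j < ?N" and l: "l < ?n - 1" using cP ci by auto
      have l': "l < ?n" using l by simp
      have "(i * snd ?M g) $$ (j, l) = (\<Sum>k<?n - 1. i $$ (j, k) * snd ?M g $$ (k, l))"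
        using j l ci cM by (simp add: scalar_prod_def lessThan_atLeast0)
      also have "\<dots> = (\<Sum>k<?n - 1. fj j (?e k) * snd ?M g $$ (k, l))"
        using j by (intro sum.cong refl) (simp add: i_def)
      also have "\<dots> = fj j (g <# ?e l)" by (rule chevalley_apply[OF fin H g fj0[OF j] l])
      finally have 1: "(i * snd ?M g) $$ (j, l) = fj j (g <# ?e l)" .
      have "inv g <# ?f j \<in> lcosets T" by (rule lcosets_translate[OF T fT[OF j]]) (use g in simp)
      then obtain j' where j': "j' < ?N" "inv g <# ?f j = ?f j'" using coset_enum_ex[OF fin T] by blast
      have gf: "g <# ?f k = ?f j \<longleftrightarrow> k = j'" if k: "k < ?N" for k
        using lcos_inv_iff[OF T fT[OF j] fT[OF k] g] j' coset_enum_eq_iff[OF fin T j'(1) k] by auto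
      have "(snd ?P g * i) $$ (j, l) = (\<Sum>k<?N. snd ?P g $$ (j, k) * i $$ (k, l))"
        using j l ci cP by (simp add: scalar_prod_def lessThan_atLeast0)
      also have "\<dots> = (\<Sum>k<?N. if k = j' then i $$ (k, l) else 0)"
        using j gf by (intro sum.cong refl) (simp add: coset_lattice_def Let_def)
      also have "\<dots> = fj j' (?e l)" using j' l by (simp add: i_def)
      also have "\<dots> = fj j (g <# ?e l)"
      proof -
        have rj: "inv g \<otimes> r j \<in> carrier G" using g r(1)[OF j] by simp
        have "?f j' = (inv g \<otimes> r j) <# T"
          using j'(2) r(2)[OF j] lcos_m_assoc[OF subgroup.subset[OF T] _ r(1)[OF j]] g by simp
        then have "al j' = inv g <# al j" "be j' = inv g <# be j"
          using al_eq[OF j'(1) rj] be_eq[OF j'(1) rj] lcos_mult[OF H aH _ r(1)[OF j]] lcos_mult[OF H bH _ r(1)[OF j]] g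
          by (auto simp: al_def be_def)
        moreover have "?e l = inv g <# C \<longleftrightarrow> g <# ?e l = C" if "C \<in> lcosets H" for C
          using lcos_inv_iff[OF H that eH[OF l'] g] by auto
        ultimately show ?thesis using al_in[OF j] be_in[OF j] by (simp add: fj_def)
      qed
      finally show "(i * snd ?M g) $$ (j, l) = (snd ?P g * i) $$ (j, l)" using 1 by simp
    qed (use ci cM cP in auto)
  qed
  \<comment> \<open>At the pair formed by point k and the last point, the difference is the basis
    vector k of the augmentation ideal, so i has a unit row there. These rows are what
    \<open>cokernel_lattice\<close> asks for.\<close>
  have "\<forall>k. \<exists>j. k < ?n - 1 \<longrightarrow> j < ?N \<and> al j = ?e k \<and> be j = ?e (?n - 1)"
  proof
    fix k show "\<exists>j. k < ?n - 1 \<longrightarrow> j < ?N \<and> al j = ?e k \<and> be j = ?e (?n - 1)"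
    proof (cases "k < ?n - 1")
      case True
      then have k: "k < ?n" "?n - 1 < ?n" "k \<noteq> ?n - 1" by auto
      then show ?thesis using pair_ex[OF eH eH, of k "?n - 1"] coset_enum_eq_iff[OF fin H k(1,2)] by auto
    qed auto
  qed
  then obtain sel where sel: "\<And>k. k < ?n - 1 \<Longrightarrow> sel k < ?N"
    "\<And>k. k < ?n - 1 \<Longrightarrow> al (sel k) = ?e k" "\<And>k. k < ?n - 1 \<Longrightarrow> be (sel k) = ?e (?n - 1)" by metis
  have ekl: "?e k = ?e l \<longleftrightarrow> k = l" "?e k \<noteq> ?e (?n - 1)" if "k < ?n - 1" "l < ?n - 1" for k l
    using coset_enum_eq_iff[OF fin H, of k l] coset_enum_eq_iff[OF fin H, of k "?n - 1"] that by auto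
  have sel_inj: "inj_on sel {..<fst ?M}"
    using sel ekl by (auto simp: inj_on_def) metis
  have sel_sub: "sel ` {..<fst ?M} \<subseteq> {..<fst ?P}" using sel by auto
  have sel_id: "i $$ (sel k, l) = (if k = l then 1 else 0)" if "k < fst ?M" "l < fst ?M" for k l
    using that sel[of k] ekl[of l k] by (auto simp: i_def fj_def)
  obtain F p s where F: "short_exact G ?M ?P F i p" "fst F = fst ?P - fst ?M" "s \<in> carrier_mat (fst ?P) (fst F)"
    and fac: "\<And>L B. G_lattice G L \<Longrightarrow> G_hom G ?P L B \<Longrightarrow> B * i = 0\<^sub>m (fst L) (fst ?M) \<Longrightarrow>
       G_hom G F L (B * s) \<and> B * s * p = B"
    using cokernel_lattice[OF is_group LM LP i_hom sel_inj sel_sub sel_id] by metis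
  have cp: "p \<in> carrier_mat (fst F) ?N" using F(1) by (simp add: short_exact_def G_hom_def)
  have rank: "fst F = (?n - 1)\<^sup>2"
    using F(2) N by (simp add: power2_eq_square diff_mult_distrib)
  have main: "\<exists>B. G_hom G F L B \<and> (\<forall>x\<in>carrier G. \<exists>z\<in>carrier_vec (fst F). B *\<^sub>v z = snd L x *\<^sub>v v)"
    if L: "G_lattice G L" and v: "v \<in> carrier_vec (fst L)" and v_inv: "\<And>t. t \<in> T \<Longrightarrow> snd L t *\<^sub>v v = v"
      and xs: "set xs \<subseteq> carrier G" and ys: "set ys \<subseteq> carrier G"
      and xa: "\<And>x. x \<in> set xs \<Longrightarrow> x <# (a <# H) = a <# H" and yb: "\<And>y. y \<in> set ys \<Longrightarrow> y <# (b <# H) = a <# H"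
      and xbij: "bij_betw (\<lambda>x. x <# (b <# H)) (set xs) (lcosets H - {a <# H})"
      and ybij: "bij_betw (\<lambda>y. y <# (a <# H)) (set ys) (lcosets H - {a <# H})"
      and rel: "\<And>q. q < fst L \<Longrightarrow> (\<Sum>x\<in>set xs. (snd L x *\<^sub>v v) $ q) = (\<Sum>y\<in>set ys. (snd L y *\<^sub>v v) $ q)"
    for L v xs ys
  proof -
    let ?m = "fst L"
    obtain B where B: "G_hom G ?P L B" and Bv: "\<And>x. x \<in> carrier G \<Longrightarrow> B *\<^sub>v coset_vec G T (x <# T) = snd L x *\<^sub>v v"
      using coset_hom[OF fin T L v v_inv] by blast
    have cB: "B \<in> carrier_mat ?m ?N" using B by (simp add: G_hom_def)
    have Bcol: "B $$ (q, j) = (snd L x *\<^sub>v v) $ q" if "q < ?m" "j < ?N" "x \<in> carrier G" "?f j = x <# T" for q j x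
    proof -
      have "B $$ (q, j) = (B *\<^sub>v unit_vec ?N j) $ q" using that cB by simp
      then show ?thesis using Bv[OF that(3)] coset_vec_enum[OF fin T that(2)] that(4) by simp
    qed
    \<comment> \<open>B kills the image of i if, for each point A, its columns over the pairs
      starting in A and over the pairs ending in A have the same sum. The hypothesis
      \<open>rel\<close> says this for the point a H, and an element g that moves a H to A carries
      it over.\<close>
    have ent: "(\<Sum>j<?N. B $$ (q, j) * fj j A) = 0" if q: "q < ?m" and A: "A \<in> lcosets H" for q A
    proof -
      obtain x0 where x0: "x0 \<in> carrier G" "A = x0 <# H" using A lcosets_iff by blast
      define g where "g = x0 \<otimes> inv a"
      have g: "g \<in> carrier G" using x0 a by (simp add: g_def)
      have gA: "g <# (a <# H) = A"
        using lcos_m_assoc[OF subgroup.subset[OF H] g a] x0 a by (simp add: g_def m_assoc)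
      have tr: "g <# (x <# C) = (g \<otimes> x) <# C" if "C \<in> lcosets H" "x \<in> carrier G" for x C
        using lcos_mult[OF H that(1) g that(2)] .
      \<comment> \<open>The roles (\<open>ga\<close>, \<open>de\<close>) are later filled by
        (\<open>al\<close>, \<open>be\<close>) for the pairs starting in A and by
        (\<open>be\<close>, \<open>al\<close>) for the pairs ending in A.\<close>
      have main: "(\<Sum>j\<in>{j\<in>{..<?N}. ga j = A}. B $$ (q, j)) = (\<Sum>x\<in>set zs. (snd L (g \<otimes> x) *\<^sub>v v) $ q)"
        if zs: "set zs \<subseteq> carrier G" and c: "c \<in> lcosets H" and d: "d \<in> lcosets H"
          and zc: "\<And>x. x \<in> set zs \<Longrightarrow> x <# c = a <# H"
          and zbij: "bij_betw (\<lambda>x. x <# d) (set zs) (lcosets H - {a <# H})"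
          and ga: "\<And>j x. j < ?N \<Longrightarrow> x \<in> carrier G \<Longrightarrow> ?f j = x <# T \<Longrightarrow> ga j = x <# c \<and> de j = x <# d"
          and gd: "\<And>j. j < ?N \<Longrightarrow> ga j \<noteq> de j"
          and ginj: "\<And>j j'. j < ?N \<Longrightarrow> j' < ?N \<Longrightarrow> ga j = ga j' \<Longrightarrow> de j = de j' \<Longrightarrow> j = j'"
          and gin: "\<And>j. j < ?N \<Longrightarrow> de j \<in> lcosets H"
        for zs c d ga de
      proof -
        have "\<forall>x. \<exists>j. x \<in> set zs \<longrightarrow> j < ?N \<and> ?f j = (g \<otimes> x) <# T"
        proof
          fix x show "\<exists>j. x \<in> set zs \<longrightarrow> j < ?N \<and> ?f j = (g \<otimes> x) <# T"
          proof (cases "x \<in> set zs")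
            case True
            then have "(g \<otimes> x) <# T \<in> lcosets T" using zs g lcosets_iff by blast
            then show ?thesis using coset_enum_ex[OF fin T] by metis
          qed simp
        qed
        then obtain J where J: "\<And>x. x \<in> set zs \<Longrightarrow> J x < ?N" "\<And>x. x \<in> set zs \<Longrightarrow> ?f (J x) = (g \<otimes> x) <# T"
          by metis
        have JA: "ga (J x) = A" "de (J x) = g <# (x <# d)" if x: "x \<in> set zs" for x
        proof -
          have xc: "x \<in> carrier G" "g \<otimes> x \<in> carrier G" using x zs g by auto
          note gg = ga[OF J(1)[OF x] xc(2) J(2)[OF x]]
          show "ga (J x) = A" using gg tr[OF c xc(1)] zc[OF x] gA by simp
          show "de (J x) = g <# (x <# d)" using gg tr[OF d xc(1)] by simp
        qed
        have "bij_betw J (set zs) {j\<in>{..<?N}. ga j = A}"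
          unfolding bij_betw_def
        proof
          show "inj_on J (set zs)"
          proof (rule inj_onI)
            fix x y assume x: "x \<in> set zs" and y: "y \<in> set zs" and eq: "J x = J y"
            have xd: "x <# d \<in> lcosets H" "y <# d \<in> lcosets H" using x y zs lcosets_translate[OF H d] by auto
            have "g <# (x <# d) = g <# (y <# d)" using JA[OF x] JA[OF y] eq by simp
            then have "x <# d = y <# d"
              using lcos_inv_iff[OF H lcosets_translate[OF H xd(1) g] xd(1) g]
                lcos_inv_iff[OF H lcosets_translate[OF H xd(1) g] xd(2) g] by simp
            then show "x = y" using bij_betw_imp_inj_on[OF zbij] x y by (auto simp: inj_on_def)
          qed
          show "J ` set zs = {j\<in>{..<?N}. ga j = A}"
          proof
            show "J ` set zs \<subseteq> {j\<in>{..<?N}. ga j = A}" using J JA by auto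
            show "{j\<in>{..<?N}. ga j = A} \<subseteq> J ` set zs"
            proof
              fix j assume "j \<in> {j\<in>{..<?N}. ga j = A}"
              then have j: "j < ?N" "ga j = A" by auto
              have D: "inv g <# de j \<in> lcosets H" by (rule lcosets_translate[OF H gin[OF j(1)]]) (use g in simp)
              have "inv g <# de j \<noteq> a <# H"
                using lcos_inv_iff[OF H gin[OF j(1)] aH g] gA gd[OF j(1)] j(2) by auto
              then have "inv g <# de j \<in> (\<lambda>x. x <# d) ` set zs"
                using D bij_betw_imp_surj_on[OF zbij] by simp
              then obtain x where x: "x \<in> set zs" "inv g <# de j = x <# d" by auto
              have "de j = g <# (x <# d)"
                using lcos_inv_iff[OF H gin[OF j(1)] lcosets_translate[OF H d] g] x zs by auto
              then have "J x = j" using ginj[OF J(1)[OF x(1)] j(1)] JA[OF x(1)] j(2) by simp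
              then show "j \<in> J ` set zs" using x(1) by auto
            qed
          qed
        qed
        from sum.reindex_bij_betw[OF this, of "\<lambda>j. B $$ (q, j)"]
        have "(\<Sum>j\<in>{j\<in>{..<?N}. ga j = A}. B $$ (q, j)) = (\<Sum>x\<in>set zs. B $$ (q, J x))" by simp
        also have "\<dots> = (\<Sum>x\<in>set zs. (snd L (g \<otimes> x) *\<^sub>v v) $ q)"
          by (intro sum.cong refl Bcol[OF q J(1) _ J(2)]) (use zs g in auto)
        finally show ?thesis .
      qed
      have push: "(\<Sum>x\<in>set zs. (snd L (g \<otimes> x) *\<^sub>v v) $ q) = (snd L g *\<^sub>v vec ?m (\<lambda>q. \<Sum>x\<in>set zs. (snd L x *\<^sub>v v) $ q)) $ q"
        if zs: "set zs \<subseteq> carrier G" for zs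
      proof -
        have "snd L g *\<^sub>v vec ?m (\<lambda>q. \<Sum>x\<in>set zs. (snd L x *\<^sub>v v) $ q) = vec ?m (\<lambda>q. \<Sum>x\<in>set zs. (snd L g *\<^sub>v (snd L x *\<^sub>v v)) $ q)"
          by (rule mult_vec_sum_components[OF G_lattice_carrier[OF L g]])
            (use zs G_lattice_carrier[OF L] v in \<open>meson mult_mat_vec_carrier subsetD\<close>)
        then have "(snd L g *\<^sub>v vec ?m (\<lambda>q. \<Sum>x\<in>set zs. (snd L x *\<^sub>v v) $ q)) $ q = (\<Sum>x\<in>set zs. (snd L g *\<^sub>v (snd L x *\<^sub>v v)) $ q)"
          using q by simp
        also have "\<dots> = (\<Sum>x\<in>set zs. (snd L (g \<otimes> x) *\<^sub>v v) $ q)"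
          by (intro sum.cong refl) (use G_lattice_mult_vec[OF L g _ v] zs in auto)
        finally show ?thesis by simp
      qed
      have "(\<Sum>j\<in>{j\<in>{..<?N}. al j = A}. B $$ (q, j)) = (\<Sum>x\<in>set xs. (snd L (g \<otimes> x) *\<^sub>v v) $ q)"
        by (rule main[where de = be, OF xs aH bH xa xbij]) (use al_eq be_eq al_be inj be_in in auto)
      also have "\<dots> = (\<Sum>y\<in>set ys. (snd L (g \<otimes> y) *\<^sub>v v) $ q)"
        unfolding push[OF xs] push[OF ys] using rel by (intro arg_cong[where f = "\<lambda>u. (snd L g *\<^sub>v u) $ q"] eq_vecI) auto
      also have "\<dots> = (\<Sum>j\<in>{j\<in>{..<?N}. be j = A}. B $$ (q, j))"
        by (rule main[where de = al, OF ys bH aH yb ybij, symmetric]) (use al_eq be_eq al_be inj al_in in \<open>auto dest: sym\<close>)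
      finally have eq: "(\<Sum>j\<in>{j\<in>{..<?N}. al j = A}. B $$ (q, j)) = (\<Sum>j\<in>{j\<in>{..<?N}. be j = A}. B $$ (q, j))" .
      have "(\<Sum>j<?N. B $$ (q, j) * fj j A) = (\<Sum>j<?N. (if al j = A then B $$ (q, j) else 0) - (if be j = A then B $$ (q, j) else 0))"
        by (intro sum.cong refl) (auto simp: fj_def)
      also have "\<dots> = 0" unfolding sum_subtractf sum.inter_filter[OF finite_lessThan, symmetric] using eq by simp
      finally show ?thesis .
    qed
    have "B * i = 0\<^sub>m ?m (fst ?M)"
    proof (rule eq_matI)
      fix q k assume qk: "q < dim_row (0\<^sub>m ?m (fst ?M) :: int mat)" "k < dim_col (0\<^sub>m ?m (fst ?M) :: int mat)"
      then have qk': "q < ?m" "k < ?n - 1" by auto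
      have "(B * i) $$ (q, k) = (\<Sum>j<?N. B $$ (q, j) * i $$ (j, k))"
        using qk' cB ci by (simp add: scalar_prod_def lessThan_atLeast0)
      also have "\<dots> = (\<Sum>j<?N. B $$ (q, j) * fj j (?e k))" using qk' by (intro sum.cong refl) (simp add: i_def)
      also have "\<dots> = 0" using ent[OF qk'(1) eH] qk' by simp
      finally show "(B * i) $$ (q, k) = 0\<^sub>m ?m (fst ?M) $$ (q, k)" using qk by simp
    qed (use cB ci in auto)
    then have Bs: "G_hom G F L (B * s)" "B * s * p = B" using fac[OF L B] by auto
    have cBs: "B * s \<in> carrier_mat ?m (fst F)" using Bs(1) by (simp add: G_hom_def)
    have "\<exists>z\<in>carrier_vec (fst F). B * s *\<^sub>v z = snd L x *\<^sub>v v" if x: "x \<in> carrier G" for x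
    proof
      show "p *\<^sub>v coset_vec G T (x <# T) \<in> carrier_vec (fst F)" using cp by (meson coset_vec_carrier mult_mat_vec_carrier)
      show "B * s *\<^sub>v (p *\<^sub>v coset_vec G T (x <# T)) = snd L x *\<^sub>v v"
        using assoc_mult_mat_vec[OF cBs cp coset_vec_carrier] Bs(2) Bv[OF x] by simp
    qed
    then show ?thesis using Bs(1) by blast
  qed
  show ?thesis by (rule that[OF F(1) rank main])
qed

end

section \<open>The projective line over the field with eight elements\<close>

text \<open>The points \<open>P0\<close>, ..., \<open>P7\<close> are the field elements in the encoding of the field, \<open>P8\<close> is \<open>\<infinity>\<close>. The maps \<open>tau b\<close>,
  \<open>mu a\<close> and \<open>winv\<close> are \<open>x + b\<close>, \<open>a x\<close> and \<open>1 / x\<close>.\<close>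

datatype pt = P0 | P1 | P2 | P3 | P4 | P5 | P6 | P7 | P8

text \<open>The tuple of images of the nine points. Equality is then equality of constructor terms,
  and composition is pattern matching, both of which rewriting evaluates quickly.\<close>

datatype perm = Perm pt pt pt pt pt pt pt pt pt

fun ap :: "perm \<Rightarrow> pt \<Rightarrow> pt" where
  "ap (Perm a0 a1 a2 a3 a4 a5 a6 a7 a8) P0 = a0"
| "ap (Perm a0 a1 a2 a3 a4 a5 a6 a7 a8) P1 = a1"
| "ap (Perm a0 a1 a2 a3 a4 a5 a6 a7 a8) P2 = a2"
| "ap (Perm a0 a1 a2 a3 a4 a5 a6 a7 a8) P3 = a3"
| "ap (Perm a0 a1 a2 a3 a4 a5 a6 a7 a8) P4 = a4"
| "ap (Perm a0 a1 a2 a3 a4 a5 a6 a7 a8) P5 = a5"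
| "ap (Perm a0 a1 a2 a3 a4 a5 a6 a7 a8) P6 = a6"
| "ap (Perm a0 a1 a2 a3 a4 a5 a6 a7 a8) P7 = a7"
| "ap (Perm a0 a1 a2 a3 a4 a5 a6 a7 a8) P8 = a8"

definition cmp :: "perm \<Rightarrow> perm \<Rightarrow> perm" where
  "cmp p q = Perm (ap p (ap q P0)) (ap p (ap q P1)) (ap p (ap q P2)) (ap p (ap q P3)) (ap p (ap q P4)) (ap p (ap q P5)) (ap p (ap q P6)) (ap p (ap q P7)) (ap p (ap q P8))"

definition idp :: perm where
  "idp = Perm P0 P1 P2 P3 P4 P5 P6 P7 P8"

fun tau :: "pt \<Rightarrow> perm" where
  "tau P0 = Perm P0 P1 P2 P3 P4 P5 P6 P7 P8"
| "tau P1 = Perm P1 P0 P3 P2 P5 P4 P7 P6 P8"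
| "tau P2 = Perm P2 P3 P0 P1 P6 P7 P4 P5 P8"
| "tau P3 = Perm P3 P2 P1 P0 P7 P6 P5 P4 P8"
| "tau P4 = Perm P4 P5 P6 P7 P0 P1 P2 P3 P8"
| "tau P5 = Perm P5 P4 P7 P6 P1 P0 P3 P2 P8"
| "tau P6 = Perm P6 P7 P4 P5 P2 P3 P0 P1 P8"
| "tau P7 = Perm P7 P6 P5 P4 P3 P2 P1 P0 P8"
| "tau P8 = Perm P0 P1 P2 P3 P4 P5 P6 P7 P8"

fun mu :: "pt \<Rightarrow> perm" where
  "mu P0 = Perm P0 P1 P2 P3 P4 P5 P6 P7 P8"
| "mu P1 = Perm P0 P1 P2 P3 P4 P5 P6 P7 P8"
| "mu P2 = Perm P0 P2 P4 P6 P3 P1 P7 P5 P8"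
| "mu P3 = Perm P0 P3 P6 P5 P7 P4 P1 P2 P8"
| "mu P4 = Perm P0 P4 P3 P7 P6 P2 P5 P1 P8"
| "mu P5 = Perm P0 P5 P1 P4 P2 P7 P3 P6 P8"
| "mu P6 = Perm P0 P6 P7 P1 P5 P3 P2 P4 P8"
| "mu P7 = Perm P0 P7 P5 P2 P1 P6 P4 P3 P8"
| "mu P8 = Perm P0 P1 P2 P3 P4 P5 P6 P7 P8"

definition winv :: perm where
  "winv = Perm P8 P1 P5 P6 P7 P2 P3 P4 P0"

text \<open>The Bruhat decomposition, indexed by the image i of infinity: the affine maps a x + b
  fix infinity, and inversion followed by the translation by i moves it to i.\<close>

definition el :: "pt \<Rightarrow> pt \<Rightarrow> pt \<Rightarrow> perm" where
  "el i b a = (let h = cmp (tau b) (mu a) in if i = P8 then h else cmp (tau i) (cmp winv h))"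

text \<open>The map 1 / (x + 1). It cycles 0, 1, infinity, has order 3 and fixes no point. The group
  it generates, its centralizer and the normalizer of that group serve as the standard C3, C9 and
  D9.\<close>

definition cyc :: perm where
  "cyc = Perm P1 P8 P6 P5 P2 P7 P4 P3 P0"

definition pts :: "pt list" where
  "pts = [P0, P1, P2, P3, P4, P5, P6, P7, P8]"

text \<open>Here i runs through all points, b through the field and a through its nonzero elements,
  which gives 9 * 8 * 7 = 504 entries.\<close>

definition group_list :: "perm list" where
  "group_list = [el i b a. i \<leftarrow> pts, b \<leftarrow> butlast pts, a \<leftarrow> butlast (tl pts)]"

fun pow :: "nat \<Rightarrow> perm \<Rightarrow> perm" where
  "pow 0 p = idp"
| "pow (Suc n) p = cmp p (pow n p)"

definition fixpts :: "perm \<Rightarrow> pt list" where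
  "fixpts p = filter (\<lambda>x. ap p x = x) pts"

text \<open>The element of the group that maps 0, 1, \<open>\<infinity>\<close> to \<open>x\<close>, \<open>y\<close>, \<open>z\<close>.\<close>

definition tri :: "pt \<Rightarrow> pt \<Rightarrow> pt \<Rightarrow> perm" where
  "tri x y z = (let h = (if z = P8 then idp else cmp winv (tau z)); b = ap h x in el z b (ap (tau b) (ap h y)))"

lemma in_pts [simp]: "x \<in> set pts"
  by (cases x) (auto simp: pts_def)

lemma ap_cmp [simp]: "ap (cmp p q) x = ap p (ap q x)"
  by (cases x) (simp_all add: cmp_def)

lemma ap_idp [simp]: "ap idp x = x"
  by (cases x) (simp_all add: idp_def)

lemma perm_eqI: "(\<And>x. ap p x = ap q x) \<Longrightarrow> p = q"
proof -
  assume *: "\<And>x. ap p x = ap q x"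
  show "p = q"
    using *[of P0] *[of P1] *[of P2] *[of P3] *[of P4] *[of P5] *[of P6] *[of P7] *[of P8]
    by (cases p; cases q) simp
qed

lemma cmp_assoc: "cmp (cmp p q) r = cmp p (cmp q r)"
  by (rule perm_eqI) simp

lemma cmp_idp [simp]: "cmp p idp = p" "cmp idp p = p"
  by (rule perm_eqI, simp)+

text \<open>Inversion and translations are involutions, so h undoes the part of \<open>el\<close>
  that moves infinity to z. What remains is an affine map, whose parameters b and a are read off at
  0 and 1; for distinct points they are admissible in \<open>el\<close>.\<close>

lemma tri_check:
  "list_all (\<lambda>x. list_all (\<lambda>y. list_all (\<lambda>z. x = y \<or> x = z \<or> y = z \<or>
     (let p = tri x y z in ap p P0 = x \<and> ap p P1 = y \<and> ap p P8 = z \<and>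
       (let h = (if z = P8 then idp else cmp winv (tau z)); b = ap h x; a = ap (tau b) (ap h y)
         in b \<noteq> P8 \<and> a \<noteq> P0 \<and> a \<noteq> P8))) pts) pts) pts"
  by code_simp

text \<open>The first clause is the sharpness of 3-transitivity. The others describe elements of
  order dividing 3, 7 and 8 by their fixed points; they will locate C3, C9 and D9, then D7, then the
  Sylow subgroup.\<close>

lemma group_list_check:
  "list_all (\<lambda>p. tri (ap p P0) (ap p P1) (ap p P8) = p \<and>
     (pow 3 p = idp \<longrightarrow> p = idp \<or> ap p P0 \<noteq> P0) \<and>
     (pow 7 p = idp \<longrightarrow> p = idp \<or> length (fixpts p) = 2) \<and>
     (pow 8 p = idp \<longrightarrow> p = idp \<or> length (fixpts p) = 1 \<and> pow 2 p = idp)) group_list"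
  by code_simp

text \<open>This count and the next ones are compared with the order of a given subgroup, which
  turns the inclusion of a conjugate into an equality.\<close>

lemma centralizer_check: "length (filter (\<lambda>p. cmp p cyc = cmp cyc p) group_list) = 9"
  by code_simp

lemma normalizer_check:
  "length (filter (\<lambda>p. cmp p cyc = cmp cyc p \<or> cmp p cyc = cmp (cmp cyc cyc) p) group_list) = 18"
  by code_simp

lemma pair_check:
  "length (filter (\<lambda>p. ap p P0 = P0 \<and> ap p P1 = P1 \<or> ap p P0 = P1 \<and> ap p P1 = P0) group_list) = 14"
  by code_simp

lemma unipotent_check:
  "list_all (\<lambda>x. length (filter (\<lambda>p. ap p x = x \<and> pow 2 p = idp) group_list) = 8) pts"
  by code_simp

lemma cyc_check:
  "list_all (\<lambda>x. ap cyc x \<noteq> x \<and> ap cyc (ap cyc (ap cyc x)) = x) pts \<and> cyc = tri P1 P8 P0"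
  by code_simp

lemma length_group_list: "length group_list = 504"
  by code_simp

text \<open>\<open>tri\<close> is injective on these triples, which bounds the number of distinct
  entries of \<open>group_list\<close> from below and avoids comparing the entries pairwise.\<close>

lemma count_triples:
  "length (filter (\<lambda>(x, y, z). x \<noteq> y \<and> x \<noteq> z \<and> y \<noteq> z) (List.product pts (List.product pts pts))) = 504"
  by code_simp

text \<open>A membership test without a search: p is compared with the one group element that has
  the same images of 0, 1, infinity.\<close>

definition in_group :: "perm \<Rightarrow> bool" where
  "in_group p \<longleftrightarrow> (let x = ap p P0; y = ap p P1; z = ap p P8 in x \<noteq> y \<and> x \<noteq> z \<and> y \<noteq> z \<and> tri x y z = p)"

section \<open>Encoding of cosets and tables of coefficients\<close>

datatype ty = T0 | T1 | T2

fun num :: "pt \<Rightarrow> int" where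
  "num P0 = 0"
| "num P1 = 1"
| "num P2 = 2"
| "num P3 = 3"
| "num P4 = 4"
| "num P5 = 5"
| "num P6 = 6"
| "num P7 = 7"
| "num P8 = 8"

text \<open>The preimage of 0. The last branch is also the default when 0 is not a value, which
  cannot happen for an element of the group.\<close>

definition pre0 :: "perm \<Rightarrow> pt" where
  "pre0 p = (case p of Perm a0 a1 a2 a3 a4 a5 a6 a7 a8 \<Rightarrow>
     if a0 = P0 then P0 else if a1 = P0 then P1 else if a2 = P0 then P2 else if a3 = P0 then P3 else if a4 = P0 then P4 else if a5 = P0 then P5 else if a6 = P0 then P6 else if a7 = P0 then P7 else P8)"

text \<open>An encoding of the cosets of \<open>C\<^sub>3\<close>, \<open>C\<^sub>9\<close>, \<open>D\<^sub>7\<close>, one type of coset for each: the images of \<open>0, 1, \<infinity>\<close> up to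
  rotation, the 3-cycle through \<open>0\<close> of the conjugate of \<open>cyc\<close> by \<open>p\<close>, and the unordered pair of images of
  \<open>0, 1\<close>. The three kinds of triples are told apart by their repeated entries.\<close>

fun key :: "ty \<Rightarrow> perm \<Rightarrow> pt \<times> pt \<times> pt" where
  "key T0 p = (let x = ap p P0; y = ap p P1; z = ap p P8 in
     if num x < num y then if num x < num z then (x, y, z) else (z, x, y)
     else if num y < num z then (y, z, x) else (z, x, y))"
| "key T1 p = (let u = ap cyc (pre0 p); v = ap p (ap cyc u) in (ap p u, v, v))"
| "key T2 p = (let x = ap p P0; y = ap p P1 in if num x < num y then (x, x, y) else (y, y, x))"

text \<open>One level of a search tree branching over the points. Three levels form a table of
  integers addressed by keys, in which an update rewrites a single path.\<close>

datatype 'a nine = N9 'a 'a 'a 'a 'a 'a 'a 'a 'a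

fun upd9 :: "pt \<Rightarrow> ('a \<Rightarrow> 'a) \<Rightarrow> 'a nine \<Rightarrow> 'a nine" where
  "upd9 P0 f (N9 a0 a1 a2 a3 a4 a5 a6 a7 a8) = N9 (f a0) a1 a2 a3 a4 a5 a6 a7 a8"
| "upd9 P1 f (N9 a0 a1 a2 a3 a4 a5 a6 a7 a8) = N9 a0 (f a1) a2 a3 a4 a5 a6 a7 a8"
| "upd9 P2 f (N9 a0 a1 a2 a3 a4 a5 a6 a7 a8) = N9 a0 a1 (f a2) a3 a4 a5 a6 a7 a8"
| "upd9 P3 f (N9 a0 a1 a2 a3 a4 a5 a6 a7 a8) = N9 a0 a1 a2 (f a3) a4 a5 a6 a7 a8"
| "upd9 P4 f (N9 a0 a1 a2 a3 a4 a5 a6 a7 a8) = N9 a0 a1 a2 a3 (f a4) a5 a6 a7 a8"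
| "upd9 P5 f (N9 a0 a1 a2 a3 a4 a5 a6 a7 a8) = N9 a0 a1 a2 a3 a4 (f a5) a6 a7 a8"
| "upd9 P6 f (N9 a0 a1 a2 a3 a4 a5 a6 a7 a8) = N9 a0 a1 a2 a3 a4 a5 (f a6) a7 a8"
| "upd9 P7 f (N9 a0 a1 a2 a3 a4 a5 a6 a7 a8) = N9 a0 a1 a2 a3 a4 a5 a6 (f a7) a8"
| "upd9 P8 f (N9 a0 a1 a2 a3 a4 a5 a6 a7 a8) = N9 a0 a1 a2 a3 a4 a5 a6 a7 (f a8)"

fun sum9 :: "(pt \<Rightarrow> 'a \<Rightarrow> int) \<Rightarrow> 'a nine \<Rightarrow> int" where
  "sum9 f (N9 a0 a1 a2 a3 a4 a5 a6 a7 a8) =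
     f P0 a0 + f P1 a1 + f P2 a2 + f P3 a3 + f P4 a4 + f P5 a5 + f P6 a6 + f P7 a7 + f P8 a8"

fun all9 :: "('a \<Rightarrow> bool) \<Rightarrow> 'a nine \<Rightarrow> bool" where
  "all9 Q (N9 a0 a1 a2 a3 a4 a5 a6 a7 a8) \<longleftrightarrow> Q a0 \<and> Q a1 \<and> Q a2 \<and> Q a3 \<and> Q a4 \<and> Q a5 \<and> Q a6 \<and> Q a7 \<and> Q a8"

definition rep9 :: "'a \<Rightarrow> 'a nine" where
  "rep9 x = N9 x x x x x x x x x"

type_synonym tree = "int nine nine nine"

definition add_key :: "int \<Rightarrow> pt \<times> pt \<times> pt \<Rightarrow> tree \<Rightarrow> tree" where
  "add_key c k t = (case k of (x, y, z) \<Rightarrow> upd9 x (upd9 y (upd9 z (\<lambda>d. d + c))) t)"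

fun add_comb :: "int \<Rightarrow> perm \<Rightarrow> (int \<times> ty \<times> perm) list \<Rightarrow> tree \<Rightarrow> tree" where
  "add_comb c g [] t = t"
| "add_comb c g ((d, s, h) # bs) t = add_comb c g bs (add_key (c * d) (key s (cmp g h)) t)"

text \<open>A list of pairs (c, g) is an element of the group ring and \<open>bs\<close> is a formal
  sum of cosets; the table t receives their product.\<close>

fun add_combs :: "(int \<times> ty \<times> perm) list \<Rightarrow> (int \<times> perm) list \<Rightarrow> tree \<Rightarrow> tree" where
  "add_combs bs [] t = t"
| "add_combs bs ((c, g) # gs) t = add_combs bs gs (add_comb c g bs t)"

definition zero_tree :: tree where
  "zero_tree = rep9 (rep9 (rep9 0))"

definition is_zero :: "tree \<Rightarrow> bool" where
  "is_zero = all9 (all9 (all9 (\<lambda>c. c = 0)))"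

text \<open>Pairs a table with an arbitrary function on keys. What the computations establish is
  stated through this pairing, so the meaning of a key enters only with the choice of the
  function.\<close>

definition tree_sum :: "(pt \<times> pt \<times> pt \<Rightarrow> int) \<Rightarrow> tree \<Rightarrow> int" where
  "tree_sum \<Phi> = sum9 (\<lambda>x. sum9 (\<lambda>y. sum9 (\<lambda>z c. c * \<Phi> (x, y, z))))"

lemma sum9_upd9:
  assumes "\<And>a. F x (f a) = F x a + \<delta>"
  shows "sum9 F (upd9 x f t) = sum9 F t + \<delta>"
  using assms by (cases x; cases t) simp_all

lemma tree_sum_add_key: "tree_sum \<Phi> (add_key c k t) = tree_sum \<Phi> t + c * \<Phi> k"
proof -
  obtain x y z where k: "k = (x, y, z)" by (cases k)
  show ?thesis unfolding tree_sum_def add_key_def k prod.case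
    by (intro sum9_upd9) (simp add: algebra_simps)
qed

lemma sum9_zero: "all9 Q t \<Longrightarrow> (\<And>x a. Q a \<Longrightarrow> F x a = 0) \<Longrightarrow> sum9 F t = 0"
  by (cases t) simp

lemma tree_sum_zero:
  assumes "is_zero t"
  shows "tree_sum \<Phi> t = 0"
  unfolding tree_sum_def
  by (rule sum9_zero[OF assms[unfolded is_zero_def]], erule sum9_zero, erule sum9_zero) simp

lemma tree_sum_zero_tree: "tree_sum \<Phi> zero_tree = 0"
  by (rule tree_sum_zero) (simp add: is_zero_def zero_tree_def rep9_def)

lemma tree_sum_add_comb:
  "tree_sum \<Phi> (add_comb c g bs t) = tree_sum \<Phi> t + c * (\<Sum>(d, s, h)\<leftarrow>bs. d * \<Phi> (key s (cmp g h)))"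
  by (induction c g bs t rule: add_comb.induct) (auto simp: tree_sum_add_key algebra_simps simp del: key.simps)

lemma tree_sum_add_combs:
  "tree_sum \<Phi> (add_combs bs gs t) =
     tree_sum \<Phi> t + (\<Sum>(c, g)\<leftarrow>gs. c * (\<Sum>(d, s, h)\<leftarrow>bs. d * \<Phi> (key s (cmp g h))))"
  by (induction bs gs t rule: add_combs.induct) (auto simp: tree_sum_add_comb)

text \<open>An entry \<open>(d, s, h)\<close> stands for \<open>d\<close> times the translate by \<open>h\<close> of the base coset of type \<open>s\<close>, and
  \<open>Rij\<close> lists the coefficients of the translates of \<open>Bj\<close> in an expression of the base coset of type \<open>Ti\<close>.
  All coefficients were found by solving integral linear systems.\<close>

definition B0 :: "(int \<times> ty \<times> perm) list" where
  "B0 = [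
    (-1, T0, el P6 P3 P4), (-1, T0, el P4 P2 P7), (-1, T0, el P4 P3 P3), (-1, T0, el P7 P7 P2),
    (1, T1, el P0 P6 P4), (1, T1, el P0 P2 P1), (1, T1, el P0 P3 P4)]"

definition B1 :: "(int \<times> ty \<times> perm) list" where
  "B1 = [
    (1, T1, el P0 P1 P6), (1, T1, el P0 P1 P3), (-1, T1, el P0 P1 P1), (1, T1, el P0 P5 P7),
    (1, T1, el P0 P6 P4), (1, T1, el P0 P6 P6), (1, T1, el P0 P7 P6), (1, T1, el P0 P7 P4),
    (1, T1, el P0 P2 P3), (1, T1, el P0 P2 P7), (1, T1, el P0 P2 P4), (1, T1, el P0 P2 P1),
    (1, T1, el P0 P3 P4), (1, T1, el P0 P3 P1), (1, T1, el P0 P3 P7), (1, T1, el P0 P3 P3),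
    (1, T1, el P0 P4 P7), (-1, T1, el P0 P0 P1), (1, T1, el P0 P0 P6), (1, T1, el P0 P0 P3),
    (-1, T2, el P4 P7 P3), (-1, T2, el P3 P6 P2), (-1, T2, el P0 P1 P4), (-1, T2, el P0 P1 P3),
    (-1, T2, el P0 P5 P1), (-1, T2, el P0 P6 P5), (-1, T2, el P0 P7 P5), (-1, T2, el P0 P3 P3),
    (-1, T2, el P0 P4 P4)]"

definition B2 :: "(int \<times> ty \<times> perm) list" where
  "B2 = [
    (1, T0, el P2 P5 P3), (1, T0, el P3 P6 P3), (1, T0, el P4 P7 P5), (1, T0, el P5 P2 P5),
    (1, T0, el P6 P3 P7), (1, T0, el P7 P4 P7), (1, T0, el P8 P0 P1), (1, T0, el P1 P1 P7),
    (1, T0, el P1 P1 P4), (1, T0, el P1 P1 P3), (1, T0, el P1 P1 P6), (1, T0, el P1 P1 P5),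
    (1, T0, el P1 P1 P2), (1, T0, el P1 P1 P1), (1, T0, el P8 P2 P1), (1, T0, el P3 P1 P5),
    (1, T0, el P7 P2 P4), (1, T0, el P8 P2 P6), (-1, T0, el P4 P3 P2), (-1, T0, el P6 P7 P1),
    (1, T0, el P8 P2 P7), (1, T0, el P6 P7 P6), (-1, T0, el P6 P7 P7), (-1, T0, el P4 P4 P5),
    (1, T0, el P5 P3 P5), (-1, T0, el P4 P4 P2), (1, T0, el P5 P3 P6), (-1, T0, el P8 P3 P4),
    (1, T0, el P5 P3 P3), (1, T0, el P6 P2 P2), (1, T0, el P5 P1 P7), (1, T0, el P6 P5 P4),
    (1, T0, el P8 P4 P3), (1, T0, el P6 P6 P7), (-1, T0, el P8 P6 P1), (-1, T1, el P0 P5 P2),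
    (-1, T1, el P0 P5 P1), (-1, T1, el P0 P6 P3), (-1, T1, el P0 P6 P6), (-1, T1, el P0 P7 P4),
    (-1, T1, el P0 P7 P3), (-1, T1, el P0 P2 P4), (-1, T1, el P0 P2 P2), (-1, T1, el P0 P3 P5),
    (-1, T1, el P0 P3 P1), (-1, T1, el P0 P4 P6), (-1, T1, el P0 P4 P7), (-1, T1, el P0 P0 P5),
    (-1, T1, el P0 P0 P7), (-1, T2, el P8 P0 P1)]"

definition R00 :: "(int \<times> perm) list" where
  "R00 = [
    (-3, el P0 P1 P4), (6, el P0 P1 P7), (-13, el P0 P1 P6), (-4, el P0 P1 P3), (2, el P0 P1 P2),
    (-5, el P0 P1 P5), (15, el P0 P1 P1), (4, el P0 P5 P4), (1, el P0 P5 P3), (1, el P0 P5 P2),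
    (-4, el P0 P5 P7), (-8, el P0 P5 P6), (1, el P0 P5 P1), (2, el P0 P5 P5), (-1, el P0 P6 P7),
    (-3, el P0 P6 P3), (10, el P0 P6 P1), (-6, el P0 P6 P4), (8, el P0 P6 P5), (-1, el P0 P6 P2),
    (-4, el P0 P6 P6), (-4, el P0 P7 P6), (5, el P0 P7 P2), (1, el P0 P7 P1), (5, el P0 P7 P5),
    (-6, el P0 P7 P4), (1, el P0 P7 P3), (-3, el P0 P7 P7), (-5, el P0 P2 P3), (1, el P0 P2 P7),
    (-5, el P0 P2 P4), (3, el P0 P2 P5), (-1, el P0 P2 P1), (-4, el P0 P2 P6), (-5, el P0 P2 P2),
    (1, el P0 P3 P2), (2, el P0 P3 P6), (2, el P0 P3 P5), (-2, el P0 P3 P4), (-2, el P0 P3 P1),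
    (-5, el P0 P3 P7), (-13, el P0 P3 P3), (1, el P0 P4 P5), (-5, el P0 P4 P1), (4, el P0 P4 P2),
    (-7, el P0 P4 P3), (-9, el P0 P4 P7), (6, el P0 P4 P4), (3, el P0 P0 P1), (1, el P0 P0 P5),
    (-5, el P0 P0 P6), (4, el P0 P0 P7), (1, el P0 P0 P2), (-4, el P0 P0 P3), (-1, el P0 P0 P4),
    (1, el P2 P1 P7), (-6, el P1 P6 P4), (1, el P1 P6 P1), (5, el P2 P7 P1), (5, el P1 P6 P5),
    (-4, el P2 P0 P6), (-7, el P2 P6 P7), (-9, el P3 P4 P1), (4, el P5 P7 P4), (-5, el P1 P5 P1),
    (1, el P1 P5 P5), (-2, el P1 P2 P4), (-5, el P3 P5 P1), (2, el P4 P1 P3), (2, el P4 P5 P7),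
    (-2, el P1 P2 P1), (1, el P8 P1 P5), (10, el P1 P7 P1), (-1, el P5 P3 P4), (8, el P4 P2 P3),
    (-3, el P6 P4 P2), (-6, el P7 P3 P6), (-1, el P8 P1 P4), (1, el P2 P6 P1), (1, el P1 P4 P1),
    (-8, el P4 P2 P7), (1, el P6 P6 P2), (-4, el P6 P1 P5), (4, el P1 P4 P4), (3, el P1 P3 P5),
    (-4, el P3 P5 P2), (-1, el P1 P3 P1), (-5, el P7 P5 P6), (1, el P6 P4 P5), (-5, el P7 P0 P3),
    (-13, el P2 P6 P6), (-5, el P1 P0 P5), (2, el P8 P4 P5), (6, el P8 P5 P4), (-3, el P1 P0 P4),
    (-4, el P7 P3 P3), (-5, el P4 P3 P7), (-2, el P3 P3 P2), (4, el P7 P2 P5), (-2, el P8 P2 P1),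
    (1, el P4 P4 P7), (-4, el P2 P3 P7), (3, el P6 P7 P2), (2, el P4 P0 P3), (4, el P3 P1 P2),
    (-6, el P2 P4 P7), (1, el P5 P6 P2), (-8, el P2 P4 P6), (-5, el P5 P0 P4), (5, el P6 P2 P5),
    (11, el P6 P5 P2), (-5, el P5 P4 P2), (-6, el P7 P2 P3), (-2, el P2 P7 P7), (-1, el P7 P7 P5),
    (5, el P2 P2 P1), (-9, el P2 P2 P6), (-4, el P7 P1 P3), (2, el P8 P2 P5), (-1, el P8 P3 P1),
    (-8, el P4 P3 P3), (-9, el P5 P4 P4), (-6, el P2 P0 P7), (8, el P8 P7 P5), (-9, el P5 P3 P2),
    (-4, el P6 P2 P7), (-2, el P3 P4 P3), (1, el P4 P0 P4), (-8, el P5 P1 P2), (-1, el P3 P3 P1),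
    (15, el P5 P5 P6), (-4, el P3 P3 P3), (-6, el P6 P5 P7), (4, el P3 P2 P1), (-8, el P7 P7 P6),
    (3, el P3 P2 P2), (4, el P3 P7 P3), (6, el P5 P3 P6), (-9, el P7 P1 P6), (-5, el P8 P3 P4),
    (-4, el P4 P4 P4), (5, el P3 P0 P2), (-6, el P8 P7 P4), (5, el P4 P1 P4), (-1, el P5 P5 P4),
    (1, el P8 P4 P1), (1, el P4 P5 P3), (1, el P6 P0 P5), (4, el P5 P1 P4), (-5, el P4 P6 P3),
    (1, el P7 P0 P6), (-5, el P8 P5 P1), (5, el P6 P5 P5), (-3, el P7 P6 P6), (4, el P6 P1 P7),
    (-7, el P5 P6 P6), (-2, el P6 P6 P7), (4, el P7 P0 P5), (1, el P5 P0 P6), (-1, el P7 P5 P5),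
    (1, el P8 P6 P1), (10, el P8 P7 P1)]"

definition R01 :: "(int \<times> perm) list" where
  "R01 = [
    (-1, el P0 P1 P7), (2, el P0 P7 P6), (1, el P0 P2 P3), (-3, el P0 P0 P1), (-1, el P0 P7 P2),
    (1, el P0 P5 P7), (-1, el P0 P6 P1), (1, el P0 P2 P4), (-1, el P0 P3 P5), (-1, el P0 P6 P2),
    (1, el P0 P0 P6), (1, el P0 P3 P4), (1, el P0 P2 P1), (2, el P0 P4 P7), (2, el P0 P0 P3),
    (-1, el P0 P0 P4)]"

definition R02 :: "(int \<times> perm) list" where
  "R02 = [
    (1, el P7 P4 P6), (1, el P4 P7 P3), (-2, el P6 P3 P5), (-1, el P5 P2 P4), (2, el P0 P1 P4),
    (-2, el P0 P1 P6), (1, el P0 P1 P3), (-2, el P0 P1 P5), (-1, el P7 P2 P6), (-2, el P0 P5 P4),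
    (-1, el P0 P5 P3), (-3, el P0 P5 P2), (-2, el P0 P5 P7), (-3, el P0 P5 P5), (-2, el P0 P6 P7),
    (1, el P0 P6 P3), (-3, el P0 P6 P1), (-1, el P0 P6 P5), (-1, el P0 P7 P6), (3, el P0 P7 P2),
    (2, el P0 P7 P5), (1, el P0 P7 P3), (1, el P0 P7 P7), (-1, el P0 P2 P7), (-2, el P0 P2 P5),
    (-2, el P0 P2 P2), (-2, el P5 P6 P4), (1, el P0 P3 P5), (-1, el P0 P3 P7), (-1, el P0 P3 P3),
    (-2, el P2 P2 P7), (-1, el P0 P4 P3), (-2, el P0 P4 P7), (-2, el P0 P0 P6), (-1, el P0 P0 P7),
    (1, el P0 P0 P3), (1, el P0 P0 P4)]"

definition R10 :: "(int \<times> perm) list" where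
  "R10 = [
    (-4, el P0 P1 P4), (-6, el P0 P1 P7), (7, el P0 P1 P6), (3, el P0 P1 P3), (1, el P0 P1 P2),
    (4, el P0 P1 P5), (-19, el P0 P1 P1), (-3, el P0 P5 P4), (-4, el P0 P5 P3), (-3, el P0 P5 P2),
    (2, el P0 P5 P7), (4, el P0 P5 P6), (-4, el P0 P5 P1), (1, el P0 P5 P5), (-3, el P0 P6 P7),
    (4, el P0 P6 P3), (-10, el P0 P6 P1), (7, el P0 P6 P4), (-10, el P0 P6 P5), (-3, el P0 P6 P2),
    (3, el P0 P6 P6), (3, el P0 P7 P6), (-6, el P0 P7 P2), (-4, el P0 P7 P1), (-4, el P0 P7 P5),
    (5, el P0 P7 P4), (-4, el P0 P7 P3), (-4, el P0 P7 P7), (5, el P0 P2 P3), (1, el P0 P2 P7),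
    (3, el P0 P2 P4), (-10, el P0 P2 P5), (1, el P0 P2 P1), (1, el P0 P2 P6), (4, el P0 P2 P2),
    (-4, el P0 P3 P2), (-5, el P0 P3 P6), (-4, el P0 P3 P5), (3, el P0 P3 P4), (2, el P0 P3 P1),
    (2, el P0 P3 P7), (7, el P0 P3 P3), (-5, el P0 P4 P5), (4, el P0 P4 P1), (-4, el P0 P4 P2),
    (4, el P0 P4 P3), (-4, el P0 P4 P6), (1, el P0 P4 P7), (-6, el P0 P4 P4), (-5, el P0 P0 P1),
    (-4, el P0 P0 P5), (5, el P0 P0 P6), (-3, el P0 P0 P7), (-5, el P0 P0 P2), (3, el P0 P0 P3),
    (-3, el P0 P0 P4), (-4, el P2 P1 P7), (5, el P1 P6 P4), (-4, el P1 P6 P1), (-6, el P2 P7 P1),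
    (-4, el P1 P6 P5), (3, el P2 P0 P6), (4, el P2 P6 P7), (1, el P3 P4 P1), (-4, el P5 P7 P4),
    (4, el P1 P5 P1), (-4, el P3 P7 P2), (-5, el P1 P5 P5), (3, el P1 P2 P4), (2, el P3 P5 P1),
    (-4, el P4 P1 P3), (-5, el P4 P5 P7), (2, el P1 P2 P1), (-4, el P8 P1 P5), (-10, el P1 P7 P1),
    (-3, el P5 P3 P4), (-10, el P4 P2 P3), (4, el P6 P4 P2), (7, el P7 P3 P6), (-3, el P8 P1 P4),
    (-3, el P2 P6 P1), (-4, el P1 P4 P1), (4, el P4 P2 P7), (-4, el P6 P6 P2), (2, el P6 P1 P5),
    (-3, el P1 P4 P4), (-10, el P1 P3 P5), (1, el P3 P5 P2), (1, el P1 P3 P1), (3, el P7 P5 P6),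
    (1, el P6 P4 P5), (5, el P7 P0 P3), (7, el P2 P6 P6), (4, el P1 P0 P5), (1, el P8 P4 P5),
    (-6, el P8 P5 P4), (-4, el P1 P0 P4), (3, el P7 P3 P3), (1, el P4 P3 P7), (4, el P3 P3 P2),
    (-3, el P6 P7 P5), (-3, el P7 P2 P5), (2, el P8 P2 P1), (-4, el P4 P4 P7), (3, el P2 P3 P7),
    (-5, el P6 P7 P2), (-3, el P2 P3 P1), (-5, el P4 P0 P3), (-5, el P3 P1 P2), (7, el P2 P4 P7),
    (-4, el P5 P6 P2), (3, el P2 P4 P6), (2, el P5 P0 P4), (-4, el P6 P2 P5), (-19, el P6 P5 P2),
    (1, el P5 P4 P2), (7, el P7 P2 P3), (3, el P2 P7 P7), (-6, el P7 P7 P5), (-4, el P2 P2 P1),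
    (5, el P2 P2 P6), (3, el P7 P1 P3), (-4, el P8 P2 P5), (1, el P8 P3 P1), (4, el P4 P3 P3),
    (1, el P5 P4 P4), (5, el P2 P0 P7), (-10, el P8 P7 P5), (5, el P5 P3 P2), (3, el P6 P2 P7),
    (4, el P3 P4 P3), (1, el P4 P0 P4), (3, el P5 P1 P2), (-6, el P3 P3 P1), (-19, el P5 P5 P6),
    (1, el P3 P3 P3), (7, el P6 P5 P7), (-3, el P3 P2 P1), (3, el P7 P7 P6), (-10, el P3 P2 P2),
    (-5, el P3 P7 P3), (-5, el P5 P3 P6), (5, el P7 P1 P6), (3, el P8 P3 P4), (2, el P4 P4 P4),
    (-4, el P3 P0 P3), (-4, el P3 P0 P2), (7, el P8 P7 P4), (-4, el P4 P1 P4), (-6, el P5 P5 P4),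
    (-4, el P8 P4 P1), (-3, el P4 P5 P4), (-4, el P4 P5 P3), (-3, el P6 P0 P5), (-3, el P5 P1 P4),
    (1, el P4 P6 P3), (-4, el P7 P0 P6), (4, el P8 P5 P1), (-6, el P6 P5 P5), (4, el P7 P6 P6),
    (-5, el P6 P1 P7), (4, el P5 P6 P6), (4, el P6 P6 P7), (-4, el P7 P0 P5), (-4, el P5 P0 P6),
    (-3, el P7 P5 P5), (-4, el P8 P6 P1), (-10, el P8 P7 P1)]"

definition R11 :: "(int \<times> perm) list" where
  "R11 = [
    (1, el P0 P1 P4), (1, el P0 P1 P7), (-1, el P0 P7 P6), (-1, el P0 P2 P3), (4, el P0 P0 P1),
    (1, el P0 P7 P2), (-1, el P0 P5 P7), (1, el P0 P6 P1), (-1, el P0 P2 P4), (1, el P0 P3 P5),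
    (1, el P0 P6 P2), (-1, el P0 P0 P6), (1, el P0 P7 P5), (-1, el P0 P3 P4), (1, el P0 P0 P7),
    (-1, el P0 P2 P1), (-1, el P0 P4 P7), (-1, el P0 P0 P3), (1, el P0 P0 P4)]"

definition R12 :: "(int \<times> perm) list" where
  "R12 = [
    (-2, el P8 P0 P1), (-1, el P7 P4 P6), (-2, el P3 P6 P2), (1, el P6 P3 P5), (-2, el P2 P5 P7),
    (-2, el P0 P1 P4), (1, el P0 P1 P2), (1, el P0 P1 P5), (1, el P0 P5 P3), (-2, el P0 P5 P1),
    (3, el P0 P5 P5), (-2, el P4 P4 P3), (-1, el P0 P6 P7), (-2, el P0 P6 P3), (1, el P0 P6 P1),
    (-2, el P0 P6 P4), (-2, el P0 P6 P2), (1, el P0 P7 P6), (-2, el P0 P7 P2), (-2, el P0 P7 P5),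
    (-1, el P0 P7 P3), (-2, el P0 P2 P3), (1, el P0 P2 P7), (-2, el P0 P2 P6), (1, el P0 P2 P2),
    (1, el P5 P6 P4), (-2, el P0 P3 P2), (-2, el P0 P3 P6), (-2, el P0 P3 P5), (-2, el P0 P3 P4),
    (-1, el P0 P3 P1), (-2, el P0 P3 P7), (1, el P2 P2 P7), (3, el P0 P4 P7), (-2, el P1 P0 P1),
    (-2, el P0 P0 P1), (-2, el P0 P0 P5), (1, el P0 P0 P6), (-1, el P0 P0 P7), (-2, el P0 P0 P2),
    (-2, el P0 P0 P3), (-2, el P0 P0 P4)]"

definition R20 :: "(int \<times> perm) list" where
  "R20 = [
    (16, el P0 P1 P4), (16, el P0 P1 P7), (16, el P0 P1 P6), (16, el P0 P1 P3), (16, el P0 P1 P2),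
    (16, el P0 P1 P5), (16, el P0 P1 P1), (16, el P0 P5 P4), (3, el P0 P5 P3), (-39, el P0 P5 P2),
    (29, el P0 P5 P7), (8, el P0 P5 P6), (-4, el P0 P5 P1), (-44, el P0 P5 P5), (16, el P0 P6 P7),
    (-4, el P0 P6 P3), (8, el P0 P6 P1), (-44, el P0 P6 P4), (3, el P0 P6 P5), (29, el P0 P6 P2),
    (-39, el P0 P6 P6), (16, el P0 P7 P6), (-44, el P0 P7 P2), (29, el P0 P7 P1), (8, el P0 P7 P5),
    (-4, el P0 P7 P4), (-39, el P0 P7 P3), (3, el P0 P7 P7), (16, el P0 P2 P3), (8, el P0 P2 P7),
    (-39, el P0 P2 P4), (29, el P0 P2 P5), (-44, el P0 P2 P1), (3, el P0 P2 P6), (-4, el P0 P2 P2),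
    (16, el P0 P3 P2), (29, el P0 P3 P6), (-4, el P0 P3 P5), (3, el P0 P3 P4), (-39, el P0 P3 P1),
    (-44, el P0 P3 P7), (8, el P0 P3 P3), (16, el P0 P4 P5), (3, el P0 P4 P1), (8, el P0 P4 P2),
    (-44, el P0 P4 P3), (-4, el P0 P4 P6), (-39, el P0 P4 P7), (29, el P0 P4 P4), (16, el P0 P0 P1),
    (-39, el P0 P0 P5), (-44, el P0 P0 P6), (-4, el P0 P0 P7), (3, el P0 P0 P2), (29, el P0 P0 P3),
    (8, el P0 P0 P4), (-4, el P2 P1 P7), (-44, el P1 P6 P4), (8, el P1 P6 P1), (29, el P2 P7 P1),
    (3, el P1 P6 P5), (-39, el P2 P0 P6), (3, el P2 P6 P7), (29, el P3 P4 P1), (-39, el P5 P7 P4),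
    (-4, el P1 P5 P1), (8, el P3 P7 P2), (-44, el P1 P5 P5), (-39, el P1 P2 P4), (8, el P3 P5 P1),
    (29, el P4 P1 P3), (3, el P4 P5 P7), (-44, el P1 P2 P1), (-4, el P8 P1 P5), (29, el P1 P7 P1),
    (-44, el P5 P3 P4), (8, el P4 P2 P3), (-39, el P6 P4 P2), (-4, el P7 P3 P6), (3, el P8 P1 P4),
    (8, el P2 P6 P1), (3, el P1 P4 P1), (-4, el P4 P2 P7), (-44, el P6 P6 P2), (-39, el P6 P1 P5),
    (29, el P1 P4 P4), (-4, el P1 P3 P5), (29, el P3 P5 P2), (-39, el P1 P3 P1), (3, el P7 P5 P6),
    (-44, el P6 P4 P5), (8, el P7 P0 P3), (-44, el P2 P6 P6), (-39, el P1 P0 P5), (3, el P8 P4 P5),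
    (-4, el P8 P5 P4), (8, el P1 P0 P4), (29, el P7 P3 P3), (22, el P4 P3 P7), (32, el P3 P3 P2),
    (-8, el P6 P7 P5), (-8, el P7 P2 P5), (9, el P8 P2 P1), (32, el P4 P4 P7), (-48, el P2 P3 P7),
    (22, el P6 P7 P2), (9, el P2 P3 P1), (9, el P4 P0 P3), (22, el P3 P1 P2), (-48, el P2 P4 P7),
    (-48, el P5 P6 P2), (-8, el P2 P4 P6), (32, el P5 P0 P4), (-8, el P6 P2 P5), (32, el P6 P5 P2),
    (-48, el P5 P4 P2), (22, el P7 P2 P3), (-48, el P2 P7 P7), (-8, el P7 P7 P5), (9, el P2 P2 P1),
    (-8, el P2 P2 P6), (32, el P7 P1 P3), (22, el P8 P2 P5), (9, el P8 P3 P1), (9, el P4 P3 P3),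
    (22, el P5 P4 P4), (-48, el P2 P0 P7), (32, el P8 P7 P5), (-48, el P5 P3 P2), (-8, el P6 P2 P7),
    (-48, el P3 P4 P3), (32, el P4 P0 P4), (-48, el P5 P1 P2), (9, el P3 P3 P1), (22, el P5 P5 P6),
    (9, el P3 P3 P3), (-8, el P6 P5 P7), (9, el P3 P2 P1), (32, el P7 P7 P6), (22, el P3 P2 P2),
    (-48, el P3 P7 P3), (32, el P5 P3 P6), (22, el P7 P1 P6), (-48, el P8 P3 P4), (22, el P4 P4 P4),
    (9, el P3 P0 P3), (32, el P3 P0 P2), (-48, el P8 P7 P4), (22, el P4 P1 P4), (32, el P5 P5 P4),
    (-8, el P8 P4 P1), (32, el P4 P5 P4), (9, el P4 P5 P3), (-8, el P6 P0 P5), (22, el P5 P1 P4),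
    (9, el P4 P6 P3), (32, el P7 P0 P6), (-8, el P8 P5 P1), (-8, el P6 P5 P5), (22, el P7 P6 P6),
    (9, el P6 P1 P7), (32, el P5 P6 P6), (9, el P6 P6 P7), (-8, el P7 P0 P5), (22, el P5 P0 P6),
    (-8, el P7 P5 P5), (-48, el P8 P6 P1), (-48, el P8 P7 P1)]"

definition R21 :: "(int \<times> perm) list" where
  "R21 = [
    (-6, el P0 P1 P4), (-6, el P0 P1 P7), (-6, el P0 P7 P6), (-6, el P0 P2 P3), (-6, el P0 P1 P2),
    (-6, el P0 P4 P5), (-6, el P0 P0 P1), (-2, el P0 P5 P3), (12, el P0 P7 P2), (-3, el P0 P5 P7),
    (-3, el P0 P3 P6), (-2, el P0 P4 P1), (12, el P0 P0 P5), (-3, el P0 P6 P1), (12, el P0 P2 P4),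
    (-2, el P0 P3 P5), (-3, el P0 P6 P2), (12, el P0 P0 P6), (-3, el P0 P7 P5), (-2, el P0 P3 P4),
    (12, el P0 P7 P3), (-2, el P0 P0 P7), (12, el P0 P2 P1), (-2, el P0 P4 P6), (-2, el P0 P0 P2),
    (12, el P0 P4 P7), (-3, el P0 P0 P3), (-3, el P0 P0 P4)]"

definition R22 :: "(int \<times> perm) list" where
  "R22 = [
    (10, el P8 P0 P1), (-5, el P4 P7 P3), (-5, el P3 P6 P2), (-5, el P2 P5 P7), (10, el P8 P1 P1),
    (-5, el P0 P1 P7), (-5, el P0 P1 P6), (-5, el P0 P1 P5), (-5, el P7 P2 P6), (-5, el P0 P5 P4),
    (-10, el P0 P5 P2), (-1, el P0 P5 P7), (-1, el P0 P5 P6), (-5, el P0 P5 P5), (10, el P0 P6 P3),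
    (-1, el P0 P6 P1), (10, el P0 P6 P5), (-1, el P0 P6 P2), (-1, el P0 P7 P1), (4, el P0 P7 P5),
    (10, el P0 P7 P4), (-5, el P0 P7 P3), (10, el P0 P7 P7), (-5, el P6 P6 P5), (-5, el P0 P2 P3),
    (-1, el P0 P2 P7), (-10, el P0 P2 P4), (-6, el P0 P2 P5), (-5, el P0 P2 P1), (5, el P0 P2 P2),
    (-5, el P5 P6 P4), (-5, el P0 P3 P2), (-1, el P0 P3 P6), (-5, el P0 P3 P1), (-10, el P0 P3 P7),
    (-1, el P0 P3 P3), (10, el P0 P4 P1), (-1, el P0 P4 P2), (-5, el P0 P4 P3), (10, el P0 P4 P6),
    (4, el P0 P4 P4), (-5, el P1 P0 P1), (-5, el P0 P0 P1), (-5, el P0 P0 P5), (-10, el P0 P0 P6),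
    (5, el P0 P0 P2), (-1, el P0 P0 P3), (-6, el P0 P0 P4)]"

text \<open>The list is the group ring element \<open>cyc\<close> - 1, and \<open>cyc\<close>
  generates the standard C3. For \<open>B1\<close> and \<open>B2\<close> all elements of the
  standard D9 and of T are run through.\<close>

lemma B0_invariant: "is_zero (add_combs B0 [(1, cyc), (-1, idp)] zero_tree)"
  by code_simp

lemma B1_invariant:
  "list_all (\<lambda>p. cmp p cyc = cmp cyc p \<or> cmp p cyc = cmp (cmp cyc cyc) p \<longrightarrow>
     is_zero (add_combs B1 [(1, p), (-1, idp)] zero_tree)) group_list"
  by code_simp

lemma B2_invariant:
  "list_all (\<lambda>p. ap p P0 = P0 \<and> ap p P1 = P1 \<longrightarrow>
     is_zero (add_combs B2 [(1, p), (-1, idp)] zero_tree)) group_list"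
  by code_simp

text \<open>The images of the pair \<open>(0, 1)\<close> are the pairs \<open>(0, y)\<close>, respectively \<open>(y, 0)\<close>, with \<open>y \<noteq> 0\<close>.\<close>

definition rows :: "perm list" where
  "rows = map (\<lambda>y. tri P0 y (if y = P8 then P1 else P8)) (tl pts)"

definition cols :: "perm list" where
  "cols = map (\<lambda>y. tri y P0 (if y = P8 then P1 else P8)) (tl pts)"

lemma certificate_in_group:
  "list_all (\<lambda>(d, s, h). in_group h) (B0 @ B1 @ B2)"
  "list_all (\<lambda>(c, g). in_group g) (concat [R00, R01, R02, R10, R11, R12, R20, R21, R22])"
  "list_all in_group (idp # cyc # rows @ cols)"
  by code_simp+

text \<open>The pairs (0, y) minus the pairs (y, 0) form the image of the class of the point 0 in P.
  A homomorphism out of P that kills this element and its translates descends to F.\<close>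

lemma B2_relation:
  "is_zero (add_combs B2 (map (\<lambda>p. (1, p)) rows @ map (\<lambda>p. (-1, p)) cols) zero_tree)"
  by code_simp

text \<open>The innermost term subtracts the base coset, so the vanishing of the table expresses
  that coset as \<open>R00\<close> applied to \<open>B0\<close>, plus \<open>R01\<close> applied to
  \<open>B1\<close>, plus \<open>R02\<close> applied to \<open>B2\<close>.\<close>

lemma generate_T0:
  "is_zero (add_combs B0 R00 (add_combs B1 R01 (add_combs B2 R02 (add_comb (-1) idp [(1, T0, idp)] zero_tree))))"
  by code_simp

lemma generate_T1:
  "is_zero (add_combs B0 R10 (add_combs B1 R11 (add_combs B2 R12 (add_comb (-1) idp [(1, T1, idp)] zero_tree))))"
  by code_simp

lemma generate_T2:
  "is_zero (add_combs B0 R20 (add_combs B1 R21 (add_combs B2 R22 (add_comb (-1) idp [(1, T2, idp)] zero_tree))))"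
  by code_simp

section \<open>Subgroups and fixed points\<close>

lemma set_group_list:
  "set group_list = {el i b a |i b a. b \<in> set (butlast pts) \<and> a \<in> set (butlast (tl pts))}"
proof -
  have "set pts = UNIV" by auto
  then have "set group_list = (\<Union>i. \<Union>b\<in>set (butlast pts). el i b ` set (butlast (tl pts)))"
    by (simp add: group_list_def)
  then show ?thesis by blast
qed

lemma tri_distinct:
  assumes "x \<noteq> y" "x \<noteq> z" "y \<noteq> z"
  shows "ap (tri x y z) P0 = x" "ap (tri x y z) P1 = y" "ap (tri x y z) P8 = z" "tri x y z \<in> set group_list"
proof -
  define h where "h = (if z = P8 then idp else cmp winv (tau z))"
  define b where "b = ap h x"
  define a where "a = ap (tau b) (ap h y)"
  have "ap (tri x y z) P0 = x \<and> ap (tri x y z) P1 = y \<and> ap (tri x y z) P8 = z \<and> b \<noteq> P8 \<and> a \<noteq> P0 \<and> a \<noteq> P8"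
    using tri_check[unfolded list_all_iff, rule_format, OF in_pts in_pts in_pts, of x y z] assms
    by (simp add: Let_def h_def b_def a_def)
  moreover have "tri x y z = el z b a"
    by (simp add: tri_def h_def b_def a_def Let_def)
  moreover have "el z b a \<in> set group_list" if "b \<noteq> P8" "a \<noteq> P0" "a \<noteq> P8"
  proof -
    have "b \<in> set (butlast pts)"
      using that(1) by (cases b) (simp_all add: pts_def)
    moreover have "a \<in> set (butlast (tl pts))"
      using that(2,3) by (cases a) (simp_all add: pts_def)
    ultimately show ?thesis unfolding set_group_list by blast
  qed
  ultimately show "ap (tri x y z) P0 = x" "ap (tri x y z) P1 = y" "ap (tri x y z) P8 = z" "tri x y z \<in> set group_list"
    by auto
qed

lemma in_group_list: "in_group p \<Longrightarrow> p \<in> set group_list"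
  unfolding in_group_def Let_def using tri_distinct(4) by metis

lemma group_listD:
  assumes "p \<in> set group_list"
  shows "tri (ap p P0) (ap p P1) (ap p P8) = p"
    "pow 3 p = idp \<Longrightarrow> p = idp \<or> ap p P0 \<noteq> P0"
    "pow 7 p = idp \<Longrightarrow> p = idp \<or> length (fixpts p) = 2"
    "pow 8 p = idp \<Longrightarrow> p = idp \<or> length (fixpts p) = 1 \<and> pow 2 p = idp"
  using group_list_check[unfolded list_all_iff, rule_format, OF assms] by blast+

lemma card_group_list: "card (set group_list) = 504"
proof (rule antisym)
  show "card (set group_list) \<le> 504" using card_length[of group_list] length_group_list by simp
  define D where "D = filter (\<lambda>(x, y, z). x \<noteq> y \<and> x \<noteq> z \<and> y \<noteq> z) (List.product pts (List.product pts pts))"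
  have "distinct pts" by (simp add: pts_def)
  then have "distinct D" unfolding D_def by (intro distinct_filter distinct_product)
  then have "card (set D) = 504" using distinct_card count_triples by (metis D_def)
  moreover have "inj_on (\<lambda>(x, y, z). tri x y z) (set D)"
    by (rule inj_on_inverseI[where g = "\<lambda>p. (ap p P0, ap p P1, ap p P8)"]) (auto simp: D_def tri_distinct)
  moreover have "(\<lambda>(x, y, z). tri x y z) ` set D \<subseteq> set group_list"
    by (auto simp: D_def tri_distinct)
  ultimately show "504 \<le> card (set group_list)"
    by (metis card_inj_on_le List.finite_set)
qed

lemma distinct_group_list: "distinct group_list"
  by (rule card_distinct) (simp add: card_group_list length_group_list)

lemma card_filter_group_list: "card {p \<in> set group_list. Q p} = length (filter Q group_list)"
  using distinct_card[OF distinct_filter[OF distinct_group_list, of Q]] by simp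

lemma cyc_ap: "ap cyc P0 = P1" "ap cyc P1 = P8" "ap cyc P8 = P0" "ap cyc x \<noteq> x" "ap cyc (ap cyc (ap cyc x)) = x"
  "cyc \<in> set group_list"
proof -
  show "ap cyc x \<noteq> x" "ap cyc (ap cyc (ap cyc x)) = x" using cyc_check by (auto simp: list_all_iff)
  have "cyc = tri P1 P8 P0" using cyc_check by simp
  then show "ap cyc P0 = P1" "ap cyc P1 = P8" "ap cyc P8 = P0" "cyc \<in> set group_list"
    using tri_distinct[of P1 P8 P0] by auto
qed

lemma idp_in: "idp \<in> set group_list"
  using certificate_in_group(3) in_group_list by simp

text \<open>An abstract group with a faithful permutation representation whose image is the concrete
  list. The group theory below uses nothing else about G; matrices enter only when this locale is
  interpreted.\<close>

locale psl28 = group G for G (structure) +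
  fixes \<pi> :: "'a \<Rightarrow> perm"
  assumes \<pi>_bij: "bij_betw \<pi> (carrier G) (set group_list)"
    and \<pi>_mult: "x \<in> carrier G \<Longrightarrow> y \<in> carrier G \<Longrightarrow> \<pi> (x \<otimes> y) = cmp (\<pi> x) (\<pi> y)"
begin

lemma inv_cancel [simp]:
  assumes "g \<in> carrier G" "x \<in> carrier G"
  shows "g \<otimes> (inv g \<otimes> x) = x" "inv g \<otimes> (g \<otimes> x) = x"
  using assms by (simp_all add: m_assoc[symmetric])

lemma fin: "finite (carrier G)"
  using bij_betw_finite[OF \<pi>_bij] by simp

lemma order: "card (carrier G) = 504"
  using bij_betw_same_card[OF \<pi>_bij] card_group_list by simp

lemma \<pi>_in: "x \<in> carrier G \<Longrightarrow> \<pi> x \<in> set group_list"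
  using bij_betwE[OF \<pi>_bij] by blast

lemma \<pi>_eq: "x \<in> carrier G \<Longrightarrow> y \<in> carrier G \<Longrightarrow> \<pi> x = \<pi> y \<longleftrightarrow> x = y"
  using bij_betw_imp_inj_on[OF \<pi>_bij] by (auto simp: inj_on_def)

definition E :: "perm \<Rightarrow> 'a" where "E = inv_into (carrier G) \<pi>"

lemma E_in [simp]: "p \<in> set group_list \<Longrightarrow> E p \<in> carrier G"
  and \<pi>_E [simp]: "p \<in> set group_list \<Longrightarrow> \<pi> (E p) = p"
  unfolding E_def using bij_betw_imp_surj_on[OF \<pi>_bij] by (auto intro: inv_into_into f_inv_into_f)

lemma E_\<pi> [simp]: "x \<in> carrier G \<Longrightarrow> E (\<pi> x) = x"
  unfolding E_def using bij_betw_imp_inj_on[OF \<pi>_bij] by (rule inv_into_f_f)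

lemma \<pi>_one [simp]: "\<pi> \<one> = idp"
proof -
  have "\<pi> (E idp \<otimes> E idp) = \<pi> (E idp)" using \<pi>_mult idp_in by simp
  then have "E idp \<otimes> E idp = E idp" using \<pi>_eq E_in[OF idp_in] m_closed by metis
  then have "E idp = \<one>" using idp_in by simp
  then show ?thesis using \<pi>_E[OF idp_in] by simp
qed

lemma E_idp: "E idp = \<one>"
  using E_\<pi>[OF one_closed] by simp

text \<open>Closure of the list under composition is inherited from G through \<pi>, which replaces
  an inspection of all products of two entries.\<close>

lemma cmp_in: "p \<in> set group_list \<Longrightarrow> q \<in> set group_list \<Longrightarrow> cmp p q \<in> set group_list"
  using \<pi>_in[of "E p \<otimes> E q"] by (simp add: \<pi>_mult)

lemma E_cmp: "p \<in> set group_list \<Longrightarrow> q \<in> set group_list \<Longrightarrow> E (cmp p q) = E p \<otimes> E q"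
  using E_\<pi>[of "E p \<otimes> E q"] by (simp add: \<pi>_mult)

lemma ap_inv [simp]: "x \<in> carrier G \<Longrightarrow> ap (\<pi> (inv x)) (ap (\<pi> x) a) = a"
  "x \<in> carrier G \<Longrightarrow> ap (\<pi> x) (ap (\<pi> (inv x)) a) = a"
  using \<pi>_mult[of "inv x" x] \<pi>_mult[of x "inv x"] by (metis ap_cmp ap_idp \<pi>_one inv_closed l_inv r_inv)+

lemma ap_eq [simp]: "x \<in> carrier G \<Longrightarrow> ap (\<pi> x) a = ap (\<pi> x) b \<longleftrightarrow> a = b"
  by (metis ap_inv(1))

lemma ap_inv_eq: "x \<in> carrier G \<Longrightarrow> ap (\<pi> (inv x)) a = b \<longleftrightarrow> a = ap (\<pi> x) b"
  by (metis ap_inv)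

lemma \<pi>_pow: "x \<in> carrier G \<Longrightarrow> \<pi> (x [^] (n::nat)) = pow n (\<pi> x)"
proof (induction n)
  case (Suc n)
  have "x [^] Suc n = x \<otimes> x [^] n" using Suc.prems nat_pow_Suc2 by blast
  then show ?case using Suc \<pi>_mult by simp
qed simp

lemma triple_ex:
  assumes "a \<noteq> b" "a \<noteq> c" "b \<noteq> c"
  obtains g where "g \<in> carrier G" "ap (\<pi> g) P0 = a" "ap (\<pi> g) P1 = b" "ap (\<pi> g) P8 = c"
  using that[of "E (tri a b c)"] tri_distinct[OF assms] by simp

lemma standard_triple_eq:
  assumes "x \<in> carrier G" "y \<in> carrier G" "ap (\<pi> x) P0 = ap (\<pi> y) P0" "ap (\<pi> x) P1 = ap (\<pi> y) P1" "ap (\<pi> x) P8 = ap (\<pi> y) P8"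
  shows "x = y"
  using group_listD(1)[OF \<pi>_in[OF assms(1)]] group_listD(1)[OF \<pi>_in[OF assms(2)]] assms \<pi>_eq by metis

text \<open>Composition with an element that moves 0, 1, infinity to a, b, c reduces the claim to
  the standard triple.\<close>

lemma triple_eq:
  assumes x: "x \<in> carrier G" and y: "y \<in> carrier G" and d: "a \<noteq> b" "a \<noteq> c" "b \<noteq> c"
    and e: "ap (\<pi> x) a = ap (\<pi> y) a" "ap (\<pi> x) b = ap (\<pi> y) b" "ap (\<pi> x) c = ap (\<pi> y) c"
  shows "x = y"
proof -
  obtain g where g: "g \<in> carrier G" "ap (\<pi> g) P0 = a" "ap (\<pi> g) P1 = b" "ap (\<pi> g) P8 = c"
    using triple_ex[OF d] .
  have "x \<otimes> g = y \<otimes> g"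
    by (rule standard_triple_eq) (use x y g e in \<open>auto simp: \<pi>_mult\<close>)
  then show ?thesis using x y g by simp
qed

section \<open>Moving the given subgroups into standard position\<close>

lemma card_sub: "card {x \<in> carrier G. Q (\<pi> x)} = length (filter Q group_list)"
proof -
  have "bij_betw \<pi> {x \<in> carrier G. Q (\<pi> x)} {p \<in> set group_list. Q p}"
  proof (rule bij_betw_subset[OF \<pi>_bij])
    show "\<pi> ` {x \<in> carrier G. Q (\<pi> x)} = {p \<in> set group_list. Q p}"
    proof
      show "\<pi> ` {x \<in> carrier G. Q (\<pi> x)} \<subseteq> {p \<in> set group_list. Q p}" using \<pi>_in by auto
      show "{p \<in> set group_list. Q p} \<subseteq> \<pi> ` {x \<in> carrier G. Q (\<pi> x)}"
      proof
        fix p assume "p \<in> {p \<in> set group_list. Q p}"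
        then show "p \<in> \<pi> ` {x \<in> carrier G. Q (\<pi> x)}" by (intro image_eqI[of _ _ "E p"]) auto
      qed
    qed
  qed auto
  then show ?thesis using bij_betw_same_card card_filter_group_list by metis
qed

text \<open>Conjugation by y embeds K into the set of elements with property Q, and equal
  cardinality makes the image the whole set. No classification of subgroups is involved: one
  conjugate inside the right set is enough.\<close>

lemma conj_standard:
  assumes K: "subgroup K G" and y: "y \<in> carrier G" and sub: "\<And>k. k \<in> K \<Longrightarrow> Q (\<pi> (y \<otimes> k \<otimes> inv y))"
    and card: "length (filter Q group_list) = card K" and x: "x \<in> carrier G"
  shows "Q (\<pi> x) \<longleftrightarrow> inv y \<otimes> x \<otimes> y \<in> K"
proof -
  have KG: "k \<in> carrier G" if "k \<in> K" for k using subgroup.subset[OF K] that by blast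
  let ?c = "\<lambda>k. y \<otimes> k \<otimes> inv y"
  have bk: "inv y \<otimes> ?c k \<otimes> y = k" if "k \<in> carrier G" for k
    using that y by (simp add: m_assoc)
  have fw: "?c (inv y \<otimes> k \<otimes> y) = k" if "k \<in> carrier G" for k
    using that y by (simp add: m_assoc)
  have "inj_on ?c K" by (rule inj_on_inverseI[where g = "\<lambda>k. inv y \<otimes> k \<otimes> y"]) (use bk KG in auto)
  then have "card (?c ` K) = card {x \<in> carrier G. Q (\<pi> x)}"
    using card_image card card_sub by metis
  moreover have "?c ` K \<subseteq> {x \<in> carrier G. Q (\<pi> x)}" using sub KG y by auto
  ultimately have im: "?c ` K = {x \<in> carrier G. Q (\<pi> x)}"
    using fin by (intro card_subset_eq) auto
  show ?thesis
  proof
    assume "Q (\<pi> x)"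
    then have "x \<in> ?c ` K" using im x by blast
    then show "inv y \<otimes> x \<otimes> y \<in> K" using bk KG by auto
  next
    assume "inv y \<otimes> x \<otimes> y \<in> K"
    then show "Q (\<pi> x)" using sub fw[OF x] by metis
  qed
qed

text \<open>An element of order 3 has no fixed point, so it permutes \<open>0, t 0, t (t 0)\<close> cyclically.\<close>

lemma order3_conj:
  assumes t: "t \<in> carrier G" and ne: "t \<noteq> \<one>" and t3: "t \<otimes> t \<otimes> t = \<one>"
  obtains g where "g \<in> carrier G" "t \<otimes> g = g \<otimes> E cyc"
proof -
  let ?p = "\<pi> t"
  have ppp: "ap ?p (ap ?p (ap ?p a)) = a" for a
    using t3 t \<pi>_mult[of "t \<otimes> t" t] \<pi>_mult[of t t] by (metis ap_cmp ap_idp \<pi>_one m_closed)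
  have "pow 3 ?p = idp" by (rule perm_eqI) (simp add: numeral_3_eq_3 ppp)
  then have "ap ?p P0 \<noteq> P0" using group_listD(2)[OF \<pi>_in[OF t]] ne \<pi>_eq[OF t one_closed] by auto
  moreover have "P0 \<noteq> ap ?p (ap ?p P0)" using ppp[of P0] calculation by metis
  ultimately have d: "P0 \<noteq> ap ?p P0" "P0 \<noteq> ap ?p (ap ?p P0)" "ap ?p P0 \<noteq> ap ?p (ap ?p P0)"
    using t by auto
  obtain g where g: "g \<in> carrier G" "ap (\<pi> g) P0 = P0" "ap (\<pi> g) P1 = ap ?p P0" "ap (\<pi> g) P8 = ap ?p (ap ?p P0)"
    using triple_ex[OF d] .
  \<comment> \<open>Both sides have the same images of 0, 1, infinity, and these determine an
    element.\<close>
  have "t \<otimes> g = g \<otimes> E cyc"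
    by (rule standard_triple_eq) (use t g cyc_ap ppp in \<open>auto simp: \<pi>_mult\<close>)
  then show ?thesis using that g by blast
qed

text \<open>Conjugation by g turns t into \<open>cyc\<close>, so it carries relations between k and
  t to relations with \<open>cyc\<close>. As \<open>cyc\<close> has order 3, the second relation
  says that the conjugate of k inverts \<open>cyc\<close>.\<close>

lemma conj_cyc:
  assumes g: "g \<in> carrier G" and t: "t \<in> carrier G" and tg: "t \<otimes> g = g \<otimes> E cyc" and k: "k \<in> carrier G"
  shows "k \<otimes> t = t \<otimes> k \<Longrightarrow> cmp (\<pi> (inv g \<otimes> k \<otimes> g)) cyc = cmp cyc (\<pi> (inv g \<otimes> k \<otimes> g))"
    "k \<otimes> t = t \<otimes> t \<otimes> k \<Longrightarrow> cmp (\<pi> (inv g \<otimes> k \<otimes> g)) cyc = cmp (cmp cyc cyc) (\<pi> (inv g \<otimes> k \<otimes> g))"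
proof -
  let ?c = "E cyc"
  have c: "?c \<in> carrier G" "\<pi> ?c = cyc" using cyc_ap by auto
  have gt: "inv g \<otimes> t = ?c \<otimes> inv g"
  proof -
    have "inv g \<otimes> t = inv g \<otimes> (t \<otimes> g) \<otimes> inv g" using g t by (simp add: m_assoc)
    also have "\<dots> = ?c \<otimes> inv g" unfolding tg using g c by (simp add: m_assoc[symmetric])
    finally show ?thesis .
  qed
  have 1: "inv g \<otimes> k \<otimes> g \<otimes> ?c = inv g \<otimes> (k \<otimes> t) \<otimes> g" using g t k c tg by (simp add: m_assoc)
  have 2: "inv g \<otimes> (t \<otimes> x) \<otimes> g = ?c \<otimes> (inv g \<otimes> x \<otimes> g)" if "x \<in> carrier G" for x
  proof -
    have "inv g \<otimes> (t \<otimes> x) \<otimes> g = (inv g \<otimes> t) \<otimes> x \<otimes> g" using g t that by (simp add: m_assoc)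
    then show ?thesis unfolding gt using g c that by (simp add: m_assoc)
  qed
  show "cmp (\<pi> (inv g \<otimes> k \<otimes> g)) cyc = cmp cyc (\<pi> (inv g \<otimes> k \<otimes> g))" if "k \<otimes> t = t \<otimes> k"
  proof -
    have "inv g \<otimes> k \<otimes> g \<otimes> ?c = ?c \<otimes> (inv g \<otimes> k \<otimes> g)" using 1 2[OF k] that by simp
    from arg_cong[OF this, of \<pi>] show ?thesis using g k c by (simp add: \<pi>_mult)
  qed
  show "cmp (\<pi> (inv g \<otimes> k \<otimes> g)) cyc = cmp (cmp cyc cyc) (\<pi> (inv g \<otimes> k \<otimes> g))" if "k \<otimes> t = t \<otimes> t \<otimes> k"
  proof -
    have "inv g \<otimes> k \<otimes> g \<otimes> ?c = inv g \<otimes> (t \<otimes> (t \<otimes> k)) \<otimes> g" using 1 that t k by (simp add: m_assoc)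
    also have "\<dots> = ?c \<otimes> (?c \<otimes> (inv g \<otimes> k \<otimes> g))" using 2 t k by simp
    finally have "\<pi> (inv g \<otimes> k \<otimes> g \<otimes> ?c) = \<pi> (?c \<otimes> (?c \<otimes> (inv g \<otimes> k \<otimes> g)))" by simp
    then show ?thesis using g k c by (simp add: \<pi>_mult cmp_assoc)
  qed
qed

text \<open>K consists of 1, t and t^2 for an element t of order 3, and t is conjugate to
  \<open>cyc\<close>.\<close>

lemma C3_standard:
  assumes K: "subgroup K G" and iso: "G\<lparr>carrier := K\<rparr> \<cong> integer_mod_group 3"
  obtains y where "y \<in> carrier G" "card K = 3"
    "\<And>x. x \<in> carrier G \<Longrightarrow> \<pi> x \<in> {idp, cyc, cmp cyc cyc} \<longleftrightarrow> inv y \<otimes> x \<otimes> y \<in> K"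
proof -
  obtain \<phi> where \<phi>: "\<phi> \<in> iso (G\<lparr>carrier := K\<rparr>) (integer_mod_group 3)" using iso by (auto simp: is_iso_def)
  then have bij: "bij_betw \<phi> K {0..<3}" and hom: "\<And>x y. x \<in> K \<Longrightarrow> y \<in> K \<Longrightarrow> \<phi> (x \<otimes> y) = (\<phi> x + \<phi> y) mod 3"
    by (auto simp: iso_def hom_def carrier_integer_mod_group)
  have KG: "k \<in> carrier G" if "k \<in> K" for k using subgroup.subset[OF K] that by blast
  note cl = subgroup.m_closed[OF K] subgroup.one_closed[OF K]
  have inj: "x = y" if "x \<in> K" "y \<in> K" "\<phi> x = \<phi> y" for x y
    using bij_betw_imp_inj_on[OF bij] that by (auto simp: inj_on_def)
  have card: "card K = 3" using bij_betw_same_card[OF bij] by simp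
  have "\<phi> \<one> \<in> {0..<3}" using bij_betwE[OF bij] cl by blast
  moreover have "\<phi> \<one> = (\<phi> \<one> + \<phi> \<one>) mod 3" using hom[of \<one> \<one>] cl by simp
  ultimately have one: "\<phi> \<one> = 0" unfolding atLeastLessThan_iff by presburger
  have "1 \<in> \<phi> ` K" using bij_betw_imp_surj_on[OF bij] by auto
  then obtain t where t: "t \<in> K" "\<phi> t = 1" by auto
  have tt: "\<phi> (t \<otimes> t) = 2" using hom[OF t(1) t(1)] t(2) by simp
  have "\<phi> (t \<otimes> t \<otimes> t) = 0" using hom[of "t \<otimes> t" t] t tt cl by simp
  then have t3: "t \<otimes> t \<otimes> t = \<one>" using inj[of "t \<otimes> t \<otimes> t" \<one>] one t cl by simp
  have tne: "t \<noteq> \<one>" using one t by auto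
  obtain g where g: "g \<in> carrier G" "t \<otimes> g = g \<otimes> E cyc" using order3_conj[OF KG[OF t(1)] tne t3] .
  have "K \<subseteq> {\<one>, t, t \<otimes> t}"
  proof
    fix k assume k: "k \<in> K"
    then have "\<phi> k \<in> {0..<3}" using bij_betwE[OF bij] by blast
    then have "\<phi> k = \<phi> \<one> \<or> \<phi> k = \<phi> t \<or> \<phi> k = \<phi> (t \<otimes> t)" using one t tt by auto
    then show "k \<in> {\<one>, t, t \<otimes> t}" using inj[OF k] cl t by blast
  qed
  moreover have ct: "\<pi> (inv g \<otimes> t \<otimes> g) = cyc"
  proof -
    have "inv g \<otimes> t \<otimes> g = E cyc" using g KG[OF t(1)] cyc_ap by (simp add: m_assoc)
    then show ?thesis using cyc_ap by simp
  qed
  moreover have "\<pi> (inv g \<otimes> (t \<otimes> t) \<otimes> g) = cmp cyc cyc"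
  proof -
    have "inv g \<otimes> (t \<otimes> t) \<otimes> g = (inv g \<otimes> t \<otimes> g) \<otimes> (inv g \<otimes> t \<otimes> g)"
      using g(1) KG[OF t(1)] by (simp add: m_assoc)
    then show ?thesis using ct g KG[OF t(1)] by (simp add: \<pi>_mult)
  qed
  ultimately have sub: "\<pi> (inv g \<otimes> k \<otimes> inv (inv g)) \<in> {idp, cyc, cmp cyc cyc}" if "k \<in> K" for k
    using that g by auto
  have "length (filter (\<lambda>p. p \<in> {idp, cyc, cmp cyc cyc}) group_list) = card {p \<in> set group_list. p \<in> {idp, cyc, cmp cyc cyc}}"
    by (rule card_filter_group_list[symmetric])
  also have "{p \<in> set group_list. p \<in> {idp, cyc, cmp cyc cyc}} = {idp, cyc, cmp cyc cyc}"
    using idp_in cyc_ap(6) cmp_in[OF cyc_ap(6) cyc_ap(6)] by auto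
  also have "card \<dots> = 3"
    by (simp add: idp_def cyc_def cmp_def)
  finally have "length (filter (\<lambda>p. p \<in> {idp, cyc, cmp cyc cyc}) group_list) = card K" using card by simp
  from conj_standard[where Q = "\<lambda>p. p \<in> {idp, cyc, cmp cyc cyc}", OF K inv_closed[OF g(1)] sub this]
  show ?thesis using that[of "inv g"] g card by simp
qed

text \<open>The element of order 3 in K is conjugate to \<open>cyc\<close>, and K is abelian; so a
  conjugate of K lies in the centralizer of \<open>cyc\<close>, which also has nine
  elements.\<close>

lemma C9_standard:
  assumes K: "subgroup K G" and iso: "G\<lparr>carrier := K\<rparr> \<cong> integer_mod_group 9"
  obtains y where "y \<in> carrier G" "card K = 9"
    "\<And>x. x \<in> carrier G \<Longrightarrow> cmp (\<pi> x) cyc = cmp cyc (\<pi> x) \<longleftrightarrow> inv y \<otimes> x \<otimes> y \<in> K"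
proof -
  obtain \<phi> where \<phi>: "\<phi> \<in> iso (G\<lparr>carrier := K\<rparr>) (integer_mod_group 9)" using iso by (auto simp: is_iso_def)
  then have bij: "bij_betw \<phi> K {0..<9}" and hom: "\<And>x y. x \<in> K \<Longrightarrow> y \<in> K \<Longrightarrow> \<phi> (x \<otimes> y) = (\<phi> x + \<phi> y) mod 9"
    by (auto simp: iso_def hom_def carrier_integer_mod_group)
  have KG: "k \<in> carrier G" if "k \<in> K" for k using subgroup.subset[OF K] that by blast
  note cl = subgroup.m_closed[OF K] subgroup.one_closed[OF K]
  have inj: "x = y" if "x \<in> K" "y \<in> K" "\<phi> x = \<phi> y" for x y
    using bij_betw_imp_inj_on[OF bij] that by (auto simp: inj_on_def)
  have card: "card K = 9" using bij_betw_same_card[OF bij] by simp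
  have "\<phi> \<one> \<in> {0..<9}" using bij_betwE[OF bij] cl by blast
  moreover have "\<phi> \<one> = (\<phi> \<one> + \<phi> \<one>) mod 9" using hom[of \<one> \<one>] cl by simp
  ultimately have one: "\<phi> \<one> = 0" unfolding atLeastLessThan_iff by presburger
  have "3 \<in> \<phi> ` K" using bij_betw_imp_surj_on[OF bij] by auto
  then obtain t where t: "t \<in> K" "\<phi> t = 3" by auto
  have "\<phi> (t \<otimes> t \<otimes> t) = 0" using hom[of "t \<otimes> t" t] hom[OF t(1) t(1)] t cl by simp
  then have t3: "t \<otimes> t \<otimes> t = \<one>" using inj[of "t \<otimes> t \<otimes> t" \<one>] one t cl by simp
  have tne: "t \<noteq> \<one>" using one t by auto
  obtain g where g: "g \<in> carrier G" "t \<otimes> g = g \<otimes> E cyc" using order3_conj[OF KG[OF t(1)] tne t3] .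
  have sub: "cmp (\<pi> (inv g \<otimes> k \<otimes> inv (inv g))) cyc = cmp cyc (\<pi> (inv g \<otimes> k \<otimes> inv (inv g)))" if k: "k \<in> K" for k
  proof -
    have "k \<otimes> t = t \<otimes> k" by (rule inj) (use hom k t cl in \<open>auto simp: add.commute\<close>)
    then show ?thesis using conj_cyc(1)[OF g(1) KG[OF t(1)] g(2) KG[OF k]] g by simp
  qed
  from conj_standard[where Q = "\<lambda>p. cmp p cyc = cmp cyc p", OF K inv_closed[OF g(1)] sub] centralizer_check card
  show ?thesis using that[of "inv g"] g by simp
qed

text \<open>The image (a, s) of the identity is idempotent. A reflection is not, and for a rotation
  a = 2 a modulo n leaves only a = 0.\<close>

lemma dihedral_group_iso:
  assumes K: "subgroup K G" and iso: "G\<lparr>carrier := K\<rparr> \<cong> dihedral_group n" and n: "n > 0"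
  obtains \<phi> where "bij_betw \<phi> K ({0..<int n} \<times> UNIV)" "\<phi> \<one> = (0, False)"
    "\<And>x y a s b t. x \<in> K \<Longrightarrow> y \<in> K \<Longrightarrow> \<phi> x = (a, s) \<Longrightarrow> \<phi> y = (b, t) \<Longrightarrow>
       \<phi> (x \<otimes> y) = ((a + (if s then - b else b)) mod int n, s \<noteq> t)"
proof -
  obtain \<phi> where \<phi>: "\<phi> \<in> iso (G\<lparr>carrier := K\<rparr>) (dihedral_group n)" using iso by (auto simp: is_iso_def)
  then have bij: "bij_betw \<phi> K ({0..<int n} \<times> UNIV)"
    and hom: "\<And>x y. x \<in> K \<Longrightarrow> y \<in> K \<Longrightarrow> \<phi> (x \<otimes> y) = \<phi> x \<otimes>\<^bsub>dihedral_group n\<^esub> \<phi> y"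
    by (auto simp: iso_def hom_def dihedral_group_def)
  have mult: "\<phi> (x \<otimes> y) = ((a + (if s then - b else b)) mod int n, s \<noteq> t)"
    if "x \<in> K" "y \<in> K" "\<phi> x = (a, s)" "\<phi> y = (b, t)" for x y a s b t
    using hom[OF that(1,2)] that by (simp add: dihedral_group_def)
  have o: "\<one> \<in> K" by (rule subgroup.one_closed[OF K])
  obtain a s where as: "\<phi> \<one> = (a, s)" by (cases "\<phi> \<one>")
  then have "a \<in> {0..<int n}" using bij_betwE[OF bij] o by fastforce
  moreover have "\<not> s" using mult[OF o o as as] as by auto
  moreover have "a = 0"
  proof -
    have eq: "a = (a + a) mod int n" using mult[OF o o as as] as \<open>\<not> s\<close> by auto
    show ?thesis
    proof (cases "a + a < int n")
      case True
      then show ?thesis using eq \<open>a \<in> {0..<int n}\<close> by simp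
    next
      case False
      have "(a + a) mod int n = (a + a - int n) mod int n" by simp
      also have "\<dots> = a + a - int n" by (rule mod_pos_pos_trivial) (use False \<open>a \<in> {0..<int n}\<close> in auto)
      finally show ?thesis using eq \<open>a \<in> {0..<int n}\<close> by simp
    qed
  qed
  ultimately have "\<phi> \<one> = (0, False)" using as by simp
  then show ?thesis using that bij mult by blast
qed

text \<open>The rotation t by 3 has order 3; rotations commute with it and reflections invert it. So
  a conjugate of K lies in the normalizer of the group generated by \<open>cyc\<close>, which has 18
  elements.\<close>

lemma D9_standard:
  assumes K: "subgroup K G" and iso: "G\<lparr>carrier := K\<rparr> \<cong> dihedral_group 9"
  obtains y where "y \<in> carrier G" "card K = 18"
    "\<And>x. x \<in> carrier G \<Longrightarrow> (cmp (\<pi> x) cyc = cmp cyc (\<pi> x) \<or> cmp (\<pi> x) cyc = cmp (cmp cyc cyc) (\<pi> x))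
       \<longleftrightarrow> inv y \<otimes> x \<otimes> y \<in> K"
proof -
  obtain \<phi> where bij': "bij_betw \<phi> K ({0..<int 9} \<times> UNIV)" and one: "\<phi> \<one> = (0, False)"
    and mult': "\<And>x y a s b t. x \<in> K \<Longrightarrow> y \<in> K \<Longrightarrow> \<phi> x = (a, s) \<Longrightarrow> \<phi> y = (b, t) \<Longrightarrow>
       \<phi> (x \<otimes> y) = ((a + (if s then - b else b)) mod int 9, s \<noteq> t)"
    by (rule dihedral_group_iso[OF K iso zero_less_numeral], rule that)
  note bij = bij'[unfolded of_nat_numeral] and mult = mult'[unfolded of_nat_numeral]
  have KG: "k \<in> carrier G" if "k \<in> K" for k using subgroup.subset[OF K] that by blast
  note cl = subgroup.m_closed[OF K] subgroup.one_closed[OF K]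
  have inj: "x = y" if "x \<in> K" "y \<in> K" "\<phi> x = \<phi> y" for x y
    using bij_betw_imp_inj_on[OF bij] that by (auto simp: inj_on_def)
  have card: "card K = 18" using bij_betw_same_card[OF bij] by (simp add: card_cartesian_product)
  have "(3, False) \<in> \<phi> ` K" using bij_betw_imp_surj_on[OF bij] by auto
  then obtain t where t: "t \<in> K" "\<phi> t = (3, False)" by auto
  have tt: "\<phi> (t \<otimes> t) = (6, False)" using mult[OF t(1) t(1) t(2) t(2)] by simp
  have "\<phi> (t \<otimes> t \<otimes> t) = (0, False)" using mult[OF _ t(1) tt t(2)] t cl by simp
  then have t3: "t \<otimes> t \<otimes> t = \<one>" using inj[of "t \<otimes> t \<otimes> t" \<one>] one t cl by simp
  have tne: "t \<noteq> \<one>" using one t by auto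
  obtain g where g: "g \<in> carrier G" "t \<otimes> g = g \<otimes> E cyc" using order3_conj[OF KG[OF t(1)] tne t3] .
  let ?Q = "\<lambda>p. cmp p cyc = cmp cyc p \<or> cmp p cyc = cmp (cmp cyc cyc) p"
  have sub: "?Q (\<pi> (inv g \<otimes> k \<otimes> inv (inv g)))" if k: "k \<in> K" for k
  proof -
    obtain a s where as: "\<phi> k = (a, s)" by (cases "\<phi> k")
    have "k \<otimes> t = t \<otimes> k \<or> k \<otimes> t = t \<otimes> t \<otimes> k"
    proof (cases s)
      case False
      have "\<phi> (k \<otimes> t) = \<phi> (t \<otimes> k)"
        using mult[OF k t(1) as t(2)] mult[OF t(1) k t(2) as] False by (simp add: add.commute)
      then show ?thesis using inj k t cl by blast
    next
      case True
      have "(a - 3) mod 9 = (6 + a) mod 9"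
        using mod_add_self2[of "a - 3" 9] by (simp add: add.commute)
      then have "\<phi> (k \<otimes> t) = \<phi> (t \<otimes> t \<otimes> k)"
        using mult[OF k t(1) as t(2)] mult[OF _ k tt as] t cl True by simp
      then show ?thesis using inj k t cl by blast
    qed
    then show ?thesis using conj_cyc[OF g(1) KG[OF t(1)] g(2) KG[OF k]] g by auto
  qed
  from conj_standard[where Q = ?Q, OF K inv_closed[OF g(1)] sub] normalizer_check card
  show ?thesis using that[of "inv g"] g by simp
qed

lemma fixpts_iff: "x \<in> set (fixpts p) \<longleftrightarrow> ap p x = x"
  by (simp add: fixpts_def)

lemma distinct_fixpts: "distinct (fixpts p)"
  by (simp add: fixpts_def pts_def)

text \<open>A rotation t of order 7 has exactly two fixed points. Every k in K permutes them,
  because t k is k times a power of t. Moving the two points to 0 and 1 puts K into the stabilizer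
  of an unordered pair, which has 14 elements.\<close>

lemma D7_standard:
  assumes K: "subgroup K G" and iso: "G\<lparr>carrier := K\<rparr> \<cong> dihedral_group 7"
  obtains y where "y \<in> carrier G" "card K = 14"
    "\<And>x. x \<in> carrier G \<Longrightarrow> (ap (\<pi> x) P0 = P0 \<and> ap (\<pi> x) P1 = P1 \<or> ap (\<pi> x) P0 = P1 \<and> ap (\<pi> x) P1 = P0)
       \<longleftrightarrow> inv y \<otimes> x \<otimes> y \<in> K"
proof -
  obtain \<phi> where bij': "bij_betw \<phi> K ({0..<int 7} \<times> UNIV)" and one: "\<phi> \<one> = (0, False)"
    and mult': "\<And>x y a s b t. x \<in> K \<Longrightarrow> y \<in> K \<Longrightarrow> \<phi> x = (a, s) \<Longrightarrow> \<phi> y = (b, t) \<Longrightarrow>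
       \<phi> (x \<otimes> y) = ((a + (if s then - b else b)) mod int 7, s \<noteq> t)"
    by (rule dihedral_group_iso[OF K iso zero_less_numeral], rule that)
  note bij = bij'[unfolded of_nat_numeral] and mult = mult'[unfolded of_nat_numeral]
  have KG: "k \<in> carrier G" if "k \<in> K" for k using subgroup.subset[OF K] that by blast
  note cl = subgroup.m_closed[OF K] subgroup.one_closed[OF K]
  have inj: "x = y" if "x \<in> K" "y \<in> K" "\<phi> x = \<phi> y" for x y
    using bij_betw_imp_inj_on[OF bij] that by (auto simp: inj_on_def)
  have card: "card K = 14" using bij_betw_same_card[OF bij] by (simp add: card_cartesian_product)
  have "(1, False) \<in> \<phi> ` K" using bij_betw_imp_surj_on[OF bij] by auto
  then obtain t where t: "t \<in> K" "\<phi> t = (1, False)" by auto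
  note tc = KG[OF t(1)]
  have tpow: "t [^] n \<in> K \<and> \<phi> (t [^] n) = (int n mod 7, False)" for n :: nat
  proof (induction n)
    case (Suc n)
    then show ?case using mult[of "t [^] n" t "int n mod 7" False 1 False] t cl
      by (simp add: mod_add_right_eq add.commute)
  qed (use cl one in simp)
  have "t [^] (7::nat) = \<one>" using inj[of "t [^] (7::nat)" \<one>] tpow[of 7] one cl by simp
  then have "pow 7 (\<pi> t) = idp" using \<pi>_pow[OF tc, of 7] by simp
  moreover have "\<pi> t \<noteq> idp" using \<pi>_eq[OF tc one_closed] one t by auto
  ultimately have "length (fixpts (\<pi> t)) = 2" using group_listD(3)[OF \<pi>_in[OF tc]] by blast
  then obtain a b where ab: "fixpts (\<pi> t) = [a, b]" by (auto simp: length_Suc_conv numeral_2_eq_2)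
  then have abne: "a \<noteq> b" using distinct_fixpts[of "\<pi> t"] by simp
  have fix_iff: "ap (\<pi> t) x = x \<longleftrightarrow> x = a \<or> x = b" for x
    using fixpts_iff[of x "\<pi> t"] ab by auto
  have fix_pow: "ap (pow n (\<pi> t)) x = x" if "ap (\<pi> t) x = x" for n x
    by (induction n) (simp_all add: that)
  have stable: "ap (\<pi> k) x = a \<or> ap (\<pi> k) x = b" if k: "k \<in> K" and x: "x = a \<or> x = b" for k x
  proof -
    obtain c s where cs: "\<phi> k = (c, s)" by (cases "\<phi> k")
    have "\<exists>n::nat. t \<otimes> k = k \<otimes> t [^] n"
    proof (cases s)
      case False
      have "\<phi> (t \<otimes> k) = \<phi> (k \<otimes> t [^] (1::nat))"
        using mult[OF t(1) k t(2) cs] mult[OF k t(1) cs t(2)] False tc by (simp add: add.commute)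
      then show ?thesis using inj k t cl tpow by blast
    next
      case True
      \<comment> \<open>A reflection inverts t, and the exponent 6 stands for -1 modulo 7.\<close>
      have "(c - 6) mod 7 = (1 + c) mod 7"
        using mod_add_self2[of "c - 6" 7] by (simp add: add.commute)
      then have "\<phi> (t \<otimes> k) = \<phi> (k \<otimes> t [^] (6::nat))"
        using mult[OF t(1) k t(2) cs] mult[OF k conjunct1[OF tpow[of 6]] cs conjunct2[OF tpow[of 6]]] True by simp
      then show ?thesis using inj k t cl tpow by blast
    qed
    then obtain n :: nat where n: "t \<otimes> k = k \<otimes> t [^] n" by blast
    have "ap (\<pi> t) (ap (\<pi> k) x) = ap (\<pi> (t \<otimes> k)) x" using tc KG[OF k] by (simp add: \<pi>_mult)
    also have "\<dots> = ap (\<pi> k) (ap (pow n (\<pi> t)) x)" unfolding n using tc KG[OF k] by (simp add: \<pi>_mult \<pi>_pow)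
    also have "\<dots> = ap (\<pi> k) x" using fix_pow fix_iff x by simp
    finally show ?thesis using fix_iff by simp
  qed
  \<comment> \<open>A third point is chosen so that 3-transitivity can move the pair (0, 1) to (a,
    b).\<close>
  obtain c where c: "a \<noteq> c" "b \<noteq> c"
  proof -
    have "\<exists>c\<in>{P0, P1, P2}. a \<noteq> c \<and> b \<noteq> c" by (cases "a = P0"; cases "b = P0"; cases "a = P1"; cases "b = P1") auto
    then show ?thesis using that by blast
  qed
  obtain g where g: "g \<in> carrier G" "ap (\<pi> g) P0 = a" "ap (\<pi> g) P1 = b"
    using triple_ex[OF abne c] by metis
  let ?Q = "\<lambda>p. ap p P0 = P0 \<and> ap p P1 = P1 \<or> ap p P0 = P1 \<and> ap p P1 = P0"
  have sub: "?Q (\<pi> (inv g \<otimes> k \<otimes> inv (inv g)))" if k: "k \<in> K" for k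
  proof -
    have "ap (\<pi> k) a \<noteq> ap (\<pi> k) b" using KG[OF k] abne by simp
    then have "ap (\<pi> k) a = a \<and> ap (\<pi> k) b = b \<or> ap (\<pi> k) a = b \<and> ap (\<pi> k) b = a"
      using stable[OF k, of a] stable[OF k, of b] by metis
    then show ?thesis using g KG[OF k] by (auto simp: \<pi>_mult ap_inv_eq)
  qed
  from conj_standard[where Q = ?Q, OF K inv_closed[OF g(1)] sub] pair_check card
  show ?thesis using that[of "inv g"] g by simp
qed

end

section \<open>Identification with fractional linear maps\<close>

text \<open>A copy of the field as a type of its own, so that type class algebra applies;
  \<open>nat_of\<close> carries it to the encoded ring \<open>GF8\<close>. Its operations are read
  off the tables \<open>tau\<close>, \<open>mu\<close> and \<open>winv\<close>, which links the
  field to the permutations.\<close>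

datatype gf8 = F0 | F1 | F2 | F3 | F4 | F5 | F6 | F7

fun pt_of :: "gf8 \<Rightarrow> pt" where
  "pt_of F0 = P0"
| "pt_of F1 = P1"
| "pt_of F2 = P2"
| "pt_of F3 = P3"
| "pt_of F4 = P4"
| "pt_of F5 = P5"
| "pt_of F6 = P6"
| "pt_of F7 = P7"

fun gf_of :: "pt \<Rightarrow> gf8" where
  "gf_of P0 = F0"
| "gf_of P1 = F1"
| "gf_of P2 = F2"
| "gf_of P3 = F3"
| "gf_of P4 = F4"
| "gf_of P5 = F5"
| "gf_of P6 = F6"
| "gf_of P7 = F7"
| "gf_of P8 = F0"

fun nat_of :: "gf8 \<Rightarrow> nat" where
  "nat_of F0 = 0"
| "nat_of F1 = 1"
| "nat_of F2 = 2"
| "nat_of F3 = 3"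
| "nat_of F4 = 4"
| "nat_of F5 = 5"
| "nat_of F6 = 6"
| "nat_of F7 = 7"

definition gplus :: "gf8 \<Rightarrow> gf8 \<Rightarrow> gf8" where
  "gplus x y = gf_of (ap (tau (pt_of x)) (pt_of y))"

text \<open>The case of zero is separate because \<open>mu P0\<close> is the identity and not the
  zero map.\<close>

definition gtimes :: "gf8 \<Rightarrow> gf8 \<Rightarrow> gf8" where
  "gtimes x y = (if x = F0 then F0 else gf_of (ap (mu (pt_of x)) (pt_of y)))"

text \<open>Inversion sends 0 to infinity, and \<open>gf_of P8 = F0\<close> turns this into the
  convention that the inverse of 0 is 0.\<close>

definition ginv :: "gf8 \<Rightarrow> gf8" where
  "ginv x = gf_of (ap winv (pt_of x))"

definition gfs :: "gf8 list" where
  "gfs = [F0, F1, F2, F3, F4, F5, F6, F7]"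

lemma in_gfs [simp]: "x \<in> set gfs"
  by (cases x) (auto simp: gfs_def)

lemma gf8_check2:
  "list_all (\<lambda>x. gplus F0 x = x \<and> gplus x x = F0 \<and> gtimes F1 x = x \<and> (x \<noteq> F0 \<longrightarrow> gtimes (ginv x) x = F1) \<and>
    (gtimes x x = F1 \<longrightarrow> x = F1)) gfs"
  "list_all (\<lambda>x. list_all (\<lambda>y. gplus x y = gplus y x \<and> gtimes x y = gtimes y x) gfs) gfs"
  by code_simp+

lemma gf8_check3:
  "list_all (\<lambda>x. list_all (\<lambda>y. list_all (\<lambda>z. gplus (gplus x y) z = gplus x (gplus y z) \<and>
     gtimes (gtimes x y) z = gtimes x (gtimes y z) \<and>
     gtimes (gplus x y) z = gplus (gtimes x z) (gtimes y z)) gfs) gfs) gfs"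
  by code_simp

lemmas gf8_law = gf8_check2(1)[unfolded list_all_iff, THEN bspec, OF in_gfs]
  and gf8_comm = gf8_check2(2)[unfolded list_all_iff, THEN bspec, OF in_gfs, THEN bspec, OF in_gfs]
  and gf8_assoc = gf8_check3[unfolded list_all_iff, THEN bspec, OF in_gfs, THEN bspec, OF in_gfs, THEN bspec, OF in_gfs]

instantiation gf8 :: field
begin

definition "zero_gf8 = F0"
definition "one_gf8 = F1"
definition "plus_gf8 = gplus"
definition "minus_gf8 = gplus"
definition "uminus_gf8 = (\<lambda>x :: gf8. x)"
definition "times_gf8 = gtimes"
definition "inverse_gf8 = ginv"
definition "divide_gf8 = (\<lambda>x y. gtimes x (ginv y))"

instance
proof
  note defs = zero_gf8_def one_gf8_def plus_gf8_def minus_gf8_def uminus_gf8_def times_gf8_def inverse_gf8_def divide_gf8_def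
  fix a b c :: gf8
  show "a + b + c = a + (b + c)" "a * b * c = a * (b * c)" "(a + b) * c = a * c + b * c"
    unfolding defs using gf8_assoc by blast+
  show "a + b = b + a" "a * b = b * a"
    unfolding defs using gf8_comm by blast+
  show "0 + a = a" "1 * a = a" "- a + a = 0" "a \<noteq> 0 \<Longrightarrow> inverse a * a = 1"
    unfolding defs using gf8_law by blast+
  show "a - b = a + - b" "a div b = a * inverse b" "(0 :: gf8) \<noteq> 1"
    unfolding defs by simp_all
  show "inverse (0 :: gf8) = 0" unfolding defs by code_simp
qed

end

lemma gf8_square_eq_one: "(a :: gf8) * a = 1 \<Longrightarrow> a = 1"
  unfolding times_gf8_def one_gf8_def using gf8_law by blast

lemma gf8_add_self: "(a :: gf8) + a = 0"
  unfolding plus_gf8_def zero_gf8_def using gf8_law by blast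

lemma gf8_minus: "(a :: gf8) - b = a + b"
  by (simp add: minus_gf8_def plus_gf8_def)

lemma nat_of_plus: "nat_of (x + y) = xor (nat_of x) (nat_of y)"
  by (cases x; cases y; simp add: plus_gf8_def gplus_def)

lemma nat_of_times: "nat_of (x * y) = gf8_reduce (gf8_clmul (nat_of x) (nat_of y))"
  by (cases x; cases y; simp add: times_gf8_def gtimes_def gf8_reduce_def gf8_clmul_def bit_iff_odd push_bit_eq_mult)

lemma nat_of_inj: "nat_of x = nat_of y \<longleftrightarrow> x = y"
  by (cases x; cases y) simp_all

lemma nat_of_range: "range nat_of = {0..<8}"
proof
  show "range nat_of \<subseteq> {0..<8}"
  proof
    fix n assume "n \<in> range nat_of"
    then obtain x where "n = nat_of x" by blast
    then show "n \<in> {0..<8}" by (cases x) simp_all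
  qed
  show "{0..<8} \<subseteq> range nat_of"
  proof
    fix n :: nat assume "n \<in> {0..<8}"
    then have "n = 0 \<or> n = 1 \<or> n = 2 \<or> n = 3 \<or> n = 4 \<or> n = 5 \<or> n = 6 \<or> n = 7" by auto
    moreover have "0 = nat_of F0" "1 = nat_of F1" "2 = nat_of F2" "3 = nat_of F3" "4 = nat_of F4"
      "5 = nat_of F5" "6 = nat_of F6" "7 = nat_of F7" by simp_all
    ultimately show "n \<in> range nat_of" by (metis rangeI)
  qed
qed

lemma GF8_carrier: "x \<in> carrier GF8 \<longleftrightarrow> (\<exists>a. x = nat_of a)"
proof -
  have "carrier GF8 = range nat_of" by (simp add: GF8_def nat_of_range)
  then show ?thesis by auto
qed

lemma nat_of_0: "nat_of 0 = 0" and nat_of_1: "nat_of 1 = 1"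
  by (simp_all add: zero_gf8_def one_gf8_def)

section \<open>Matrices of determinant one and the trivial center\<close>

type_synonym mat2 = "gf8 \<times> gf8 \<times> gf8 \<times> gf8"

definition sl2 :: "mat2 set" where
  "sl2 = {(a, b, c, d). a * d - b * c = 1}"

fun mat2_mult :: "mat2 \<Rightarrow> mat2 \<Rightarrow> mat2" where
  "mat2_mult (a, b, c, d) (a', b', c', d') = (a * a' + b * c', a * b' + b * d', c * a' + d * c', c * b' + d * d')"

fun mat2_inv :: "mat2 \<Rightarrow> mat2" where
  "mat2_inv (a, b, c, d) = (d, - b, - c, a)"

fun nat_mat2 :: "mat2 \<Rightarrow> nat \<times> nat \<times> nat \<times> nat" where
  "nat_mat2 (a, b, c, d) = (nat_of a, nat_of b, nat_of c, nat_of d)"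

lemma nat_mat2_inj: "nat_mat2 m = nat_mat2 n \<longleftrightarrow> m = n"
  by (cases m; cases n) (simp add: nat_of_inj)

text \<open>In characteristic 2 every element is its own negative. The negative in
  \<open>GF8\<close> is a definite description, so uniqueness is shown as well, by cancellation in
  \<open>gf8\<close>.\<close>

lemma GF8_minus: "x \<ominus>\<^bsub>GF8\<^esub> nat_of y = xor x (nat_of y)"
proof -
  have self: "xor (nat_of y) (nat_of y) = 0"
    using nat_of_plus[of y y] by (simp add: gf8_add_self nat_of_0)
  have "\<ominus>\<^bsub>GF8\<^esub> nat_of y = nat_of y"
    unfolding a_inv_def m_inv_def
  proof (rule the_equality)
    show "nat_of y \<in> carrier (add_monoid GF8) \<and> nat_of y \<otimes>\<^bsub>add_monoid GF8\<^esub> nat_of y = \<one>\<^bsub>add_monoid GF8\<^esub> \<and>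
      nat_of y \<otimes>\<^bsub>add_monoid GF8\<^esub> nat_of y = \<one>\<^bsub>add_monoid GF8\<^esub>"
      using self nat_of_range by (auto simp: GF8_def)
    fix z assume "z \<in> carrier (add_monoid GF8) \<and> nat_of y \<otimes>\<^bsub>add_monoid GF8\<^esub> z = \<one>\<^bsub>add_monoid GF8\<^esub> \<and>
      z \<otimes>\<^bsub>add_monoid GF8\<^esub> nat_of y = \<one>\<^bsub>add_monoid GF8\<^esub>"
    then have z: "z \<in> range nat_of" "xor (nat_of y) z = 0" using nat_of_range by (auto simp: GF8_def)
    then obtain w where w: "z = nat_of w" by blast
    then have "y + w = 0" using z nat_of_plus[of y w] nat_of_0 nat_of_inj by metis
    then have "w = y" by (metis gf8_add_self add_left_cancel)
    then show "z = nat_of y" using w by simp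
  qed
  then show ?thesis by (simp add: a_minus_def GF8_def)
qed

lemma SL2_carrier: "carrier (SL2 GF8) = nat_mat2 ` sl2"
proof -
  have det: "(nat_of a \<otimes>\<^bsub>GF8\<^esub> nat_of d) \<ominus>\<^bsub>GF8\<^esub> (nat_of b \<otimes>\<^bsub>GF8\<^esub> nat_of c) = \<one>\<^bsub>GF8\<^esub> \<longleftrightarrow> a * d - b * c = 1" for a b c d
  proof -
    have m: "nat_of x \<otimes>\<^bsub>GF8\<^esub> nat_of y = nat_of (x * y)" for x y by (simp add: GF8_def nat_of_times)
    have "(nat_of a \<otimes>\<^bsub>GF8\<^esub> nat_of d) \<ominus>\<^bsub>GF8\<^esub> (nat_of b \<otimes>\<^bsub>GF8\<^esub> nat_of c) = nat_of (a * d + b * c)"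
      unfolding m GF8_minus nat_of_plus ..
    moreover have "\<one>\<^bsub>GF8\<^esub> = nat_of 1" by (simp add: GF8_def nat_of_1)
    ultimately show ?thesis by (simp only: nat_of_inj gf8_minus)
  qed
  show ?thesis
  proof (rule Set.set_eqI)
    fix q :: "nat \<times> nat \<times> nat \<times> nat"
    obtain x y z w where q: "q = (x, y, z, w)" by (cases q)
    have "q \<in> carrier (SL2 GF8) \<longleftrightarrow> (\<exists>a b c d. x = nat_of a \<and> y = nat_of b \<and> z = nat_of c \<and> w = nat_of d \<and> a * d - b * c = 1)"
      unfolding SL2_def q by (auto simp: GF8_carrier det nat_of_inj)
    also have "\<dots> \<longleftrightarrow> (\<exists>m\<in>sl2. q = nat_mat2 m)"
    proof
      assume "\<exists>a b c d. x = nat_of a \<and> y = nat_of b \<and> z = nat_of c \<and> w = nat_of d \<and> a * d - b * c = 1"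
      then obtain a b c d where "q = nat_mat2 (a, b, c, d)" "(a, b, c, d) \<in> sl2" by (auto simp: q sl2_def)
      then show "\<exists>m\<in>sl2. q = nat_mat2 m" by (rule rev_bexI[rotated])
    qed (auto simp: q sl2_def)
    also have "\<dots> \<longleftrightarrow> q \<in> nat_mat2 ` sl2" by (simp only: image_iff)
    finally show "q \<in> carrier (SL2 GF8) \<longleftrightarrow> q \<in> nat_mat2 ` sl2" .
  qed
qed

lemma SL2_mult: "nat_mat2 m \<otimes>\<^bsub>SL2 GF8\<^esub> nat_mat2 n = nat_mat2 (mat2_mult m n)"
  by (cases m; cases n) (simp add: SL2_def GF8_def nat_of_plus nat_of_times)

lemma SL2_one: "\<one>\<^bsub>SL2 GF8\<^esub> = nat_mat2 (1, 0, 0, 1)"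
  by (simp add: SL2_def GF8_def nat_of_0 nat_of_1)

lemma mat2_assoc: "mat2_mult (mat2_mult m n) k = mat2_mult m (mat2_mult n k)"
  by (cases m; cases n; cases k) (simp add: algebra_simps)

lemma mat2_one: "mat2_mult (1, 0, 0, 1) m = m"
  by (cases m) simp

lemma mat2_mult_sl2: "m \<in> sl2 \<Longrightarrow> n \<in> sl2 \<Longrightarrow> mat2_mult m n \<in> sl2"
proof -
  assume m: "m \<in> sl2" and n: "n \<in> sl2"
  obtain a b c d where abcd: "m = (a, b, c, d)" by (cases m)
  obtain a' b' c' d' where abcd': "n = (a', b', c', d')" by (cases n)
  have "(a * a' + b * c') * (c * b' + d * d') - (a * b' + b * d') * (c * a' + d * c')
      = (a * d - b * c) * (a' * d' - b' * c')"
    by (simp add: algebra_simps)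
  then show ?thesis using m n abcd abcd' by (simp add: sl2_def)
qed

lemma mat2_inv: "m \<in> sl2 \<Longrightarrow> mat2_inv m \<in> sl2" "m \<in> sl2 \<Longrightarrow> mat2_mult (mat2_inv m) m = (1, 0, 0, 1)"
  by (cases m; simp add: sl2_def algebra_simps)+

lemma group_SL2: "group (SL2 GF8)"
proof (rule groupI)
  show "\<one>\<^bsub>SL2 GF8\<^esub> \<in> carrier (SL2 GF8)" unfolding SL2_carrier SL2_one by (rule imageI) (simp add: sl2_def)
  have mat: "\<exists>m\<in>sl2. x = nat_mat2 m" if "x \<in> carrier (SL2 GF8)" for x
    using that unfolding SL2_carrier by (rule imageE) blast
  fix x y z assume "x \<in> carrier (SL2 GF8)" "y \<in> carrier (SL2 GF8)" "z \<in> carrier (SL2 GF8)"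
  with mat obtain m n k where m: "m \<in> sl2" "x = nat_mat2 m" and n: "n \<in> sl2" "y = nat_mat2 n" and k: "z = nat_mat2 k"
    by meson
  show "x \<otimes>\<^bsub>SL2 GF8\<^esub> y \<otimes>\<^bsub>SL2 GF8\<^esub> z = x \<otimes>\<^bsub>SL2 GF8\<^esub> (y \<otimes>\<^bsub>SL2 GF8\<^esub> z)"
    by (simp only: m(2) n(2) k SL2_mult mat2_assoc)
  show "x \<otimes>\<^bsub>SL2 GF8\<^esub> y \<in> carrier (SL2 GF8)"
    unfolding SL2_carrier m(2) n(2) SL2_mult using m(1) n(1) by (intro imageI mat2_mult_sl2)
  show "\<one>\<^bsub>SL2 GF8\<^esub> \<otimes>\<^bsub>SL2 GF8\<^esub> x = x"
    by (simp only: m(2) SL2_one SL2_mult mat2_one)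
  have "nat_mat2 (mat2_inv m) \<otimes>\<^bsub>SL2 GF8\<^esub> x = \<one>\<^bsub>SL2 GF8\<^esub>"
    by (simp only: m(2) SL2_one SL2_mult mat2_inv(2)[OF m(1)])
  moreover have "nat_mat2 (mat2_inv m) \<in> carrier (SL2 GF8)"
    unfolding SL2_carrier using mat2_inv(1)[OF m(1)] by (rule imageI)
  ultimately show "\<exists>y\<in>carrier (SL2 GF8). y \<otimes>\<^bsub>SL2 GF8\<^esub> x = \<one>\<^bsub>SL2 GF8\<^esub>" by (rule bexI)
qed

text \<open>The only square root of 1 in characteristic 2 is 1. Hence PSL2 is the quotient of SL2 by
  the trivial subgroup, and its elements are singletons.\<close>

lemma SL2_center_trivial: "SL2_center GF8 = {\<one>\<^bsub>SL2 GF8\<^esub>}"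
proof -
  have "x = 1" if x: "x \<in> carrier GF8" "x \<otimes>\<^bsub>GF8\<^esub> x = \<one>\<^bsub>GF8\<^esub>" for x
  proof -
    obtain a where a: "x = nat_of a" using x(1) GF8_carrier by blast
    have "nat_of (a * a) = nat_of 1" using x(2) by (simp add: a GF8_def nat_of_times nat_of_1)
    then have "a = 1" unfolding nat_of_inj by (rule gf8_square_eq_one)
    then show ?thesis by (simp add: a nat_of_1)
  qed
  moreover have "(1 :: nat) \<otimes>\<^bsub>GF8\<^esub> 1 = \<one>\<^bsub>GF8\<^esub>"
    using nat_of_times[of 1 1] by (simp add: GF8_def nat_of_1)
  moreover have "(1 :: nat) \<in> carrier GF8" by (simp add: GF8_def)
  ultimately have one: "x \<in> carrier GF8 \<and> x \<otimes>\<^bsub>GF8\<^esub> x = \<one>\<^bsub>GF8\<^esub> \<longleftrightarrow> x = 1" for x by blast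
  have "\<zero>\<^bsub>GF8\<^esub> = 0" "\<one>\<^bsub>SL2 GF8\<^esub> = (1, 0, 0, 1)"
    by (simp_all add: GF8_def SL2_def)
  then show ?thesis unfolding SL2_center_def one by simp
qed

text \<open>Homogeneous coordinates: a field element x is [x : 1] and infinity is [1 : 0].\<close>

fun hx hy :: "pt \<Rightarrow> gf8" where
  "hx P8 = 1"
| "hx x = gf_of x"
| "hy P8 = 0"
| "hy x = 1"

text \<open>The point with homogeneous coordinates [u : v]. The value at (0, 0) has no meaning; it
  is avoided because matrices of determinant one keep coordinates nonzero.\<close>

definition ratio :: "gf8 \<Rightarrow> gf8 \<Rightarrow> pt" where
  "ratio u v = (if v = 0 then P8 else pt_of (u / v))"

fun mobius :: "mat2 \<Rightarrow> pt \<Rightarrow> pt" where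
  "mobius (a, b, c, d) x = ratio (a * hx x + b * hy x) (c * hx x + d * hy x)"

definition perm_of :: "mat2 \<Rightarrow> perm" where
  "perm_of m = Perm (mobius m P0) (mobius m P1) (mobius m P2) (mobius m P3) (mobius m P4) (mobius m P5) (mobius m P6) (mobius m P7) (mobius m P8)"

lemma ap_perm_of [simp]: "ap (perm_of m) x = mobius m x"
  by (cases x) (simp_all add: perm_of_def)

lemma gf_of_pt_of [simp]: "gf_of (pt_of x) = x"
  by (cases x) simp_all

lemma pt_of_inj [simp]: "pt_of x = pt_of y \<longleftrightarrow> x = y"
  by (metis gf_of_pt_of)

lemma pt_of_not_P8 [simp]: "pt_of x \<noteq> P8"
  by (cases x) simp_all

lemma hx_pt_of [simp]: "hx (pt_of x) = x" "hy (pt_of x) = 1"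
  by (cases x; simp)+

lemma ratio_scale: "l \<noteq> 0 \<Longrightarrow> ratio (l * u) (l * v) = ratio u v"
  by (simp add: ratio_def)

lemma ratio_coordinates:
  assumes "u \<noteq> 0 \<or> v \<noteq> 0"
  obtains l where "l \<noteq> 0" "u = l * hx (ratio u v)" "v = l * hy (ratio u v)"
proof (cases "v = 0")
  case True
  then show ?thesis using that[of u] assms by (simp add: ratio_def)
next
  case False
  then show ?thesis using that[of v] by (simp add: ratio_def)
qed

lemma coordinates_nonzero: "hx x \<noteq> 0 \<or> hy x \<noteq> 0"
  by (cases x) simp_all

text \<open>\<open>ratio\<close> followed by \<open>hx\<close> and \<open>hy\<close> returns the
  coordinates up to a common factor l, and this factor cancels in the next application. Determinant
  one of n ensures that the intermediate coordinates are not both zero.\<close>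

lemma mobius_mult:
  assumes n: "n \<in> sl2"
  shows "mobius (mat2_mult m n) x = mobius m (mobius n x)"
proof -
  obtain a b c d where m: "m = (a, b, c, d)" by (cases m)
  obtain a' b' c' d' where n': "n = (a', b', c', d')" by (cases n)
  have det: "a' * d' - b' * c' = 1" using n by (simp add: n' sl2_def)
  let ?u = "a' * hx x + b' * hy x" and ?v = "c' * hx x + d' * hy x"
  have "?u \<noteq> 0 \<or> ?v \<noteq> 0"
  proof (rule ccontr)
    assume "\<not> (?u \<noteq> 0 \<or> ?v \<noteq> 0)"
    then have z: "?u = 0" "?v = 0" by auto
    \<comment> \<open>Cramer's rule: if both new coordinates were zero, so would be the old
      ones.\<close>
    have "(a' * d' - b' * c') * hx x = d' * ?u - b' * ?v" "(a' * d' - b' * c') * hy x = a' * ?v - c' * ?u"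
      by (simp_all add: algebra_simps)
    then have "hx x = 0" "hy x = 0" unfolding det z by simp_all
    then show False using coordinates_nonzero[of x] by simp
  qed
  then obtain l where l: "l \<noteq> 0" "?u = l * hx (ratio ?u ?v)" "?v = l * hy (ratio ?u ?v)"
    using ratio_coordinates by blast
  have lin: "ratio (a * u + b * v) (c * u + d * v) = ratio (a * p + b * q) (c * p + d * q)"
    if "l \<noteq> 0" "u = l * p" "v = l * q" for u v p q l
  proof -
    have "a * u + b * v = l * (a * p + b * q)" "c * u + d * v = l * (c * p + d * q)"
      by (simp_all add: that(2,3) algebra_simps)
    then show ?thesis using ratio_scale[OF that(1)] by simp
  qed
  have "mobius (mat2_mult m n) x = ratio (a * ?u + b * ?v) (c * ?u + d * ?v)"
    by (simp add: m n' algebra_simps)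
  also have "\<dots> = mobius m (mobius n x)" unfolding lin[OF l] by (simp add: m n')
  finally show ?thesis .
qed

lemma perm_of_mult: "n \<in> sl2 \<Longrightarrow> perm_of (mat2_mult m n) = cmp (perm_of m) (perm_of n)"
  by (rule perm_eqI) (simp add: mobius_mult)

lemma mobius_one: "mobius (1, 0, 0, 1) x = x"
  by (cases x) (simp_all add: ratio_def zero_gf8_def one_gf8_def divide_gf8_def times_gf8_def plus_gf8_def gtimes_def gplus_def ginv_def winv_def)

text \<open>Fixing infinity, 0 and 1 gives in turn c = 0, b = 0 and a = d. The determinant is then
  a^2, and a^2 = 1 forces a = 1.\<close>

lemma mobius_fixes_three:
  assumes m: "m \<in> sl2" and "mobius m P0 = P0" "mobius m P1 = P1" "mobius m P8 = P8"
  shows "m = (1, 0, 0, 1)"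
proof -
  obtain a b c d where abcd: "m = (a, b, c, d)" by (cases m)
  have h: "P0 = pt_of 0" "P1 = pt_of 1"
    by (simp_all add: zero_gf8_def one_gf8_def)
  have c: "c = 0" using assms(4) by (auto simp: abcd ratio_def split: if_splits)
  have "ratio b d = P0" using assms(2) by (simp add: abcd zero_gf8_def[symmetric] one_gf8_def[symmetric])
  then have b: "b = 0" and d: "d \<noteq> 0" unfolding h(1) ratio_def using pt_of_not_P8[of 0] by (auto split: if_splits simp del: pt_of_not_P8)
  have "ratio a d = P1" using assms(3) by (simp add: abcd b c zero_gf8_def[symmetric] one_gf8_def[symmetric])
  then have "a = d" unfolding h(2) ratio_def using d by auto
  moreover have "a * d = 1" using m by (simp add: abcd sl2_def b)
  ultimately have "a * a = 1" by simp
  then have "a = 1" by (rule gf8_square_eq_one)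
  then show ?thesis using \<open>a = d\<close> abcd b c by simp
qed

text \<open>In the field with eight elements x^4 is the square root of x, since x^8 = x. So the
  diagonal matrix with entries x^4 and x^-4 acts as multiplication by x.\<close>

lemma perm_of_check:
  "perm_of (0, 1, 1, 0) = winv"
  "list_all (\<lambda>x. perm_of (1, x, 0, 1) = tau (pt_of x)) gfs"
  "list_all (\<lambda>x. x \<noteq> 0 \<longrightarrow> x * x * (x * x) \<noteq> 0 \<and>
     perm_of (x * x * (x * x), 0, 0, inverse (x * x * (x * x))) = mu (pt_of x)) gfs"
  by code_simp+

lemma perm_of_generators:
  "b \<noteq> P8 \<Longrightarrow> tau b \<in> perm_of ` sl2" "a \<noteq> P0 \<Longrightarrow> a \<noteq> P8 \<Longrightarrow> mu a \<in> perm_of ` sl2" "winv \<in> perm_of ` sl2"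
proof -
  have pt: "pt_of (gf_of x) = x" if "x \<noteq> P8" for x using that by (cases x) simp_all
  have "(0, 1, 1, 0) \<in> sl2" by (simp add: sl2_def gf8_minus)
  then show "winv \<in> perm_of ` sl2" by (rule rev_image_eqI) (rule perm_of_check(1)[symmetric])
  show "tau b \<in> perm_of ` sl2" if "b \<noteq> P8"
  proof (rule image_eqI)
    show "tau b = perm_of (1, gf_of b, 0, 1)"
      using perm_of_check(2) pt[OF that] by (simp add: list_all_iff)
    show "(1, gf_of b, 0, 1) \<in> sl2" by (simp add: sl2_def)
  qed
  show "mu a \<in> perm_of ` sl2" if a: "a \<noteq> P0" "a \<noteq> P8"
  proof (rule image_eqI)
    let ?s = "gf_of a * gf_of a * (gf_of a * gf_of a)"
    have "gf_of a \<noteq> 0" using a by (cases a) (simp_all add: zero_gf8_def)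
    then have s: "?s \<noteq> 0 \<and> perm_of (?s, 0, 0, inverse ?s) = mu a"
      using perm_of_check(3)[unfolded list_all_iff, THEN bspec, OF in_gfs, of "gf_of a"] pt[OF a(2)] by simp
    then show "mu a = perm_of (?s, 0, 0, inverse ?s)" by simp
    have "(s, 0, 0, inverse s) \<in> sl2" if "s \<noteq> 0" for s using that by (simp add: sl2_def)
    then show "(?s, 0, 0, inverse ?s) \<in> sl2" using s by blast
  qed
qed

text \<open>Every entry of the list is a product of translations, scalings and the inversion, all of
  which come from matrices. Conversely a matrix agrees at 0, 1, infinity with some entry of the
  list, and three images determine a matrix of determinant one.\<close>

lemma perm_of_bij: "bij_betw perm_of sl2 (set group_list)"
proof -
  have closed: "cmp p q \<in> perm_of ` sl2" if pq: "p \<in> perm_of ` sl2" "q \<in> perm_of ` sl2" for p q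
  proof -
    obtain m n where "m \<in> sl2" "p = perm_of m" "n \<in> sl2" "q = perm_of n" using pq by (elim imageE) rule
    then show ?thesis using perm_of_mult[of n m] mat2_mult_sl2[of m n] by (intro image_eqI[of _ _ "mat2_mult m n"]) simp_all
  qed
  have sup: "set group_list \<subseteq> perm_of ` sl2"
  proof
    fix p assume "p \<in> set group_list"
    then obtain i b a where p: "p = el i b a" "b \<in> set (butlast pts)" "a \<in> set (butlast (tl pts))"
      unfolding set_group_list by blast
    have "b \<noteq> P8" "a \<noteq> P0" "a \<noteq> P8" using p(2,3) by (auto simp: pts_def)
    then show "p \<in> perm_of ` sl2"
      unfolding p(1) el_def Let_def by (cases "i = P8") (simp_all add: perm_of_generators closed)
  qed
  have ker: "m = n" if m: "m \<in> sl2" and n: "n \<in> sl2"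
    and e: "mobius m P0 = mobius n P0" "mobius m P1 = mobius n P1" "mobius m P8 = mobius n P8" for m n
  proof -
    have k: "mat2_mult (mat2_inv n) m \<in> sl2" using mat2_mult_sl2 mat2_inv m n by blast
    have ret: "mobius (mat2_inv n) (mobius n x) = x" for x
      using mobius_mult[OF n, of "mat2_inv n" x] mat2_inv(2)[OF n] mobius_one by simp
    have "mat2_mult (mat2_inv n) m = (1, 0, 0, 1)"
      by (rule mobius_fixes_three[OF k]) (simp_all add: mobius_mult[OF m] e ret)
    moreover have "mat2_mult n (mat2_inv n) = (1, 0, 0, 1)"
      using n by (cases n) (simp add: sl2_def algebra_simps)
    ultimately have "mat2_mult (1, 0, 0, 1) m = mat2_mult n (1, 0, 0, 1)" by (metis mat2_assoc)
    moreover have "mat2_mult n (1, 0, 0, 1) = n" by (cases n) simp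
    ultimately show ?thesis by (simp only: mat2_one)
  qed
  have "inj_on perm_of sl2"
  proof (rule inj_onI)
    fix m n assume "m \<in> sl2" "n \<in> sl2" "perm_of m = perm_of n"
    then show "m = n" using ker by (metis ap_perm_of)
  qed
  moreover have "perm_of ` sl2 \<subseteq> set group_list"
  proof
    fix p assume "p \<in> perm_of ` sl2"
    then obtain m where m: "m \<in> sl2" "p = perm_of m" by blast
    have ret: "mobius (mat2_inv m) (mobius m x) = x" for x
      using mobius_mult[OF m(1), of "mat2_inv m" x] mat2_inv(2)[OF m(1)] mobius_one by simp
    have ne: "mobius m x \<noteq> mobius m y" if "x \<noteq> y" for x y using ret[of x] ret[of y] that by auto
    have d: "mobius m P0 \<noteq> mobius m P1" "mobius m P0 \<noteq> mobius m P8" "mobius m P1 \<noteq> mobius m P8"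
      using ne by simp_all
    note t = tri_distinct[OF d]
    obtain n where n: "n \<in> sl2" "tri (mobius m P0) (mobius m P1) (mobius m P8) = perm_of n" using t(4) sup by blast
    have "m = n" by (rule ker[OF m(1) n(1)]) (use t n in simp_all)
    then show "p \<in> set group_list" using m n t(4) by simp
  qed
  ultimately show ?thesis using sup by (auto simp: bij_betw_def)
qed

lemma PSL2_GF8: "\<exists>\<pi>. psl28 (PSL2 GF8) \<pi>"
proof -
  interpret SL: group "SL2 GF8" by (rule group_SL2)
  have norm: "{\<one>\<^bsub>SL2 GF8\<^esub>} \<lhd> SL2 GF8" by (rule SL.one_is_normal)
  have gr: "group (PSL2 GF8)" unfolding PSL2_def SL2_center_trivial by (rule normal.factorgroup_is_group[OF norm])
  have rc: "{\<one>\<^bsub>SL2 GF8\<^esub>} #>\<^bsub>SL2 GF8\<^esub> x = {x}" if "x \<in> carrier (SL2 GF8)" for x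
    unfolding r_coset_def using SL.l_one[OF that] by simp
  have "carrier (PSL2 GF8) = (\<lambda>x. {x}) ` carrier (SL2 GF8)"
    unfolding PSL2_def SL2_center_trivial FactGroup_def RCOSETS_def using rc by auto
  then have car: "carrier (PSL2 GF8) = (\<lambda>m. {nat_mat2 m}) ` sl2"
    unfolding SL2_carrier image_image .
  have mult: "{nat_mat2 m} \<otimes>\<^bsub>PSL2 GF8\<^esub> {nat_mat2 n} = {nat_mat2 (mat2_mult m n)}" for m n
    by (simp add: PSL2_def FactGroup_def set_mult_def SL2_mult)
  define \<pi> where "\<pi> X = perm_of (inv_into sl2 (\<lambda>m. {nat_mat2 m}) X)" for X
  have inj: "inj_on (\<lambda>m. {nat_mat2 m}) sl2" by (auto simp: inj_on_def nat_mat2_inj)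
  have \<pi>: "\<pi> {nat_mat2 m} = perm_of m" if "m \<in> sl2" for m
    unfolding \<pi>_def using inv_into_f_f[OF inj that] by simp
  have "bij_betw \<pi> (carrier (PSL2 GF8)) (set group_list)"
  proof -
    have "bij_betw (inv_into sl2 (\<lambda>m. {nat_mat2 m})) (carrier (PSL2 GF8)) sl2"
      unfolding car by (rule bij_betw_inv_into) (use inj in \<open>auto simp: bij_betw_def\<close>)
    from bij_betw_trans[OF this perm_of_bij] show ?thesis by (simp add: \<pi>_def [abs_def] comp_def)
  qed
  moreover have "\<pi> (x \<otimes>\<^bsub>PSL2 GF8\<^esub> y) = cmp (\<pi> x) (\<pi> y)" if xy: "x \<in> carrier (PSL2 GF8)" "y \<in> carrier (PSL2 GF8)" for x y
  proof -
    obtain m n where "m \<in> sl2" "n \<in> sl2" "x = {nat_mat2 m}" "y = {nat_mat2 n}" using xy unfolding car by (elim imageE) rule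
    then show ?thesis using \<pi> mat2_mult_sl2 perm_of_mult by (simp add: mult)
  qed
  ultimately have "psl28 (PSL2 GF8) \<pi>" using gr by (simp add: psl28_def psl28_axioms_def)
  then show ?thesis by blast
qed

section \<open>Formal sums of translates\<close>

text \<open>The standard C3, C9 and D7, in the role of stabilizers of the base cosets of the three
  types.\<close>

fun stab :: "ty \<Rightarrow> perm \<Rightarrow> bool" where
  "stab T0 p \<longleftrightarrow> p \<in> {idp, cyc, cmp cyc cyc}"
| "stab T1 p \<longleftrightarrow> cmp p cyc = cmp cyc p"
| "stab T2 p \<longleftrightarrow> ap p P0 = P0 \<and> ap p P1 = P1 \<or> ap p P0 = P1 \<and> ap p P1 = P0"

lemma ap_pre0: "ap p a = P0 \<Longrightarrow> ap p (pre0 p) = P0"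
  by (cases p; cases a) (auto simp: pre0_def)

lemma key_T0_eq:
  "key T0 p = key T0 q \<Longrightarrow>
    (ap q P0 = ap p P0 \<and> ap q P1 = ap p P1 \<and> ap q P8 = ap p P8) \<or>
    (ap q P0 = ap p P1 \<and> ap q P1 = ap p P8 \<and> ap q P8 = ap p P0) \<or>
    (ap q P0 = ap p P8 \<and> ap q P1 = ap p P0 \<and> ap q P8 = ap p P1)"
  by (simp add: Let_def split: if_splits)

lemma key_T2_eq:
  "key T2 p = key T2 q \<Longrightarrow>
    (ap q P0 = ap p P0 \<and> ap q P1 = ap p P1) \<or> (ap q P0 = ap p P1 \<and> ap q P1 = ap p P0)"
  by (simp add: Let_def split: if_splits)

definition ok :: "(int \<times> ty \<times> perm) list \<Rightarrow> bool" where
  "ok bs \<longleftrightarrow> (\<forall>(d, s, h) \<in> set bs. h \<in> set group_list)"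

context psl28
begin

lemma ap_pre0_\<pi>: "x \<in> carrier G \<Longrightarrow> ap (\<pi> x) (pre0 (\<pi> x)) = P0"
  using ap_pre0[of "\<pi> x" "ap (\<pi> (inv x)) P0"] by simp

lemma E_cyc: "E cyc \<in> carrier G" "\<pi> (E cyc) = cyc"
  using cyc_ap(6) by simp_all

lemma key_type:
  assumes x: "x \<in> carrier G"
  obtains a b c where "key s (\<pi> x) = (a, b, c)"
    "s = T0 \<longleftrightarrow> a \<noteq> b \<and> b \<noteq> c" "s = T1 \<longleftrightarrow> a \<noteq> b \<and> b = c" "s = T2 \<longleftrightarrow> a = b \<and> b \<noteq> c"
proof -
  have "\<exists>a b c. key s (\<pi> x) = (a, b, c) \<and> (s = T0 \<longleftrightarrow> a \<noteq> b \<and> b \<noteq> c) \<and>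
    (s = T1 \<longleftrightarrow> a \<noteq> b \<and> b = c) \<and> (s = T2 \<longleftrightarrow> a = b \<and> b \<noteq> c)"
  proof (cases s)
    case T0
    then show ?thesis using x by (simp add: Let_def)
  next
    case T1
    have "ap (\<pi> x) (ap cyc u) \<noteq> ap (\<pi> x) u" for u using x cyc_ap(4) by simp
    then show ?thesis using T1 by (simp add: Let_def) metis
  next
    case T2
    then show ?thesis using x by (simp add: Let_def)
  qed
  then show ?thesis using that by blast
qed

text \<open>Soundness of the encoding: entries that meet in one cell of the table belong to the same
  coset. For \<open>T0\<close> the images of 0, 1, infinity agree up to a rotation, that is, up to a
  power of \<open>cyc\<close>. For \<open>T1\<close> the conjugates of \<open>cyc\<close> agree on
  three points and so everywhere, and elements with equal conjugates differ by the
  centralizer.\<close>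

lemma key_eqD:
  assumes x: "x \<in> carrier G" and y: "y \<in> carrier G" and eq: "key s (\<pi> x) = key s' (\<pi> y)"
  shows "s = s'" "stab s (\<pi> (inv x \<otimes> y))"
proof -
  show ss: "s = s'"
  proof (rule key_type[OF x, of s], rule key_type[OF y, of s'])
    fix a b c a' b' c'
    assume k: "key s (\<pi> x) = (a, b, c)" "key s' (\<pi> y) = (a', b', c')"
      and 1: "s = T0 \<longleftrightarrow> a \<noteq> b \<and> b \<noteq> c" "s = T1 \<longleftrightarrow> a \<noteq> b \<and> b = c" "s = T2 \<longleftrightarrow> a = b \<and> b \<noteq> c"
      and 2: "s' = T0 \<longleftrightarrow> a' \<noteq> b' \<and> b' \<noteq> c'" "s' = T1 \<longleftrightarrow> a' \<noteq> b' \<and> b' = c'" "s' = T2 \<longleftrightarrow> a' = b' \<and> b' \<noteq> c'"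
    have "a = a'" "b = b'" "c = c'" using eq k by auto
    then show "s = s'" using 1 2 by (cases s; cases s') auto
  qed
  note c = E_cyc
  have kx: "inv x \<otimes> y \<in> carrier G" using x y by simp
  show "stab s (\<pi> (inv x \<otimes> y))"
  proof (cases s)
    case T0
    have y_eq: "y = x \<otimes> z \<Longrightarrow> z \<in> carrier G \<Longrightarrow> inv x \<otimes> y = z" for z using x by simp
    from key_T0_eq[of "\<pi> x" "\<pi> y"] eq ss T0 consider
      "ap (\<pi> y) P0 = ap (\<pi> x) P0 \<and> ap (\<pi> y) P1 = ap (\<pi> x) P1 \<and> ap (\<pi> y) P8 = ap (\<pi> x) P8"
      | "ap (\<pi> y) P0 = ap (\<pi> x) P1 \<and> ap (\<pi> y) P1 = ap (\<pi> x) P8 \<and> ap (\<pi> y) P8 = ap (\<pi> x) P0"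
      | "ap (\<pi> y) P0 = ap (\<pi> x) P8 \<and> ap (\<pi> y) P1 = ap (\<pi> x) P0 \<and> ap (\<pi> y) P8 = ap (\<pi> x) P1"
      by metis
    then show ?thesis
    proof cases
      case 1
      then have "y = x \<otimes> \<one>" using standard_triple_eq[of y x] x y by simp
      then show ?thesis using y_eq T0 by simp
    next
      case 2
      then have "y = x \<otimes> E cyc" using x y c cyc_ap by (intro standard_triple_eq) (auto simp: \<pi>_mult)
      then show ?thesis using y_eq[of "E cyc"] T0 c by simp
    next
      case 3
      then have "y = x \<otimes> (E cyc \<otimes> E cyc)" using x y c cyc_ap by (intro standard_triple_eq) (auto simp: \<pi>_mult)
      then show ?thesis using y_eq[of "E cyc \<otimes> E cyc"] T0 c by (simp add: \<pi>_mult)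
    qed
  next
    case T1
    define X where "X = x \<otimes> E cyc \<otimes> inv x"
    define Y where "Y = y \<otimes> E cyc \<otimes> inv y"
    have XY: "X \<in> carrier G" "Y \<in> carrier G" using x y c by (auto simp: X_def Y_def)
    have apX: "ap (\<pi> X) (ap (\<pi> x) u) = ap (\<pi> x) (ap cyc u)" for u using x c by (simp add: X_def \<pi>_mult)
    have apY: "ap (\<pi> Y) (ap (\<pi> y) u) = ap (\<pi> y) (ap cyc u)" for u using y c by (simp add: Y_def \<pi>_mult)
    let ?u = "pre0 (\<pi> x)" and ?v = "pre0 (\<pi> y)"
    have u: "ap (\<pi> x) ?u = P0" and v: "ap (\<pi> y) ?v = P0" using ap_pre0_\<pi> x y by auto
    have e: "ap (\<pi> x) (ap cyc ?u) = ap (\<pi> y) (ap cyc ?v)" "ap (\<pi> x) (ap cyc (ap cyc ?u)) = ap (\<pi> y) (ap cyc (ap cyc ?v))"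
      using eq ss T1 by (auto simp: Let_def)
    have "X = Y"
    proof (rule triple_eq[OF XY, of P0 "ap (\<pi> x) (ap cyc ?u)" "ap (\<pi> x) (ap cyc (ap cyc ?u))"])
      show "P0 \<noteq> ap (\<pi> x) (ap cyc ?u)" using u x cyc_ap(4) by (metis ap_eq)
      show "ap (\<pi> x) (ap cyc ?u) \<noteq> ap (\<pi> x) (ap cyc (ap cyc ?u))" using x cyc_ap(4) by (metis ap_eq)
      show "P0 \<noteq> ap (\<pi> x) (ap cyc (ap cyc ?u))" using u x cyc_ap(4,5) by (metis ap_eq)
      show "ap (\<pi> X) P0 = ap (\<pi> Y) P0" using apX[of ?u] apY[of ?v] u v e by simp
      show "ap (\<pi> X) (ap (\<pi> x) (ap cyc ?u)) = ap (\<pi> Y) (ap (\<pi> x) (ap cyc ?u))"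
        using apX[of "ap cyc ?u"] apY[of "ap cyc ?v"] e by simp
      show "ap (\<pi> X) (ap (\<pi> x) (ap cyc (ap cyc ?u))) = ap (\<pi> Y) (ap (\<pi> x) (ap cyc (ap cyc ?u)))"
        using apX[of "ap cyc (ap cyc ?u)"] apY[of "ap cyc (ap cyc ?v)"] e u v cyc_ap(5) by simp
    qed
    then have "x \<otimes> E cyc \<otimes> inv x \<otimes> y = y \<otimes> E cyc \<otimes> inv y \<otimes> y" by (simp add: X_def Y_def)
    then have "x \<otimes> (E cyc \<otimes> (inv x \<otimes> y)) = y \<otimes> E cyc" using x y c by (simp add: m_assoc)
    then have "inv x \<otimes> (x \<otimes> (E cyc \<otimes> (inv x \<otimes> y))) = inv x \<otimes> (y \<otimes> E cyc)" by simp
    then have "E cyc \<otimes> (inv x \<otimes> y) = inv x \<otimes> y \<otimes> E cyc" using x y c by (simp add: m_assoc)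
    from arg_cong[OF this, of \<pi>] show ?thesis using T1 x y c by (simp add: \<pi>_mult)
  next
    case T2
    have "ap (\<pi> y) P0 = ap (\<pi> x) P0 \<and> ap (\<pi> y) P1 = ap (\<pi> x) P1 \<or> ap (\<pi> y) P0 = ap (\<pi> x) P1 \<and> ap (\<pi> y) P1 = ap (\<pi> x) P0"
      using key_T2_eq[of "\<pi> x" "\<pi> y"] eq ss T2 by metis
    then show ?thesis using T2 x y by (auto simp: \<pi>_mult)
  qed
qed

end

text \<open>A realization of formal sums of cosets in a lattice: \<open>w s\<close> is the vector of
  the base coset of type s, and its invariance makes its translates depend on the coset
  only.\<close>

locale formal_sums = psl28 G \<pi> for G (structure) and \<pi> +
  fixes L :: "'a lattice" and w :: "ty \<Rightarrow> int vec"
  assumes L: "G_lattice G L" and w: "\<And>s. w s \<in> carrier_vec (fst L)"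
    and w_inv: "\<And>s x. x \<in> carrier G \<Longrightarrow> stab s (\<pi> x) \<Longrightarrow> snd L x *\<^sub>v w s = w s"
begin

text \<open>Coordinate r of the vector that belongs to a key, an integer function as
  \<open>tree_sum\<close> expects. By \<open>key_eqD\<close> the choice of the type and the group
  element behind the key is immaterial.\<close>

definition \<Phi> :: "nat \<Rightarrow> pt \<times> pt \<times> pt \<Rightarrow> int" where
  "\<Phi> r k = (case (SOME sx. snd sx \<in> carrier G \<and> key (fst sx) (\<pi> (snd sx)) = k) of (s, x) \<Rightarrow> (snd L x *\<^sub>v w s) $ r)"

lemma \<Phi>_key:
  assumes x: "x \<in> carrier G"
  shows "\<Phi> r (key s (\<pi> x)) = (snd L x *\<^sub>v w s) $ r"
proof -
  define sx where "sx = (SOME sx. snd sx \<in> carrier G \<and> key (fst sx) (\<pi> (snd sx)) = key s (\<pi> x))"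
  obtain s' y where sy: "sx = (s', y)" by (cases sx)
  have "snd sx \<in> carrier G \<and> key (fst sx) (\<pi> (snd sx)) = key s (\<pi> x)"
    unfolding sx_def by (rule someI[of _ "(s, x)"]) (use x in simp)
  then have y: "y \<in> carrier G" "key s' (\<pi> y) = key s (\<pi> x)" by (auto simp: sy)
  note k = key_eqD[OF y(1) x y(2)]
  have "snd L x *\<^sub>v w s = snd L (y \<otimes> (inv y \<otimes> x)) *\<^sub>v w s" using x y by simp
  also have "\<dots> = snd L y *\<^sub>v (snd L (inv y \<otimes> x) *\<^sub>v w s)"
    by (rule G_lattice_mult_vec[OF L y(1) _ w]) (use x y in simp)
  also have "\<dots> = snd L y *\<^sub>v w s" using w_inv[of "inv y \<otimes> x" s] k x y by simp
  finally show ?thesis unfolding \<Phi>_def sx_def[symmetric] sy using k by simp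
qed

primrec comb :: "(int \<times> ty \<times> perm) list \<Rightarrow> int vec" where
  "comb [] = 0\<^sub>v (fst L)"
| "comb (b # bs) = (case b of (d, s, h) \<Rightarrow> d \<cdot>\<^sub>v (snd L (E h) *\<^sub>v w s)) + comb bs"

lemma act_carrier: "g \<in> carrier G \<Longrightarrow> x \<in> carrier_vec (fst L) \<Longrightarrow> snd L g *\<^sub>v x \<in> carrier_vec (fst L)"
  using G_lattice_carrier[OF L] by (meson mult_mat_vec_carrier)

lemma comb_carrier: "ok bs \<Longrightarrow> comb bs \<in> carrier_vec (fst L)"
proof (induction bs)
  case (Cons b bs)
  obtain d s h where b: "b = (d, s, h)" by (cases b)
  have "h \<in> set group_list" "ok bs" using Cons.prems by (auto simp: ok_def b)
  then show ?case using Cons.IH act_carrier[OF E_in w] by (simp add: b)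
qed simp

lemma act_comb:
  assumes g: "g \<in> set group_list" and "ok bs" and r: "r < fst L"
  shows "(snd L (E g) *\<^sub>v comb bs) $ r = (\<Sum>(d, s, h)\<leftarrow>bs. d * \<Phi> r (key s (cmp g h)))"
  using assms(2)
proof (induction bs)
  case Nil
  show ?case using mult_zero_vec[OF G_lattice_carrier[OF L E_in[OF g]]] r by simp
next
  case (Cons b bs)
  obtain d s h where b: "b = (d, s, h)" by (cases b)
  have h: "h \<in> set group_list" and bs: "ok bs" using Cons.prems by (auto simp: ok_def b)
  note cg = G_lattice_carrier[OF L E_in[OF g]]
  have hw: "snd L (E h) *\<^sub>v w s \<in> carrier_vec (fst L)" by (rule act_carrier[OF E_in[OF h] w])
  have ghw: "snd L (E g) *\<^sub>v (snd L (E h) *\<^sub>v w s) \<in> carrier_vec (fst L)" by (rule act_carrier[OF E_in[OF g] hw])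
  have cb: "snd L (E g) *\<^sub>v comb bs \<in> carrier_vec (fst L)" by (rule act_carrier[OF E_in[OF g] comb_carrier[OF bs]])
  have smult: "snd L (E g) *\<^sub>v (d \<cdot>\<^sub>v (snd L (E h) *\<^sub>v w s)) = d \<cdot>\<^sub>v (snd L (E g) *\<^sub>v (snd L (E h) *\<^sub>v w s))"
  proof (rule eq_vecI)
    fix i assume "i < dim_vec (d \<cdot>\<^sub>v (snd L (E g) *\<^sub>v (snd L (E h) *\<^sub>v w s)))"
    then have i: "i < fst L" using carrier_vecD[OF ghw] by (simp del: dim_mult_mat_vec)
    have "row (snd L (E g)) i \<bullet> (d \<cdot>\<^sub>v (snd L (E h) *\<^sub>v w s)) = d * (row (snd L (E g)) i \<bullet> (snd L (E h) *\<^sub>v w s))"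
      by (rule scalar_prod_smult_distrib[OF row_carrier_vec[OF i cg] hw])
    then show "(snd L (E g) *\<^sub>v (d \<cdot>\<^sub>v (snd L (E h) *\<^sub>v w s))) $ i = (d \<cdot>\<^sub>v (snd L (E g) *\<^sub>v (snd L (E h) *\<^sub>v w s))) $ i"
      using i cg by simp
  qed simp
  have "snd L (E g) *\<^sub>v comb (b # bs) = d \<cdot>\<^sub>v (snd L (E g) *\<^sub>v (snd L (E h) *\<^sub>v w s)) + snd L (E g) *\<^sub>v comb bs"
    using mult_add_distrib_mat_vec[OF cg smult_carrier_vec[THEN iffD2, OF hw] comb_carrier[OF bs]] by (simp add: b smult)
  also have "\<dots> $ r = d * (snd L (E g) *\<^sub>v (snd L (E h) *\<^sub>v w s)) $ r + (snd L (E g) *\<^sub>v comb bs) $ r"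
    using r carrier_vecD[OF ghw] carrier_vecD[OF cb] by (simp del: index_mult_mat_vec dim_mult_mat_vec)
  also have "snd L (E g) *\<^sub>v (snd L (E h) *\<^sub>v w s) = snd L (E (cmp g h)) *\<^sub>v w s"
    using G_lattice_mult_vec[OF L E_in[OF g] E_in[OF h] w] E_cmp[OF g h] by simp
  also have "(snd L (E (cmp g h)) *\<^sub>v w s) $ r = \<Phi> r (key s (cmp g h))"
    using \<Phi>_key[OF E_in[OF cmp_in[OF g h]], of r s] \<pi>_E[OF cmp_in[OF g h]] by simp
  finally show ?case using Cons.IH[OF bs] by (simp add: b)
qed

lemma tree_sum_combs:
  assumes "ok bs" "\<forall>(c, g)\<in>set gs. g \<in> set group_list" "r < fst L"
  shows "tree_sum (\<Phi> r) (add_combs bs gs t) =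
    tree_sum (\<Phi> r) t + (\<Sum>(c, g)\<leftarrow>gs. c * (snd L (E g) *\<^sub>v comb bs) $ r)"
proof -
  have "(\<Sum>(c, g)\<leftarrow>gs. c * (\<Sum>(d, s, h)\<leftarrow>bs. d * \<Phi> r (key s (cmp g h)))) = (\<Sum>(c, g)\<leftarrow>gs. c * (snd L (E g) *\<^sub>v comb bs) $ r)"
    using assms(2) by (intro arg_cong[where f = sum_list] map_cong refl) (auto simp: act_comb[OF _ assms(1,3)])
  then show ?thesis unfolding tree_sum_add_combs by simp
qed

lemma comb_invariant:
  assumes bs: "ok bs" and p: "p \<in> set group_list" and z: "is_zero (add_combs bs [(1, p), (-1, idp)] zero_tree)"
  shows "snd L (E p) *\<^sub>v comb bs = comb bs"
proof (rule eq_vecI)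
  have one: "snd L (E idp) *\<^sub>v comb bs = comb bs"
    using L comb_carrier[OF bs] by (simp add: E_idp G_lattice_def)
  fix r assume "r < dim_vec (comb bs)"
  then have r: "r < fst L" using comb_carrier[OF bs] by simp
  have "0 = tree_sum (\<Phi> r) (add_combs bs [(1, p), (-1, idp)] zero_tree)" using tree_sum_zero[OF z] by simp
  also have "\<dots> = (snd L (E p) *\<^sub>v comb bs) $ r - comb bs $ r"
    using tree_sum_combs[OF bs _ r, of "[(1, p), (-1, idp)]"] p idp_in one tree_sum_zero_tree
    by (simp del: add_combs.simps index_mult_mat_vec)
  finally show "(snd L (E p) *\<^sub>v comb bs) $ r = comb bs $ r" by simp
qed (use carrier_vecD[OF act_carrier[OF E_in[OF p] comb_carrier[OF bs]]] carrier_vecD[OF comb_carrier[OF bs]] in \<open>simp del: dim_mult_mat_vec\<close>)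

lemma submodule_sum_list:
  assumes S: "int_submodule (fst L) S" and gs: "\<forall>(c, g)\<in>set gs. g \<in> set group_list"
    and b: "\<And>g. g \<in> carrier G \<Longrightarrow> snd L g *\<^sub>v b \<in> S"
  shows "vec (fst L) (\<lambda>r. \<Sum>(c, g)\<leftarrow>gs. c * (snd L (E g) *\<^sub>v b) $ r) \<in> S"
  using gs
proof (induction gs)
  case Nil
  have "vec (fst L) (\<lambda>r. \<Sum>(c, g)\<leftarrow>[]. c * (snd L (E g) *\<^sub>v b) $ r) = 0\<^sub>v (fst L)" by (intro eq_vecI) auto
  then show ?case using S by (simp add: int_submodule_def)
next
  case (Cons cg gs)
  obtain c g where cg: "cg = (c, g)" by (cases cg)
  have g: "snd L (E g) *\<^sub>v b \<in> S" using Cons.prems b by (simp add: cg)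
  then have "dim_vec (snd L (E g) *\<^sub>v b) = fst L" using S unfolding int_submodule_def by (meson carrier_vecD subsetD)
  then have "vec (fst L) (\<lambda>r. \<Sum>(c, g)\<leftarrow>cg # gs. c * (snd L (E g) *\<^sub>v b) $ r) =
     c \<cdot>\<^sub>v (snd L (E g) *\<^sub>v b) + vec (fst L) (\<lambda>r. \<Sum>(c, g)\<leftarrow>gs. c * (snd L (E g) *\<^sub>v b) $ r)"
    by (intro eq_vecI) (simp_all add: cg del: index_mult_mat_vec dim_mult_mat_vec)
  then show ?case using Cons g S by (simp add: int_submodule_def)
qed

text \<open>The vanishing table, paired with each coordinate in turn, writes the base vector as an
  integral combination of translates of the three vectors, all of which lie in S.\<close>

lemma w_in_submodule:
  assumes S: "int_submodule (fst L) S" and ok: "ok b0" "ok b1" "ok b2"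
    and gs: "\<forall>(c, g)\<in>set (r0 @ r1 @ r2). g \<in> set group_list"
    and in_S: "\<And>g. g \<in> carrier G \<Longrightarrow> snd L g *\<^sub>v comb b0 \<in> S" "\<And>g. g \<in> carrier G \<Longrightarrow> snd L g *\<^sub>v comb b1 \<in> S"
      "\<And>g. g \<in> carrier G \<Longrightarrow> snd L g *\<^sub>v comb b2 \<in> S"
    and z: "is_zero (add_combs b0 r0 (add_combs b1 r1 (add_combs b2 r2 (add_comb (-1) idp [(1, s, idp)] zero_tree))))"
  shows "w s \<in> S"
proof -
  define v where "v b gs = vec (fst L) (\<lambda>r. \<Sum>(c, g)\<leftarrow>gs. c * (snd L (E g) *\<^sub>v b) $ r)" for b and gs :: "(int \<times> perm) list"
  have g012: "\<forall>(c, g)\<in>set r0. g \<in> set group_list" "\<forall>(c, g)\<in>set r1. g \<in> set group_list" "\<forall>(c, g)\<in>set r2. g \<in> set group_list"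
    using gs by auto
  have vS: "v (comb b0) r0 \<in> S" "v (comb b1) r1 \<in> S" "v (comb b2) r2 \<in> S"
    unfolding v_def using submodule_sum_list[OF S] g012 in_S by auto
  have "w s = v (comb b0) r0 + (v (comb b1) r1 + v (comb b2) r2)"
  proof (rule eq_vecI)
    fix r assume "r < dim_vec (v (comb b0) r0 + (v (comb b1) r1 + v (comb b2) r2))"
    then have r: "r < fst L" by (simp add: v_def)
    have "\<Phi> r (key s idp) = (snd L \<one> *\<^sub>v w s) $ r" using \<Phi>_key[OF one_closed, of r s] by simp
    also have "\<dots> = w s $ r" using L w[of s] by (simp add: G_lattice_def)
    finally have id: "\<Phi> r (key s idp) = w s $ r" .
    have "0 = tree_sum (\<Phi> r) (add_combs b0 r0 (add_combs b1 r1 (add_combs b2 r2 (add_comb (-1) idp [(1, s, idp)] zero_tree))))"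
      using tree_sum_zero[OF z] by simp
    also have "\<dots> = v (comb b0) r0 $ r + v (comb b1) r1 $ r + v (comb b2) r2 $ r - w s $ r"
      unfolding tree_sum_combs[OF ok(1) g012(1) r] tree_sum_combs[OF ok(2) g012(2) r] tree_sum_combs[OF ok(3) g012(3) r]
        tree_sum_add_comb tree_sum_zero_tree
      using r id by (simp add: v_def del: key.simps index_mult_mat_vec)
    finally show "w s $ r = (v (comb b0) r0 + (v (comb b1) r1 + v (comb b2) r2)) $ r"
      using r by (simp add: v_def del: index_mult_mat_vec)
  qed (use w[of s] in \<open>simp add: v_def\<close>)
  then show ?thesis using vS S by (simp add: int_submodule_def)
qed

end

text \<open>Only the existence of a homomorphism hitting X is recorded, so a surjection from a
  direct sum can be assembled one summand at a time without naming its matrix.\<close>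

definition covers :: "('g, 'c) monoid_scheme \<Rightarrow> 'g lattice \<Rightarrow> 'g lattice \<Rightarrow> int vec set \<Rightarrow> bool" where
  "covers G L M X \<longleftrightarrow> (\<exists>A. G_hom G L M A \<and> X \<subseteq> {A *\<^sub>v z |z. z \<in> carrier_vec (fst L)})"

lemma covers_dsum:
  assumes G: "group G" and L: "G_lattice G L" and Ls: "G_lattice G (lat_dsum Ls)" and M: "G_lattice G M"
    and X: "covers G L M X" and Y: "covers G (lat_dsum Ls) M Y"
  shows "covers G (lat_dsum (L # Ls)) M (X \<union> Y)"
proof -
  obtain A B where A: "G_hom G L M A" "X \<subseteq> {A *\<^sub>v z |z. z \<in> carrier_vec (fst L)}"
    and B: "G_hom G (lat_dsum Ls) M B" "Y \<subseteq> {B *\<^sub>v z |z. z \<in> carrier_vec (fst (lat_dsum Ls))}"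
    using X Y unfolding covers_def by blast
  obtain C where C: "G_hom G (lat_dsum (L # Ls)) M C"
    "\<And>x y. x \<in> carrier_vec (fst L) \<Longrightarrow> y \<in> carrier_vec (fst (lat_dsum Ls)) \<Longrightarrow> C *\<^sub>v (x @\<^sub>v y) = A *\<^sub>v x + B *\<^sub>v y"
    using dsum_hom[OF G L Ls M A(1) B(1)] by blast
  have cA: "A \<in> carrier_mat (fst M) (fst L)" and cB: "B \<in> carrier_mat (fst M) (fst (lat_dsum Ls))"
    using A(1) B(1) by (auto simp: G_hom_def)
  have "X \<union> Y \<subseteq> {C *\<^sub>v z |z. z \<in> carrier_vec (fst (lat_dsum (L # Ls)))}"
  proof
    fix v assume "v \<in> X \<union> Y"
    then consider x where "x \<in> carrier_vec (fst L)" "v = A *\<^sub>v x" | y where "y \<in> carrier_vec (fst (lat_dsum Ls))" "v = B *\<^sub>v y"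
      using A(2) B(2) by blast
    then show "v \<in> {C *\<^sub>v z |z. z \<in> carrier_vec (fst (lat_dsum (L # Ls)))}"
    proof cases
      case 1
      have "A *\<^sub>v x \<in> carrier_vec (fst M)" using cA 1 by simp
      then have "C *\<^sub>v (x @\<^sub>v 0\<^sub>v (fst (lat_dsum Ls))) = v"
        using C(2)[OF 1(1) zero_carrier_vec] mult_zero_vec[OF cB] 1 by simp
      moreover have "x @\<^sub>v 0\<^sub>v (fst (lat_dsum Ls)) \<in> carrier_vec (fst (lat_dsum (L # Ls)))" using 1 by simp
      ultimately show ?thesis unfolding mem_Collect_eq by metis
    next
      case 2
      have "B *\<^sub>v y \<in> carrier_vec (fst M)" using cB 2 by simp
      then have "C *\<^sub>v (0\<^sub>v (fst L) @\<^sub>v y) = v"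
        using C(2)[OF zero_carrier_vec 2(1)] mult_zero_vec[OF cA] 2 by simp
      moreover have "0\<^sub>v (fst L) @\<^sub>v y \<in> carrier_vec (fst (lat_dsum (L # Ls)))" using 2 by simp
      ultimately show ?thesis unfolding mem_Collect_eq by metis
    qed
  qed
  then show ?thesis using C(1) unfolding covers_def by blast
qed

lemma covers_submodule:
  assumes "covers G L M X" and L: "G_lattice G L" and M: "G_lattice G M"
  obtains S A where "G_hom G L M A" "S = {A *\<^sub>v z |z. z \<in> carrier_vec (fst L)}" "int_submodule (fst M) S" "X \<subseteq> S"
    "\<And>g x. g \<in> carrier G \<Longrightarrow> x \<in> S \<Longrightarrow> snd M g *\<^sub>v x \<in> S"
proof -
  obtain A where A: "G_hom G L M A" "X \<subseteq> {A *\<^sub>v z |z. z \<in> carrier_vec (fst L)}"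
    using assms(1) unfolding covers_def by blast
  have cA: "A \<in> carrier_mat (fst M) (fst L)" using A(1) by (simp add: G_hom_def)
  have "snd M g *\<^sub>v x \<in> {A *\<^sub>v z |z. z \<in> carrier_vec (fst L)}"
    if g: "g \<in> carrier G" and x: "x \<in> {A *\<^sub>v z |z. z \<in> carrier_vec (fst L)}" for g x
  proof -
    obtain z where z: "z \<in> carrier_vec (fst L)" "x = A *\<^sub>v z" using x by blast
    have "snd M g *\<^sub>v x = A *\<^sub>v (snd L g *\<^sub>v z)" using G_hom_mult_vec[OF L M A(1) g z(1)] z(2) by simp
    moreover have "snd L g *\<^sub>v z \<in> carrier_vec (fst L)" using G_lattice_carrier[OF L g] z(1) by simp
    ultimately show ?thesis unfolding mem_Collect_eq by metis
  qed
  then show ?thesis using that[OF A(1) refl int_submodule_range[OF cA] A(2)] by blast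
qed

section \<open>Submodules and retracts of direct sums\<close>

lemma dsum_span:
  assumes S: "int_submodule (m + n) S" and x: "\<And>x. x \<in> carrier_vec m \<Longrightarrow> x @\<^sub>v 0\<^sub>v n \<in> S"
    and y: "\<And>y. y \<in> carrier_vec n \<Longrightarrow> 0\<^sub>v m @\<^sub>v y \<in> S"
  shows "S = carrier_vec (m + n)"
proof (rule int_submodule_eq_carrier[OF S])
  fix j assume "j < m + n"
  then show "unit_vec (m + n) j \<in> S" using x y by (simp add: unit_vec_append)
qed

lemma int_submodule_fst:
  assumes S: "int_submodule (m + n) S"
  shows "int_submodule m {x \<in> carrier_vec m. x @\<^sub>v 0\<^sub>v n \<in> S}"
proof -
  have s: "c \<cdot>\<^sub>v (x @\<^sub>v 0\<^sub>v n) = (c \<cdot>\<^sub>v x) @\<^sub>v 0\<^sub>v n" if "x \<in> carrier_vec m" for c :: int and x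
    using that by (intro eq_vecI) auto
  have a: "(x @\<^sub>v 0\<^sub>v n) + (y @\<^sub>v 0\<^sub>v n) = (x + y) @\<^sub>v 0\<^sub>v n" if "x \<in> carrier_vec m" "y \<in> carrier_vec m" for x y :: "int vec"
    using append_vec_add[OF that, of "0\<^sub>v n" n "0\<^sub>v n"] by simp
  have z: "0\<^sub>v m @\<^sub>v 0\<^sub>v n = (0\<^sub>v (m + n) :: int vec)" by (intro eq_vecI) auto
  show ?thesis using S unfolding int_submodule_def by (auto simp: z a[symmetric] s[symmetric])
qed

lemma int_submodule_snd:
  assumes S: "int_submodule (m + n) S"
  shows "int_submodule n {y \<in> carrier_vec n. 0\<^sub>v m @\<^sub>v y \<in> S}"
proof -
  have s: "c \<cdot>\<^sub>v (0\<^sub>v m @\<^sub>v y) = 0\<^sub>v m @\<^sub>v (c \<cdot>\<^sub>v y)" if "y \<in> carrier_vec n" for c :: int and y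
    using that by (intro eq_vecI) auto
  have a: "(0\<^sub>v m @\<^sub>v x) + (0\<^sub>v m @\<^sub>v y) = 0\<^sub>v m @\<^sub>v (x + y)" if "x \<in> carrier_vec n" "y \<in> carrier_vec n" for x y :: "int vec"
    using append_vec_add[of "0\<^sub>v m" m "0\<^sub>v m", OF _ _ that] by simp
  have z: "0\<^sub>v m @\<^sub>v 0\<^sub>v n = (0\<^sub>v (m + n) :: int vec)" by (intro eq_vecI) auto
  show ?thesis using S unfolding int_submodule_def by (auto simp: z a[symmetric] s[symmetric])
qed

lemma dsum_retract:
  assumes G: "group G" and L: "G_lattice G L" and Ls: "G_lattice G (lat_dsum Ls)"
  obtains I P where "G_hom G L (lat_dsum (L # Ls)) I" "G_hom G (lat_dsum (L # Ls)) L P" "P * I = 1\<^sub>m (fst L)"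
proof -
  let ?m = "fst L" and ?n = "fst (lat_dsum Ls)"
  note D = G_lattice_dsum_Cons[OF L Ls G]
  have 1: "G_hom G L L (1\<^sub>m ?m)" using G_lattice_carrier[OF L] by (simp add: G_hom_def) (metis left_mult_one_mat right_mult_one_mat)
  have 0: "G_hom G (lat_dsum Ls) L (0\<^sub>m ?m ?n)"
    unfolding G_hom_def 
    using G_lattice_carrier[OF L] G_lattice_carrier[OF Ls] by (auto simp: left_mult_zero_mat[of _ "fst (lat_dsum Ls)" "fst (lat_dsum Ls)"] right_mult_zero_mat[of _ "fst L" "fst L"])
  obtain P where P: "G_hom G (lat_dsum (L # Ls)) L P"
    "\<And>x y. x \<in> carrier_vec ?m \<Longrightarrow> y \<in> carrier_vec ?n \<Longrightarrow> P *\<^sub>v (x @\<^sub>v y) = 1\<^sub>m ?m *\<^sub>v x + 0\<^sub>m ?m ?n *\<^sub>v y"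
    using dsum_hom[OF G L Ls L 1 0] by blast
  have cP: "P \<in> carrier_mat ?m (?m + ?n)" using P(1) by (simp add: G_hom_def)
  define I :: "int mat" where "I = mat (?m + ?n) ?m (\<lambda>(i, j). if i = j then 1 else 0)"
  have cI: "I \<in> carrier_mat (?m + ?n) ?m" by (simp add: I_def)
  have I: "I *\<^sub>v x = x @\<^sub>v 0\<^sub>v ?n" if x: "x \<in> carrier_vec ?m" for x
  proof (rule eq_vecI)
    fix i assume "i < dim_vec (x @\<^sub>v 0\<^sub>v ?n)"
    then have i: "i < ?m + ?n" using x by simp
    have "(I *\<^sub>v x) $ i = (\<Sum>j<?m. I $$ (i, j) * x $ j)"
      using i x cI by (simp add: scalar_prod_def lessThan_atLeast0)
    also have "\<dots> = (\<Sum>j<?m. if j = i then x $ j else 0)"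
      using i by (intro sum.cong) (auto simp: I_def)
    finally show "(I *\<^sub>v x) $ i = (x @\<^sub>v 0\<^sub>v ?n) $ i" using i x by simp
  qed (use cI x in simp)
  have "G_hom G L (lat_dsum (L # Ls)) I"
    unfolding G_hom_iff_vec[OF L D]
  proof (intro conjI ballI)
    show "I \<in> carrier_mat (fst (lat_dsum (L # Ls))) ?m" using cI by simp
    fix g and x :: "int vec" assume g: "g \<in> carrier G" and x: "x \<in> carrier_vec ?m"
    have "snd L g *\<^sub>v x \<in> carrier_vec ?m" using G_lattice_carrier[OF L g] x by simp
    then show "I *\<^sub>v (snd L g *\<^sub>v x) = snd (lat_dsum (L # Ls)) g *\<^sub>v (I *\<^sub>v x)"
      using I x dsum_action[OF L Ls g x zero_carrier_vec] mult_zero_vec[OF G_lattice_carrier[OF Ls g]] by simp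
  qed
  moreover have "P * I = 1\<^sub>m ?m"
  proof (rule mat_eq_on_unit_vecs)
    show "P * I \<in> carrier_mat ?m ?m" using cP cI by simp
    fix j
    have "(P * I) *\<^sub>v unit_vec ?m j = P *\<^sub>v (unit_vec ?m j @\<^sub>v 0\<^sub>v ?n)"
      using assoc_mult_mat_vec[OF cP cI, of "unit_vec ?m j"] I by simp
    also have "\<dots> = 1\<^sub>m ?m *\<^sub>v unit_vec ?m j"
      using P(2)[of "unit_vec ?m j" "0\<^sub>v ?n"] mult_zero_vec[OF zero_carrier_mat[of ?m ?n]] by simp
    finally show "(P * I) *\<^sub>v unit_vec ?m j = 1\<^sub>m ?m *\<^sub>v unit_vec ?m j" .
  qed simp
  ultimately show ?thesis using that P(1) by blast
qed

text \<open>The direct sum is a retract of U through the isomorphism, and L is a retract of the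
  direct sum; flabbiness descends along both.\<close>

lemma flabby_dsum_head:
  assumes G: "group G" and L: "G_lattice G L" and Ls: "G_lattice G (lat_dsum Ls)" and U: "G_lattice G U" "flabby G U"
    and iso: "lat_iso G (lat_dsum (L # Ls)) U"
  shows "flabby G L"
proof -
  note D = G_lattice_dsum_Cons[OF L Ls G]
  obtain A B where A: "G_hom G (lat_dsum (L # Ls)) U A" and B: "B \<in> carrier_mat (fst (lat_dsum (L # Ls))) (fst U)"
    "A * B = 1\<^sub>m (fst U)" "B * A = 1\<^sub>m (fst (lat_dsum (L # Ls)))"
    using iso unfolding lat_iso_def by blast
  have hB: "G_hom G U (lat_dsum (L # Ls)) B" by (rule G_hom_inverse[OF D U(1) A B])
  have "flabby G (lat_dsum (L # Ls))" by (rule flabby_retract[OF U(2) D A hB B(3)])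
  moreover obtain I P where "G_hom G L (lat_dsum (L # Ls)) I" "G_hom G (lat_dsum (L # Ls)) L P" "P * I = 1\<^sub>m (fst L)"
    using dsum_retract[OF G L Ls] .
  ultimately show ?thesis using flabby_retract[OF _ L] by blast
qed

lemma perm_lattice_dsum:
  assumes G: "group G" "finite (carrier G)" and Hs: "\<And>H. H \<in> set Hs \<Longrightarrow> subgroup H G"
  shows "perm_lattice G (lat_dsum (map (coset_lattice G) Hs))"
proof -
  have "G_lattice G (lat_dsum (map (coset_lattice G) Hs))"
    by (rule G_lattice_dsum[OF G(1)]) (use group.G_lattice_coset[OF G] Hs in auto)
  then show ?thesis unfolding perm_lattice_def using lat_iso_refl Hs by blast
qed

text \<open>An equality and not merely an isomorphism, because a block with no rows and no columns
  adds nothing. One-element sums can thus be rewritten away.\<close>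

lemma lat_dsum_single: "lat_dsum [L] = L"
proof (rule prod_eqI)
  have "four_block_mat A (0\<^sub>m (dim_row A) 0) (0\<^sub>m 0 (dim_col A)) (0\<^sub>m 0 0) = A" for A :: "int mat"
    by (rule eq_matI) auto
  then show "snd (lat_dsum [L]) = snd L" by (simp add: lat_dsum_def fun_eq_iff Let_def)
qed simp

section \<open>The isomorphism\<close>

lemma rows_cols_check:
  "list_all (\<lambda>p. ap p P0 = P0) rows" "map (\<lambda>p. ap p P1) rows = tl pts"
  "list_all (\<lambda>p. ap p P1 = P0) cols" "map (\<lambda>p. ap p P0) cols = tl pts"
  by code_simp+

lemma in_tl_pts: "x \<noteq> P0 \<Longrightarrow> x \<in> set (tl pts)"
  by (cases x) (simp_all add: pts_def)

lemma tl_pts: "distinct (tl pts)" "length (tl pts) = 8" "P0 \<notin> set (tl pts)"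
  by (simp_all add: pts_def)

lemma rows_cols_in: "p \<in> set rows \<Longrightarrow> p \<in> set group_list" "p \<in> set cols \<Longrightarrow> p \<in> set group_list"
  using certificate_in_group(3) in_group_list by (auto simp: list_all_iff)

lemma certificate_ok: "ok B0" "ok B1" "ok B2"
  using certificate_in_group(1) in_group_list by (simp_all add: ok_def list_all_iff case_prod_beta)

lemma certificate_gs:
  "\<forall>(c, g)\<in>set (R00 @ R01 @ R02). g \<in> set group_list"
  "\<forall>(c, g)\<in>set (R10 @ R11 @ R12). g \<in> set group_list"
  "\<forall>(c, g)\<in>set (R20 @ R21 @ R22). g \<in> set group_list"
  using certificate_in_group(2) in_group_list by (simp_all add: list_all_iff case_prod_beta ball_Un)

lemma other_points: obtains c d :: pt where "c \<noteq> u" "c \<noteq> v" "d \<noteq> u" "d \<noteq> v" "c \<noteq> d"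
proof -
  have "\<exists>c d :: pt. c \<noteq> u \<and> c \<noteq> v \<and> d \<noteq> u \<and> d \<noteq> v \<and> c \<noteq> d"
  proof (cases "P0 \<in> {u, v}")
    case True
    then consider "P1 \<notin> {u, v}" "P2 \<notin> {u, v}" | "P1 \<notin> {u, v}" "P3 \<notin> {u, v}" | "P2 \<notin> {u, v}" "P3 \<notin> {u, v}" by auto
    then show ?thesis by cases auto
  next
    case False
    then consider "P1 \<notin> {u, v}" | "P2 \<notin> {u, v}" | "P3 \<notin> {u, v}" by auto
    then show ?thesis using False by cases auto
  qed
  then show ?thesis using that by blast
qed

lemma (in group) dsum_span_coset:
  assumes fin: "finite (carrier G)" and K: "subgroup K G" and S: "int_submodule (card (lcosets K) + n) S"
    and x: "\<And>x. x \<in> carrier G \<Longrightarrow> coset_vec G K (x <# K) @\<^sub>v 0\<^sub>v n \<in> S"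
    and y: "\<And>y. y \<in> carrier_vec n \<Longrightarrow> 0\<^sub>v (card (lcosets K)) @\<^sub>v y \<in> S"
  shows "S = carrier_vec (card (lcosets K) + n)"
proof (rule dsum_span[OF S _ y])
  have "{x \<in> carrier_vec (card (lcosets K)). x @\<^sub>v 0\<^sub>v n \<in> S} = carrier_vec (card (lcosets K))"
    by (rule coset_lattice_span[OF fin K int_submodule_fst[OF S]]) (simp add: x)
  then show "x @\<^sub>v 0\<^sub>v n \<in> S" if "x \<in> carrier_vec (card (lcosets K))" for x using that by blast
qed

text \<open>The vector b is fixed by the conjugate y K y^-1, so its translate by y^-1 is fixed by K
  and has the same orbit. Invariance under a standard subgroup is thereby transferred to the given
  one.\<close>

lemma (in group) covers_coset:
  assumes fin: "finite (carrier G)" and K: "subgroup K G" and y: "y \<in> carrier G" and M: "G_lattice G M"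
    and b: "b \<in> carrier_vec (fst M)"
    and inv: "\<And>x. x \<in> carrier G \<Longrightarrow> inv y \<otimes> x \<otimes> y \<in> K \<Longrightarrow> snd M x *\<^sub>v b = b"
  shows "covers G (coset_lattice G K) M {snd M g *\<^sub>v b |g. g \<in> carrier G}"
proof -
  let ?v = "snd M (inv y) *\<^sub>v b"
  have v: "?v \<in> carrier_vec (fst M)" using G_lattice_carrier[OF M, of "inv y"] y b by simp
  have "snd M k *\<^sub>v ?v = ?v" if k: "k \<in> K" for k
  proof -
    have kc: "k \<in> carrier G" using k subgroup.subset[OF K] by blast
    let ?x = "y \<otimes> k \<otimes> inv y"
    have x: "?x \<in> carrier G" using y kc by simp
    have 1: "inv y \<otimes> ?x = k \<otimes> inv y" using y kc by (metis inv_closed m_assoc m_closed l_inv l_one)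
    have "inv y \<otimes> ?x \<otimes> y = k" unfolding 1 using y kc by (simp add: m_assoc)
    then have "snd M ?x *\<^sub>v b = b" using inv[OF x] k by simp
    then have "?v = snd M (inv y \<otimes> ?x) *\<^sub>v b" using G_lattice_mult_vec[OF M inv_closed[OF y] x b] by simp
    also have "\<dots> = snd M k *\<^sub>v ?v" unfolding 1 by (rule G_lattice_mult_vec[OF M kc inv_closed[OF y] b])
    finally show ?thesis by simp
  qed
  then obtain A where A: "G_hom G (coset_lattice G K) M A"
    "\<And>x. x \<in> carrier G \<Longrightarrow> A *\<^sub>v coset_vec G K (x <# K) = snd M x *\<^sub>v ?v"
    using coset_hom[OF fin K M v] by blast
  have "\<exists>z\<in>carrier_vec (fst (coset_lattice G K)). snd M g *\<^sub>v b = A *\<^sub>v z" if g: "g \<in> carrier G" for g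
  proof (rule bexI)
    have "A *\<^sub>v coset_vec G K ((g \<otimes> y) <# K) = snd M (g \<otimes> y \<otimes> inv y) *\<^sub>v b"
      using A(2)[of "g \<otimes> y"] G_lattice_mult_vec[OF M, of "g \<otimes> y" "inv y" b] g y b by simp
    then show "snd M g *\<^sub>v b = A *\<^sub>v coset_vec G K ((g \<otimes> y) <# K)" using g y by (simp add: m_assoc)
  qed simp
  then show ?thesis using A(1) unfolding covers_def by blast
qed

section \<open>The Sylow normalizer, and points as cosets\<close>

context psl28
begin

lemma fixator_subgroup: "subgroup {x \<in> carrier G. \<forall>u\<in>A. ap (\<pi> x) u = u} G"
proof (rule subgroupI)
  show "{x \<in> carrier G. \<forall>u\<in>A. ap (\<pi> x) u = u} \<noteq> {}" by (auto intro!: exI[of _ \<one>])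
qed (auto simp: \<pi>_mult ap_inv_eq)

text \<open>S has order 8 and all its elements have square one, so S is abelian. A nontrivial
  element s of S has a single fixed point q, which everything commuting with s must fix. There are
  exactly eight elements of square one that fix q; so they form S, and the normalizer is the
  stabilizer of q.\<close>

lemma sylow_normalizer:
  assumes S: "sylow_subgroup G 2 S"
  obtains q where "normalizer G S = {x \<in> carrier G. ap (\<pi> x) q = q}"
proof -
  have SG: "subgroup S G" using S by (simp add: sylow_subgroup_def)
  obtain a where a: "card S = 2 ^ a" and dvd: "2 ^ a dvd (504 :: nat)" and ndvd: "\<not> 2 dvd (504 :: nat) div 2 ^ a"
    using S order by (auto simp: sylow_subgroup_def Coset.order_def)
  have "a < 4"
  proof (rule ccontr)
    assume "\<not> a < 4"
    then have "(2 :: nat) ^ 4 dvd 2 ^ a" by (intro le_imp_power_dvd) simp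
    then have "(2 :: nat) ^ 4 dvd 504" using dvd by (rule dvd_trans)
    then show False by simp
  qed
  then have "a = 0 \<or> a = 1 \<or> a = 2 \<or> a = 3" by auto
  then have "a = 3" using ndvd by auto
  then have card: "card S = 8" using a by simp
  have finS: "finite S" using card by (auto intro: card_ge_0_finite)
  have sub: "S \<subseteq> carrier G" by (rule subgroup.subset[OF SG])
  have p2: "pow 2 p = cmp p p" for p by (simp add: numeral_2_eq_2)
  have el: "\<pi> x = idp \<or> length (fixpts (\<pi> x)) = 1 \<and> pow 2 (\<pi> x) = idp" if x: "x \<in> S" for x
  proof -
    have xG: "x \<in> carrier G" using x sub by blast
    interpret Sg: group "G\<lparr>carrier := S\<rparr>" by (rule subgroup.subgroup_is_group[OF SG]) (rule is_group)
    have "x [^]\<^bsub>G\<lparr>carrier := S\<rparr>\<^esub> (8 :: nat) = \<one>" using Sg.pow_order_eq_1[of x] x card by (simp add: Coset.order_def)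
    then have "x [^] (8 :: nat) = \<one>" using nat_pow_consistent[of x "8 :: nat" S] by simp
    then have "pow 8 (\<pi> x) = idp" using \<pi>_pow[OF xG, of 8] by simp
    then show ?thesis using group_listD(4)[OF \<pi>_in[OF xG]] by blast
  qed
  have sq: "pow 2 (\<pi> x) = idp" if "x \<in> S" for x using el[OF that] by (auto simp: p2)
  have sq': "x \<otimes> x = \<one>" if "x \<in> S" for x
    using sq[OF that] that sub \<pi>_eq[of "x \<otimes> x" \<one>] by (auto simp: p2 \<pi>_mult)
  have comm: "x \<otimes> y = y \<otimes> x" if x: "x \<in> S" and y: "y \<in> S" for x y
  proof -
    have xy: "x \<otimes> y \<in> S" "x \<in> carrier G" "y \<in> carrier G" using subgroup.m_closed[OF SG x y] x y sub by auto
    have i: "inv z = z" if "z \<in> S" for z using inv_equality[OF sq'[OF that]] that sub by blast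
    show ?thesis using inv_mult_group[OF xy(2,3)] i x y xy(1) by simp
  qed
  obtain s where s: "s \<in> S" "s \<noteq> \<one>"
  proof -
    have "\<not> S \<subseteq> {\<one>}" using card card_mono[of "{\<one>}" S] by auto
    then show ?thesis using that by blast
  qed
  have sG: "s \<in> carrier G" using s sub by blast
  have "\<pi> s \<noteq> idp" using s sG \<pi>_eq[of s \<one>] by simp
  then have "length (fixpts (\<pi> s)) = 1" using el[OF s(1)] by blast
  then obtain q where "fixpts (\<pi> s) = [q]" by (cases "fixpts (\<pi> s)") auto
  then have q: "ap (\<pi> s) x = x \<longleftrightarrow> x = q" for x using fixpts_iff[of x "\<pi> s"] by simp
  let ?V = "{x \<in> carrier G. ap (\<pi> x) q = q \<and> pow 2 (\<pi> x) = idp}"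
  have "S \<subseteq> ?V"
  proof
    fix x assume x: "x \<in> S"
    have xG: "x \<in> carrier G" using x sub by blast
    have "ap (\<pi> s) (ap (\<pi> x) q) = ap (\<pi> x) (ap (\<pi> s) q)"
      using arg_cong[OF comm[OF s(1) x], of "\<lambda>z. ap (\<pi> z) q"] by (simp add: \<pi>_mult xG sG)
    also have "ap (\<pi> s) q = q" using q by blast
    finally have "ap (\<pi> x) q = q" using q by blast
    then show "x \<in> ?V" using xG sq[OF x] by blast
  qed
  moreover have "card ?V = 8"
    using card_sub[of "\<lambda>p. ap p q = q \<and> pow 2 p = idp"] unipotent_check by (simp add: list_all_iff)
  ultimately have SV: "S = ?V" using card card_subset_eq[of ?V S] fin by simp
  have V: "x \<in> S \<longleftrightarrow> x \<in> carrier G \<and> ap (\<pi> x) q = q \<and> (\<forall>u. ap (\<pi> x) (ap (\<pi> x) u) = u)" for x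
  proof -
    have "pow 2 (\<pi> x) = idp \<longleftrightarrow> (\<forall>u. ap (\<pi> x) (ap (\<pi> x) u) = u)"
    proof
      assume "pow 2 (\<pi> x) = idp"
      then show "\<forall>u. ap (\<pi> x) (ap (\<pi> x) u) = u" unfolding p2 by (simp flip: ap_cmp)
    next
      assume "\<forall>u. ap (\<pi> x) (ap (\<pi> x) u) = u"
      then show "pow 2 (\<pi> x) = idp" unfolding p2 by (intro perm_eqI) simp
    qed
    then show ?thesis unfolding SV by blast
  qed
  have conj: "x \<otimes> u \<otimes> inv x \<in> S" if "x \<in> carrier G" "ap (\<pi> x) q = q" "u \<in> S" for x u
  proof -
    have "ap (\<pi> (inv x)) q = q" using that ap_inv_eq[of x q q] by simp
    then show ?thesis using that unfolding V by (auto simp: \<pi>_mult)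
  qed
  have "x <# S #> inv x = S \<longleftrightarrow> ap (\<pi> x) q = q" if x: "x \<in> carrier G" for x
  proof
    assume e: "x <# S #> inv x = S"
    \<comment> \<open>The conjugate of s lies in S and fixes q, so s fixes the image of q under
      x^-1, which is then its only fixed point q.\<close>
    have "x \<otimes> s \<otimes> inv x \<in> x <# S #> inv x" using s(1) unfolding l_coset_def r_coset_def by blast
    then have "x \<otimes> s \<otimes> inv x \<in> S" by (simp only: e)
    then have "ap (\<pi> (x \<otimes> s \<otimes> inv x)) q = q" unfolding V by blast
    then have "ap (\<pi> x) (ap (\<pi> s) (ap (\<pi> (inv x)) q)) = q" using x sG by (simp add: \<pi>_mult)
    then have "ap (\<pi> s) (ap (\<pi> (inv x)) q) = ap (\<pi> (inv x)) q"
      using ap_inv_eq[OF x, of q "ap (\<pi> s) (ap (\<pi> (inv x)) q)"] by simp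
    then show "ap (\<pi> x) q = q" using q x by (simp add: ap_inv_eq)
  next
    assume xq: "ap (\<pi> x) q = q"
    show "x <# S #> inv x = S"
    proof
      show "x <# S #> inv x \<subseteq> S" using conj[OF x xq] by (auto simp: l_coset_def r_coset_def)
      show "S \<subseteq> x <# S #> inv x"
      proof
        fix u assume u: "u \<in> S"
        have uG: "u \<in> carrier G" using u sub by blast
        have "inv x \<otimes> u \<otimes> inv (inv x) \<in> S" by (rule conj) (use x xq u in \<open>simp_all add: ap_inv_eq\<close>)
        moreover have "u = x \<otimes> (inv x \<otimes> u \<otimes> inv (inv x)) \<otimes> inv x" using x uG by (simp add: m_assoc)
        ultimately show "u \<in> x <# S #> inv x" unfolding l_coset_def r_coset_def by blast
      qed
    qed
  qed
  then have "normalizer G S = {x \<in> carrier G. ap (\<pi> x) q = q}"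
    using sub unfolding normalizer_def stabilizer_def by auto
  then show ?thesis by (rule that)
qed

context
  fixes q H assumes H: "H = {x \<in> carrier G. ap (\<pi> x) q = q}"
begin

lemma point_stabilizer: "subgroup H G"
  using fixator_subgroup[of "{q}"] by (simp add: H)

lemma point_coset_eq:
  assumes z: "z \<in> carrier G" and w: "w \<in> carrier G"
  shows "z <# H = w <# H \<longleftrightarrow> ap (\<pi> z) q = ap (\<pi> w) q"
proof -
  have "inv z \<otimes> w \<in> H \<longleftrightarrow> ap (\<pi> (inv z)) (ap (\<pi> w) q) = q" using z w by (simp add: H \<pi>_mult)
  then show ?thesis using lcos_eq_iff[OF point_stabilizer z w] ap_inv_eq[OF z, of "ap (\<pi> w) q" q] by auto
qed

lemma point_coset_move:
  assumes "x \<in> carrier G" "z \<in> carrier G"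
  shows "x <# (z <# H) = (x \<otimes> z) <# H"
  using lcos_m_assoc[OF subgroup.subset[OF point_stabilizer] assms] .

text \<open>The coset of z corresponds to the point z q. The list \<open>tl pts\<close> contains
  every point except 0, and a H is the coset that belongs to 0.\<close>

lemma point_coset_bij:
  assumes a: "a \<in> carrier G" "ap (\<pi> a) q = P0" and c: "c \<in> carrier G"
    and xs: "set xs \<subseteq> carrier G" "map (\<lambda>x. ap (\<pi> x) (ap (\<pi> c) q)) xs = tl pts"
  shows "bij_betw (\<lambda>x. x <# (c <# H)) (set xs) (lcosets H - {a <# H})"
proof -
  let ?u = "ap (\<pi> c) q"
  have d: "distinct (map (\<lambda>x. ap (\<pi> x) ?u) xs)" unfolding xs(2) by (rule tl_pts(1))
  have eq: "x <# (c <# H) = w <# H \<longleftrightarrow> ap (\<pi> x) ?u = ap (\<pi> w) q" if "x \<in> set xs" "w \<in> carrier G" for x w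
  proof -
    have x: "x \<in> carrier G" using that(1) xs(1) by blast
    show ?thesis using point_coset_eq[of "x \<otimes> c" w] x c that(2) by (simp add: point_coset_move \<pi>_mult)
  qed
  show ?thesis unfolding bij_betw_def
  proof
    show "inj_on (\<lambda>x. x <# (c <# H)) (set xs)"
    proof (rule inj_onI)
      fix x x' assume x: "x \<in> set xs" "x' \<in> set xs" "x <# (c <# H) = x' <# (c <# H)"
      then have x': "x' \<in> carrier G" using xs(1) by blast
      have "x <# (c <# H) = (x' \<otimes> c) <# H" using x(3) point_coset_move[OF x' c] by simp
      then have "ap (\<pi> x) ?u = ap (\<pi> x') ?u" using eq[OF x(1), of "x' \<otimes> c"] x' c by (simp add: \<pi>_mult)
      then show "x = x'" using d x(1,2) by (auto simp: distinct_map dest: inj_onD)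
    qed
    show "(\<lambda>x. x <# (c <# H)) ` set xs = lcosets H - {a <# H}"
    proof
      show "(\<lambda>x. x <# (c <# H)) ` set xs \<subseteq> lcosets H - {a <# H}"
      proof
        fix C assume "C \<in> (\<lambda>x. x <# (c <# H)) ` set xs"
        then obtain x where x: "x \<in> set xs" "C = x <# (c <# H)" by blast
        have xG: "x \<in> carrier G" using x(1) xs(1) by blast
        have "ap (\<pi> x) ?u \<in> set (map (\<lambda>x. ap (\<pi> x) ?u) xs)" using x(1) by simp
        then have "ap (\<pi> x) ?u \<noteq> P0" unfolding xs(2) using tl_pts(3) by metis
        then have "C \<noteq> a <# H" using eq[OF x(1) a(1)] a(2) x(2) by simp
        moreover have "C \<in> lcosets H" unfolding lcosets_iff x(2) point_coset_move[OF xG c] using xG c by blast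
        ultimately show "C \<in> lcosets H - {a <# H}" by blast
      qed
      show "lcosets H - {a <# H} \<subseteq> (\<lambda>x. x <# (c <# H)) ` set xs"
      proof
        fix C assume C: "C \<in> lcosets H - {a <# H}"
        then obtain z where z: "z \<in> carrier G" "C = z <# H" using lcosets_iff by blast
        have "ap (\<pi> z) q \<noteq> P0" using C point_coset_eq[OF z(1) a(1)] z(2) a(2) by auto
        then have "ap (\<pi> z) q \<in> set (map (\<lambda>x. ap (\<pi> x) ?u) xs)" unfolding xs(2) by (rule in_tl_pts)
        then obtain x where "x \<in> set xs" "ap (\<pi> x) ?u = ap (\<pi> z) q" by auto
        then show "C \<in> (\<lambda>x. x <# (c <# H)) ` set xs" using eq[of x z] z by blast
      qed
    qed
  qed
qed

text \<open>Double transitivity follows from triple transitivity with an arbitrary third point c as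
  the image of infinity.\<close>

lemma point_coset_transitive:
  assumes a: "a \<in> carrier G" "ap (\<pi> a) q = P0" and b: "b \<in> carrier G" "ap (\<pi> b) q = P1"
    and A: "A \<in> lcosets H" and B: "B \<in> lcosets H" and AB: "A \<noteq> B"
  shows "\<exists>x\<in>carrier G. A = x <# (a <# H) \<and> B = x <# (b <# H)"
proof -
  obtain z where z: "z \<in> carrier G" "A = z <# H" using A unfolding lcosets_iff by (elim bexE) (rule that)
  obtain w where w: "w \<in> carrier G" "B = w <# H" using B unfolding lcosets_iff by (elim bexE) (rule that)
  have ne: "ap (\<pi> z) q \<noteq> ap (\<pi> w) q" using AB point_coset_eq[OF z(1) w(1)] z(2) w(2) by simp
  obtain c where c: "c \<noteq> ap (\<pi> z) q" "c \<noteq> ap (\<pi> w) q"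
    by (rule other_points[of "ap (\<pi> z) q" "ap (\<pi> w) q"]) (rule that, assumption+)
  obtain x where x: "x \<in> carrier G" "ap (\<pi> x) P0 = ap (\<pi> z) q" "ap (\<pi> x) P1 = ap (\<pi> w) q"
    by (rule triple_ex[OF ne c[symmetric]]) (rule that, assumption+)
  have "A = (x \<otimes> a) <# H" using point_coset_eq[of z "x \<otimes> a"] x a z by (simp add: \<pi>_mult)
  moreover have "B = (x \<otimes> b) <# H" using point_coset_eq[of w "x \<otimes> b"] x b w by (simp add: \<pi>_mult)
  ultimately show ?thesis using x(1) point_coset_move[OF x(1) a(1)] point_coset_move[OF x(1) b(1)] by (intro bexI[of _ x]) simp_all
qed

lemma point_representatives:
  obtains a b where "a \<in> carrier G" "ap (\<pi> a) q = P0" "b \<in> carrier G" "ap (\<pi> b) q = P1"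
proof -
  obtain c d where cd: "c \<noteq> q" "d \<noteq> q" "c \<noteq> d" by (rule other_points[of q q]) (rule that, assumption+)
  obtain g where g: "g \<in> carrier G" "ap (\<pi> g) P0 = q"
    by (rule triple_ex[OF cd(1)[symmetric] cd(2)[symmetric] cd(3)]) (rule that, assumption+)
  obtain h where h: "h \<in> carrier G" "ap (\<pi> h) P1 = q"
    by (rule triple_ex[OF cd(1) cd(3) cd(2)[symmetric]]) (rule that, assumption+)
  show ?thesis by (rule that[of "inv g" "inv h"]) (use g h in \<open>simp_all add: ap_inv_eq\<close>)
qed

end

section \<open>The lattice U and the surjections onto it\<close>

context
  fixes K :: "ty \<Rightarrow> 'a set" and y :: "ty \<Rightarrow> 'a"
  assumes K: "\<And>s. subgroup (K s) G" and y: "\<And>s. y s \<in> carrier G"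
    and stab_conj: "\<And>s x. x \<in> carrier G \<Longrightarrow> stab s (\<pi> x) \<Longrightarrow> inv (y s) \<otimes> x \<otimes> y s \<in> K s"
begin

abbreviation "CL s \<equiv> coset_lattice G (K s)"
abbreviation "rk s \<equiv> card (lcosets (K s))"
abbreviation "U \<equiv> lat_dsum [CL T0, CL T1, CL T2]"

definition emb :: "ty \<Rightarrow> int vec \<Rightarrow> int vec" where
  "emb s v = (case s of T0 \<Rightarrow> v @\<^sub>v 0\<^sub>v (rk T1 + rk T2)
     | T1 \<Rightarrow> 0\<^sub>v (rk T0) @\<^sub>v (v @\<^sub>v 0\<^sub>v (rk T2))
     | T2 \<Rightarrow> 0\<^sub>v (rk T0) @\<^sub>v (0\<^sub>v (rk T1) @\<^sub>v v))"

text \<open>The base coset of type s is realized by the coset of \<open>y s\<close> and not by K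
  itself: the stabilizer of that coset is the conjugate of K by \<open>y s\<close>, which contains
  the standard group \<open>stab s\<close>.\<close>

definition gen :: "ty \<Rightarrow> int vec" where
  "gen s = emb s (coset_vec G (K s) (y s <# K s))"

lemma CL: "G_lattice G (CL s)" by (rule G_lattice_coset[OF fin K])

lemma tails: "G_lattice G (lat_dsum [CL T1, CL T2])" "G_lattice G U" "G_lattice G (lat_dsum [CL T2])"
  by (rule G_lattice_dsum[OF is_group]; use CL in force)+

lemma emb_carrier: "v \<in> carrier_vec (rk s) \<Longrightarrow> emb s v \<in> carrier_vec (fst U)"
  unfolding emb_def by (cases s) simp_all

lemma emb_action:
  assumes g: "g \<in> carrier G" and v: "v \<in> carrier_vec (rk s)"
  shows "snd U g *\<^sub>v emb s v = emb s (snd (CL s) g *\<^sub>v v)"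
proof -
  have z: "snd (CL t) g *\<^sub>v 0\<^sub>v (rk t) = 0\<^sub>v (rk t)" for t
    using mult_zero_vec[OF G_lattice_carrier[OF CL g]] by simp
  have z1: "snd (lat_dsum [CL T1, CL T2]) g *\<^sub>v 0\<^sub>v (rk T1 + rk T2) = 0\<^sub>v (rk T1 + rk T2)"
    using mult_zero_vec[OF G_lattice_carrier[OF tails(1) g]] by simp
  note a = dsum_action[OF CL tails(1) g] dsum_action[OF CL tails(3) g, unfolded lat_dsum_single]
  show ?thesis
  proof (cases s)
    case T0
    then show ?thesis using v a(1)[of v T0 "0\<^sub>v (rk T1 + rk T2)"] z1 by (simp add: emb_def)
  next
    case T1
    then show ?thesis using v a(1)[of "0\<^sub>v (rk T0)" T0 "v @\<^sub>v 0\<^sub>v (rk T2)"] a(2)[of v T1 "0\<^sub>v (rk T2)"] z by (simp add: emb_def)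
  next
    case T2
    then show ?thesis using v a(1)[of "0\<^sub>v (rk T0)" T0 "0\<^sub>v (rk T1) @\<^sub>v v"] a(2)[of "0\<^sub>v (rk T1)" T1 v] z by (simp add: emb_def)
  qed
qed

lemma gen_carrier: "gen s \<in> carrier_vec (fst U)"
  unfolding gen_def by (rule emb_carrier) simp

lemma gen_action:
  assumes g: "g \<in> carrier G"
  shows "snd U g *\<^sub>v gen s = emb s (coset_vec G (K s) ((g \<otimes> y s) <# K s))"
proof -
  have C: "y s <# K s \<in> lcosets (K s)" unfolding lcosets_iff using y by blast
  have "g <# (y s <# K s) = (g \<otimes> y s) <# K s" by (rule lcos_m_assoc[OF subgroup.subset[OF K] g y])
  then show ?thesis
    unfolding gen_def emb_action[OF g coset_vec_carrier] coset_lattice_action[OF fin K g C] by simp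
qed

lemma gen_stab:
  assumes x: "x \<in> carrier G" and "stab s (\<pi> x)"
  shows "snd U x *\<^sub>v gen s = gen s"
proof -
  have "inv (y s) \<otimes> (x \<otimes> y s) \<in> K s" using stab_conj[OF assms] x y by (simp add: m_assoc)
  then have "y s <# K s = (x \<otimes> y s) <# K s" using lcos_eq_iff[OF K y, of "x \<otimes> y s" s] x y by simp
  then show ?thesis unfolding gen_action[OF x] by (simp add: gen_def)
qed

interpretation formal_sums G \<pi> U gen
  by unfold_locales (fact tails(2) gen_carrier gen_stab)+

text \<open>The translates of \<open>gen s\<close> are all basis vectors of summand s. The last
  summand is treated first, in keeping with the right-nested direct sum.\<close>

lemma gen_span:
  assumes S: "int_submodule (fst U) S" and gen: "\<And>s. gen s \<in> S"
    and stable: "\<And>g x. g \<in> carrier G \<Longrightarrow> x \<in> S \<Longrightarrow> snd U g *\<^sub>v x \<in> S"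
  shows "S = carrier_vec (fst U)"
proof -
  have e: "emb s (coset_vec G (K s) (x <# K s)) \<in> S" if x: "x \<in> carrier G" for s x
  proof -
    have g: "x \<otimes> inv (y s) \<in> carrier G" using x y by simp
    have "x \<otimes> inv (y s) \<otimes> y s = x" using x y by (simp add: m_assoc)
    then show ?thesis using stable[OF g gen[of s]] unfolding gen_action[OF g] by simp
  qed
  have e0: "coset_vec G (K T0) (x <# K T0) @\<^sub>v 0\<^sub>v (rk T1 + rk T2) \<in> S" if "x \<in> carrier G" for x
    using e[OF that, of T0] by (simp add: emb_def)
  have S0: "int_submodule (rk T0 + (rk T1 + rk T2)) S" using S by simp
  note S1 = int_submodule_snd[OF S0]
  note S2 = int_submodule_snd[OF S1]
  have "{z \<in> carrier_vec (rk T2). 0\<^sub>v (rk T1) @\<^sub>v z \<in> {y \<in> carrier_vec (rk T1 + rk T2). 0\<^sub>v (rk T0) @\<^sub>v y \<in> S}}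
    = carrier_vec (rk T2)"
  proof (rule coset_lattice_span[OF fin K S2])
    fix x assume x: "x \<in> carrier G"
    show "coset_vec G (K T2) (x <# K T2) \<in> {z \<in> carrier_vec (rk T2). 0\<^sub>v (rk T1) @\<^sub>v z \<in> {y \<in> carrier_vec (rk T1 + rk T2). 0\<^sub>v (rk T0) @\<^sub>v y \<in> S}}"
      using e[OF x, of T2] unfolding mem_Collect_eq emb_def ty.case
      by (intro conjI append_carrier_vec coset_vec_carrier zero_carrier_vec)
  qed
  then have z2: "0\<^sub>v (rk T1) @\<^sub>v z \<in> {y \<in> carrier_vec (rk T1 + rk T2). 0\<^sub>v (rk T0) @\<^sub>v y \<in> S}" if "z \<in> carrier_vec (rk T2)" for z
    using that by blast
  have "{y \<in> carrier_vec (rk T1 + rk T2). 0\<^sub>v (rk T0) @\<^sub>v y \<in> S} = carrier_vec (rk T1 + rk T2)"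
  proof (rule dsum_span_coset[OF fin K S1 _ z2])
    fix x assume x: "x \<in> carrier G"
    show "coset_vec G (K T1) (x <# K T1) @\<^sub>v 0\<^sub>v (rk T2) \<in> {y \<in> carrier_vec (rk T1 + rk T2). 0\<^sub>v (rk T0) @\<^sub>v y \<in> S}"
      using e[OF x, of T1] unfolding mem_Collect_eq emb_def ty.case
      by (intro conjI append_carrier_vec coset_vec_carrier zero_carrier_vec)
  qed
  then have z1: "0\<^sub>v (rk T0) @\<^sub>v z \<in> S" if "z \<in> carrier_vec (rk T1 + rk T2)" for z
    using that by blast
  show ?thesis using dsum_span_coset[OF fin K S0 e0 z1] by simp
qed

abbreviation "Orb bs \<equiv> {snd U g *\<^sub>v comb bs |g. g \<in> carrier G}"

text \<open>The image is a stable submodule that contains the orbits of \<open>B0\<close>,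
  \<open>B1\<close>, \<open>B2\<close>, hence the base cosets, hence everything; equality of ranks
  does the rest. The order of the summands of L is left open, as two different orders occur
  below.\<close>

lemma iso_of_covers:
  assumes L: "G_lattice G L" and rank: "fst L = fst U" and cov: "covers G L U X"
    and X: "Orb B0 \<subseteq> X" "Orb B1 \<subseteq> X" "Orb B2 \<subseteq> X"
  shows "lat_iso G L U"
proof -
  obtain S A where A: "G_hom G L U A" "S = {A *\<^sub>v z |z. z \<in> carrier_vec (fst L)}" "int_submodule (fst U) S" "X \<subseteq> S"
    "\<And>g x. g \<in> carrier G \<Longrightarrow> x \<in> S \<Longrightarrow> snd U g *\<^sub>v x \<in> S"
    by (rule covers_submodule[OF cov L tails(2)]) (rule that, assumption+)
  have o: "snd U g *\<^sub>v comb B0 \<in> S" "snd U g *\<^sub>v comb B1 \<in> S" "snd U g *\<^sub>v comb B2 \<in> S"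
    if g: "g \<in> carrier G" for g
  proof -
    have "snd U g *\<^sub>v comb bs \<in> Orb bs" for bs using g by blast
    then show "snd U g *\<^sub>v comb B0 \<in> S" "snd U g *\<^sub>v comb B1 \<in> S" "snd U g *\<^sub>v comb B2 \<in> S"
      using X A(4) by (meson subsetD)+
  qed
  have "gen s \<in> S" for s
  proof (cases s)
    case T0
    show ?thesis unfolding T0 by (rule w_in_submodule[OF A(3) certificate_ok certificate_gs(1) o generate_T0])
  next
    case T1
    show ?thesis unfolding T1 by (rule w_in_submodule[OF A(3) certificate_ok certificate_gs(2) o generate_T1])
  next
    case T2
    show ?thesis unfolding T2 by (rule w_in_submodule[OF A(3) certificate_ok certificate_gs(3) o generate_T2])
  qed
  then have S: "S = carrier_vec (fst U)" by (rule gen_span[OF A(3) _ A(5)])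
  have "\<exists>v\<in>carrier_vec (fst L). A *\<^sub>v v = w" if w: "w \<in> carrier_vec (fst U)" for w
  proof -
    have "w \<in> {A *\<^sub>v z |z. z \<in> carrier_vec (fst L)}" using w by (simp only: S[symmetric] A(2))
    then show ?thesis by blast
  qed
  then show ?thesis by (rule lat_iso_of_surj[OF A(1) rank])
qed

lemma covers_D9:
  assumes D: "subgroup D G" and z: "z \<in> carrier G"
    and iff: "\<And>x. x \<in> carrier G \<Longrightarrow> (cmp (\<pi> x) cyc = cmp cyc (\<pi> x) \<or> cmp (\<pi> x) cyc = cmp (cmp cyc cyc) (\<pi> x)) \<longleftrightarrow> inv z \<otimes> x \<otimes> z \<in> D"
  shows "covers G (coset_lattice G D) U (Orb B1)"
proof (rule covers_coset[OF fin D z tails(2) comb_carrier[OF certificate_ok(2)]])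
  fix x assume x: "x \<in> carrier G" and "inv z \<otimes> x \<otimes> z \<in> D"
  then have "cmp (\<pi> x) cyc = cmp cyc (\<pi> x) \<or> cmp (\<pi> x) cyc = cmp (cmp cyc cyc) (\<pi> x)" using iff by blast
  then have "is_zero (add_combs B1 [(1, \<pi> x), (-1, idp)] zero_tree)"
    using B1_invariant[unfolded list_all_iff] \<pi>_in[OF x] by blast
  from comb_invariant[OF certificate_ok(2) \<pi>_in[OF x] this] show "snd U x *\<^sub>v comb B1 = comb B1" using x by simp
qed

lemma covers_C3:
  assumes C: "subgroup C G" and z: "z \<in> carrier G"
    and iff: "\<And>x. x \<in> carrier G \<Longrightarrow> \<pi> x \<in> {idp, cyc, cmp cyc cyc} \<longleftrightarrow> inv z \<otimes> x \<otimes> z \<in> C"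
  shows "covers G (coset_lattice G C) U (Orb B0)"
proof (rule covers_coset[OF fin C z tails(2) comb_carrier[OF certificate_ok(1)]])
  note c = comb_carrier[OF certificate_ok(1)]
  have cyc: "snd U (E cyc) *\<^sub>v comb B0 = comb B0"
    by (rule comb_invariant[OF certificate_ok(1) cyc_ap(6) B0_invariant])
  fix x assume x: "x \<in> carrier G" and "inv z \<otimes> x \<otimes> z \<in> C"
  then have "\<pi> x = idp \<or> \<pi> x = cyc \<or> \<pi> x = cmp cyc cyc" using iff[OF x] by blast
  then have "x = \<one> \<or> x = E cyc \<or> x = E cyc \<otimes> E cyc"
    using E_\<pi>[OF x] E_idp E_cmp[OF cyc_ap(6) cyc_ap(6)] by metis
  then consider "x = \<one>" | "x = E cyc" | "x = E cyc \<otimes> E cyc" by blast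
  then show "snd U x *\<^sub>v comb B0 = comb B0"
  proof cases
    case 1
    then show ?thesis using tails(2) c by (simp add: G_lattice_def)
  next
    case 2
    then show ?thesis using cyc by simp
  next
    case 3
    then show ?thesis using G_lattice_mult_vec[OF tails(2) E_cyc(1) E_cyc(1) c] cyc by simp
  qed
qed

lemma B2_fixed:
  assumes x: "x \<in> carrier G" "ap (\<pi> x) P0 = P0" "ap (\<pi> x) P1 = P1"
  shows "snd U x *\<^sub>v comb B2 = comb B2"
proof -
  have "is_zero (add_combs B2 [(1, \<pi> x), (-1, idp)] zero_tree)"
    using B2_invariant[unfolded list_all_iff] \<pi>_in[OF x(1)] x by blast
  from comb_invariant[OF certificate_ok(3) \<pi>_in[OF x(1)] this] show ?thesis using x by simp
qed

text \<open>The checked relation speaks of lists, while a homomorphism out of F asks for sums over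
  sets of group elements.\<close>

lemma B2_rows_cols:
  assumes r: "r < fst U"
  shows "(\<Sum>x\<in>set (map E rows). (snd U x *\<^sub>v comb B2) $ r) = (\<Sum>x\<in>set (map E cols). (snd U x *\<^sub>v comb B2) $ r)"
proof -
  let ?gs = "map (\<lambda>p. (1, p)) rows @ map (\<lambda>p. (-1, p)) cols :: (int \<times> perm) list"
  let ?f = "\<lambda>x. (snd U x *\<^sub>v comb B2) $ r"
  have gs: "\<forall>(c, g)\<in>set ?gs. g \<in> set group_list" using rows_cols_in by auto
  have neg: "(\<Sum>p\<leftarrow>ps. - h p) = - (\<Sum>p\<leftarrow>ps. h p)" for h :: "perm \<Rightarrow> int" and ps by (induction ps) auto
  have "0 = tree_sum (\<Phi> r) (add_combs B2 ?gs zero_tree)" using tree_sum_zero[OF B2_relation] by simp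
  also have "\<dots> = (\<Sum>(c, g)\<leftarrow>?gs. c * ?f (E g))"
    unfolding tree_sum_combs[OF certificate_ok(3) gs r] tree_sum_zero_tree by simp
  also have "\<dots> = (\<Sum>p\<leftarrow>rows. ?f (E p)) - (\<Sum>p\<leftarrow>cols. ?f (E p))"
    by (simp add: comp_def neg del: index_mult_mat_vec)
  finally have eq: "(\<Sum>p\<leftarrow>rows. ?f (E p)) = (\<Sum>p\<leftarrow>cols. ?f (E p))" by simp
  \<comment> \<open>The entries move one point to pairwise distinct points, so they are distinct and
    list sums become sums over sets.\<close>
  have d: "distinct (map E ps)" if "distinct (map (\<lambda>p. ap p u) ps)" "\<And>p. p \<in> set ps \<Longrightarrow> p \<in> set group_list" for ps u
  proof -
    have "inj_on E (set ps)" using that(2) by (metis \<pi>_E inj_onI)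
    then show ?thesis using that(1) by (auto simp: distinct_map)
  qed
  have "distinct (map E rows)" by (rule d[of P1]) (simp_all add: rows_cols_check tl_pts rows_cols_in)
  moreover have "distinct (map E cols)" by (rule d[of P0]) (simp_all add: rows_cols_check tl_pts rows_cols_in)
  ultimately show ?thesis
    using eq sum_list_distinct_conv_sum_set[of "map E rows" ?f] sum_list_distinct_conv_sum_set[of "map E cols" ?f]
    by (simp add: comp_def del: index_mult_mat_vec)
qed

text \<open>C3 is a summand on both sides. Inside U its role is to be stabilized by the standard C3;
  as a source of homomorphisms its elements must be conjugate into the standard C3. The two
  directions of C serve these two roles.\<close>

lemma resolution:
  assumes H: "H = {x \<in> carrier G. ap (\<pi> x) q = q}"
    and C: "\<And>x. x \<in> carrier G \<Longrightarrow> \<pi> x \<in> {idp, cyc, cmp cyc cyc} \<longleftrightarrow> inv (y T0) \<otimes> x \<otimes> y T0 \<in> K T0"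
    and D: "subgroup D G" and z: "z \<in> carrier G"
    and D_iff: "\<And>x. x \<in> carrier G \<Longrightarrow> (cmp (\<pi> x) cyc = cmp cyc (\<pi> x) \<or> cmp (\<pi> x) cyc = cmp (cmp cyc cyc) (\<pi> x)) \<longleftrightarrow> inv z \<otimes> x \<otimes> z \<in> D"
    and card: "card (K T0) = 3" "card (K T1) = 9" "card (K T2) = 14" "card D = 18"
  shows "\<exists>P F i p. flabby_resolution G (chevalley_lattice G H) P F i p \<and> lat_rank F = 64 \<and>
    lat_iso G U (lat_dsum [CL T0, coset_lattice G D, F]) \<and> lat_rank U = 260 \<and> stably_perm_lattice G F"
proof -
  obtain a b where a: "a \<in> carrier G" "ap (\<pi> a) q = P0" and b: "b \<in> carrier G" "ap (\<pi> b) q = P1"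
    by (rule point_representatives[OF H])
  note HG = point_stabilizer[OF H] and move = point_coset_move[OF H] and eq = point_coset_eq[OF H]
  have ab: "a <# H \<noteq> b <# H" using eq[OF a(1) b(1)] a b by simp
  \<comment> \<open>Since a H and b H correspond to the points 0 and 1, T is the stabilizer of the
    ordered pair (0, 1) for which \<open>B2\<close> was made.\<close>
  define T where "T = {x \<in> carrier G. \<forall>u\<in>{P0, P1}. ap (\<pi> x) u = u}"
  have T: "subgroup T G" unfolding T_def by (rule fixator_subgroup)
  have T_iff: "x \<in> T \<longleftrightarrow> x <# (a <# H) = a <# H \<and> x <# (b <# H) = b <# H" if x: "x \<in> carrier G" for x
    using x a b eq[of "x \<otimes> a" a] eq[of "x \<otimes> b" b] by (simp add: T_def move \<pi>_mult)
  obtain F i p where F: "short_exact G (chevalley_lattice G H) (coset_lattice G T) F i p"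
    and rankF: "fst F = (card (lcosets H) - 1)\<^sup>2"
    and lift: "\<And>L v xs ys. G_lattice G L \<Longrightarrow> v \<in> carrier_vec (fst L) \<Longrightarrow> (\<And>t. t \<in> T \<Longrightarrow> snd L t *\<^sub>v v = v) \<Longrightarrow>
       set xs \<subseteq> carrier G \<Longrightarrow> set ys \<subseteq> carrier G \<Longrightarrow>
       (\<And>x. x \<in> set xs \<Longrightarrow> x <# (a <# H) = a <# H) \<Longrightarrow> (\<And>y. y \<in> set ys \<Longrightarrow> y <# (b <# H) = a <# H) \<Longrightarrow>
       bij_betw (\<lambda>x. x <# (b <# H)) (set xs) (lcosets H - {a <# H}) \<Longrightarrow>
       bij_betw (\<lambda>y. y <# (a <# H)) (set ys) (lcosets H - {a <# H}) \<Longrightarrow>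
       (\<And>r. r < fst L \<Longrightarrow> (\<Sum>x\<in>set xs. (snd L x *\<^sub>v v) $ r) = (\<Sum>y\<in>set ys. (snd L y *\<^sub>v v) $ r)) \<Longrightarrow>
       \<exists>B. G_hom G F L B \<and> (\<forall>x\<in>carrier G. \<exists>z\<in>carrier_vec (fst F). B *\<^sub>v z = snd L x *\<^sub>v v)"
    by (rule chevalley_resolution[OF fin HG a(1) b(1) ab point_coset_transitive[OF H a b] T T_iff]) blast+
  have FL: "G_lattice G F" using F by (simp add: short_exact_def)
  let ?xs = "map E rows" and ?ys = "map E cols"
  have xs: "set ?xs \<subseteq> carrier G" and ys: "set ?ys \<subseteq> carrier G" using rows_cols_in by auto
  have mx: "map (\<lambda>x. ap (\<pi> x) P1) ?xs = tl pts"
    unfolding rows_cols_check(2)[symmetric] by (simp add: rows_cols_in)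
  have my: "map (\<lambda>x. ap (\<pi> x) P0) ?ys = tl pts"
    unfolding rows_cols_check(4)[symmetric] by (simp add: rows_cols_in)
  have bx: "bij_betw (\<lambda>x. x <# (b <# H)) (set ?xs) (lcosets H - {a <# H})"
    by (rule point_coset_bij[OF H a b(1) xs]) (use mx b in simp)
  have by': "bij_betw (\<lambda>x. x <# (a <# H)) (set ?ys) (lcosets H - {a <# H})"
    by (rule point_coset_bij[OF H a a(1) ys]) (use my a in simp)
  have row: "x <# (a <# H) = a <# H" if "x \<in> set ?xs" for x
  proof -
    have "x \<in> carrier G" "ap (\<pi> x) P0 = P0" using that rows_cols_check(1) rows_cols_in by (auto simp: list_all_iff)
    then show ?thesis using eq[of "x \<otimes> a" a] a by (simp add: move \<pi>_mult)
  qed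
  have col: "x <# (b <# H) = a <# H" if "x \<in> set ?ys" for x
  proof -
    have "x \<in> carrier G" "ap (\<pi> x) P1 = P0" using that rows_cols_check(3) rows_cols_in by (auto simp: list_all_iff)
    then show ?thesis using eq[of "x \<otimes> b" a] a b by (simp add: move \<pi>_mult)
  qed
  have B2_T: "snd U t *\<^sub>v comb B2 = comb B2" if "t \<in> T" for t using that B2_fixed by (simp add: T_def)
  have "\<exists>B. G_hom G F U B \<and> (\<forall>x\<in>carrier G. \<exists>z\<in>carrier_vec (fst F). B *\<^sub>v z = snd U x *\<^sub>v comb B2)"
    by (rule lift[OF tails(2) comb_carrier[OF certificate_ok(3)] B2_T xs ys row col bx by' B2_rows_cols])
  then obtain B where B: "G_hom G F U B" "\<And>x. x \<in> carrier G \<Longrightarrow> \<exists>z\<in>carrier_vec (fst F). B *\<^sub>v z = snd U x *\<^sub>v comb B2"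
    by (elim exE conjE) (rule that, assumption, rule bspec)
  have covF: "covers G F U (Orb B2)" unfolding covers_def
  proof (intro exI conjI subsetI)
    fix v assume "v \<in> Orb B2"
    then obtain x where "x \<in> carrier G" "v = snd U x *\<^sub>v comb B2" by (elim CollectE exE conjE) (rule that)
    then obtain z where "z \<in> carrier_vec (fst F)" "v = B *\<^sub>v z" using B(2) by metis
    then show "v \<in> {B *\<^sub>v z |z. z \<in> carrier_vec (fst F)}" by (intro CollectI exI conjI)
  qed (rule B(1))
  have covC: "covers G (CL T0) U (Orb B0)" by (rule covers_C3[OF K y C])
  have covD: "covers G (coset_lattice G D) U (Orb B1)" by (rule covers_D9[OF D z D_iff])
  have DL: "G_lattice G (coset_lattice G D)" by (rule G_lattice_coset[OF fin D])
  have "card (set ?xs) = card (lcosets H - {a <# H})" by (rule bij_betw_same_card[OF bx])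
  moreover have "card (set ?xs) = 8"
  proof -
    have "distinct ?xs" using mx tl_pts(1) by (metis distinct_map)
    moreover have "length ?xs = 8" using arg_cong[OF mx, of length] tl_pts(2) by simp
    ultimately show ?thesis by (metis distinct_card)
  qed
  moreover have "a <# H \<in> lcosets H" unfolding lcosets_iff using a(1) by blast
  ultimately have "card (lcosets H) - 1 = 8" by simp
  then have rankF: "fst F = 64" using rankF by simp
  have rank: "card (lcosets M) = 504 div card M" if "subgroup M G" "card M > 0" for M
    using l_lagrange[OF fin that(1)] that(2) order by (metis Coset.order_def nonzero_mult_div_cancel_right less_not_refl)
  \<comment> \<open>Indices of subgroups of order 3, 9, 14 and 18 in a group of order 504.\<close>
  have r: "rk T0 = 168" "rk T1 = 56" "rk T2 = 36" "card (lcosets D) = 28"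
    using rank[OF K[of T0]] rank[OF K[of T1]] rank[OF K[of T2]] rank[OF D] card by simp_all
  let ?P = "lat_dsum [CL T0, coset_lattice G D]"
  have PL: "G_lattice G ?P" "G_lattice G (lat_dsum [coset_lattice G D, F])" "G_lattice G (lat_dsum [CL T0, coset_lattice G D, F])"
    by (rule G_lattice_dsum[OF is_group]; use CL DL FL in force)+
  have sF: "G_lattice G (lat_dsum [F])" "G_lattice G (lat_dsum [coset_lattice G D])" "G_lattice G (lat_dsum [?P])"
    using FL DL PL(1) by (simp_all only: lat_dsum_single)
  have "covers G (lat_dsum [coset_lattice G D, F]) U (Orb B1 \<union> Orb B2)"
    by (rule covers_dsum[OF is_group DL sF(1) tails(2) covD]) (simp only: lat_dsum_single covF)
  from covers_dsum[OF is_group CL PL(2) tails(2) covC this]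
  have "lat_iso G (lat_dsum [CL T0, coset_lattice G D, F]) U"
    by (rule iso_of_covers[OF PL(3), rotated]) (use r rankF in auto)
  then have iso1: "lat_iso G U (lat_dsum [CL T0, coset_lattice G D, F])"
    by (rule lat_iso_sym[OF PL(3) tails(2)])
  have "covers G ?P U (Orb B0 \<union> Orb B1)"
    by (rule covers_dsum[OF is_group CL sF(2) tails(2) covC]) (simp only: lat_dsum_single covD)
  then have "covers G (lat_dsum [?P]) U (Orb B0 \<union> Orb B1)" by (simp only: lat_dsum_single)
  \<comment> \<open>The same surjection with F in front and the two coset lattices bundled into one
    permutation lattice, the shape that \<open>flabby_dsum_head\<close> and stable permutation ask
    for.\<close>
  from covers_dsum[OF is_group FL sF(3) tails(2) covF this]
  have iso2: "lat_iso G (lat_dsum [F, ?P]) U"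
    by (rule iso_of_covers[OF G_lattice_dsum_Cons[OF FL sF(3) is_group], rotated]) (use r rankF in auto)
  have "permutes_basis G U"
    by (rule permutes_basis_dsum[OF is_group]; use CL permutes_basis_coset[OF fin K] in force)
  then have "flabby G U" by (rule flabby_permutes_basis[OF fin tails(2)])
  then have "flabby G F" by (rule flabby_dsum_head[OF is_group FL sF(3) tails(2) _ iso2])
  moreover have "perm_lattice G (coset_lattice G T)"
    using perm_lattice_dsum[OF is_group fin, of "[T]"] T by (simp add: lat_dsum_single)
  ultimately have "flabby_resolution G (chevalley_lattice G H) (coset_lattice G T) F i p"
    using F by (simp add: flabby_resolution_def)
  moreover have "stably_perm_lattice G F"
    unfolding stably_perm_lattice_def
  proof (intro conjI exI)
    have "subgroup M G" if "M \<in> set [K T0, D]" for M using that K D by auto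
    from perm_lattice_dsum[OF is_group fin, of "[K T0, D]", OF this] show "perm_lattice G ?P" by simp
    have "subgroup M G" if "M \<in> set [K T0, K T1, K T2]" for M using that K by auto
    from perm_lattice_dsum[OF is_group fin, of "[K T0, K T1, K T2]", OF this] show "perm_lattice G U" by simp
  qed (rule FL iso2)+
  moreover have "lat_rank F = 64" "lat_rank U = 260" using rankF r by (simp_all add: lat_rank_def)
  ultimately show ?thesis using iso1 by (intro exI conjI)
qed

end

end

theorem theorem1p3:
  fixes G :: "(nat \<times> nat \<times> nat \<times> nat) set monoid"
    and S H C3 C9 D7 D9 :: "(nat \<times> nat \<times> nat \<times> nat) set set"
  assumes G_def: "G = PSL2 GF8"
    and S: "sylow_subgroup G 2 S"
    and H_def: "H = normalizer G S"
    and C3: "subgroup C3 G" "G\<lparr>carrier := C3\<rparr> \<cong> integer_mod_group 3"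
    and C9: "subgroup C9 G" "G\<lparr>carrier := C9\<rparr> \<cong> integer_mod_group 9"
    and D7: "subgroup D7 G" "G\<lparr>carrier := D7\<rparr> \<cong> dihedral_group 7"
    and D9: "subgroup D9 G" "G\<lparr>carrier := D9\<rparr> \<cong> dihedral_group 9"
  shows "\<exists>P F i p. flabby_resolution G (chevalley_lattice G H) P F i p \<and> lat_rank F = 64 \<and>
           lat_iso G (lat_dsum [coset_lattice G C3, coset_lattice G C9, coset_lattice G D7])
                     (lat_dsum [coset_lattice G C3, coset_lattice G D9, F]) \<and>
           lat_rank (lat_dsum [coset_lattice G C3, coset_lattice G C9, coset_lattice G D7]) = 260 \<and>
           stably_perm_lattice G F"
proof -
  obtain \<pi> where "psl28 G \<pi>" using PSL2_GF8 unfolding G_def by blast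
  then interpret psl28 G \<pi> .
  \<comment> \<open>Whichever Sylow subgroup is given, H is the stabilizer of a point.\<close>
  obtain q where q: "normalizer G S = {x \<in> carrier G. ap (\<pi> x) q = q}" by (rule sylow_normalizer[OF S])
  obtain y0 where y0: "y0 \<in> carrier G" "card C3 = 3"
    "\<And>x. x \<in> carrier G \<Longrightarrow> \<pi> x \<in> {idp, cyc, cmp cyc cyc} \<longleftrightarrow> inv\<^bsub>G\<^esub> y0 \<otimes>\<^bsub>G\<^esub> x \<otimes>\<^bsub>G\<^esub> y0 \<in> C3"
    by (rule C3_standard[OF C3]) (rule that, assumption+)
  obtain y1 where y1: "y1 \<in> carrier G" "card C9 = 9"
    "\<And>x. x \<in> carrier G \<Longrightarrow> cmp (\<pi> x) cyc = cmp cyc (\<pi> x) \<longleftrightarrow> inv\<^bsub>G\<^esub> y1 \<otimes>\<^bsub>G\<^esub> x \<otimes>\<^bsub>G\<^esub> y1 \<in> C9"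
    by (rule C9_standard[OF C9]) (rule that, assumption+)
  obtain y2 where y2: "y2 \<in> carrier G" "card D7 = 14"
    "\<And>x. x \<in> carrier G \<Longrightarrow> (ap (\<pi> x) P0 = P0 \<and> ap (\<pi> x) P1 = P1 \<or> ap (\<pi> x) P0 = P1 \<and> ap (\<pi> x) P1 = P0)
       \<longleftrightarrow> inv\<^bsub>G\<^esub> y2 \<otimes>\<^bsub>G\<^esub> x \<otimes>\<^bsub>G\<^esub> y2 \<in> D7"
    by (rule D7_standard[OF D7]) (rule that, assumption+)
  obtain z where z: "z \<in> carrier G" "card D9 = 18"
    "\<And>x. x \<in> carrier G \<Longrightarrow> (cmp (\<pi> x) cyc = cmp cyc (\<pi> x) \<or> cmp (\<pi> x) cyc = cmp (cmp cyc cyc) (\<pi> x))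
       \<longleftrightarrow> inv\<^bsub>G\<^esub> z \<otimes>\<^bsub>G\<^esub> x \<otimes>\<^bsub>G\<^esub> z \<in> D9"
    by (rule D9_standard[OF D9]) (rule that, assumption+)
  \<comment> \<open>The given subgroups and their conjugating elements are indexed by the coset
    types of the certificate.\<close>
  define K where "K s = (case s of T0 \<Rightarrow> C3 | T1 \<Rightarrow> C9 | T2 \<Rightarrow> D7)" for s
  define y where "y s = (case s of T0 \<Rightarrow> y0 | T1 \<Rightarrow> y1 | T2 \<Rightarrow> y2)" for s
  have K: "subgroup (K s) G" and y: "y s \<in> carrier G" for s
    using C3(1) C9(1) D7(1) y0(1) y1(1) y2(1) by (cases s; simp add: K_def y_def)+
  have conj: "inv\<^bsub>G\<^esub> y s \<otimes>\<^bsub>G\<^esub> x \<otimes>\<^bsub>G\<^esub> y s \<in> K s" if "x \<in> carrier G" "stab s (\<pi> x)" for s x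
    using that y0(3)[of x] y1(3)[of x] y2(3)[of x] by (cases s) (simp_all only: stab.simps K_def y_def ty.case)
  have Hq: "H = {x \<in> carrier G. ap (\<pi> x) q = q}" unfolding H_def by (rule q)
  have C: "\<pi> x \<in> {idp, cyc, cmp cyc cyc} \<longleftrightarrow> inv\<^bsub>G\<^esub> y T0 \<otimes>\<^bsub>G\<^esub> x \<otimes>\<^bsub>G\<^esub> y T0 \<in> K T0" if "x \<in> carrier G" for x
    unfolding K_def y_def ty.case by (rule y0(3)[OF that])
  have card: "card (K T0) = 3" "card (K T1) = 9" "card (K T2) = 14" "card D9 = 18"
    using y0(2) y1(2) y2(2) z(2) by (simp_all add: K_def)
  have "\<exists>P F i p. flabby_resolution G (chevalley_lattice G H) P F i p \<and> lat_rank F = 64 \<and>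
    lat_iso G (lat_dsum [coset_lattice G (K T0), coset_lattice G (K T1), coset_lattice G (K T2)])
      (lat_dsum [coset_lattice G (K T0), coset_lattice G D9, F]) \<and>
    lat_rank (lat_dsum [coset_lattice G (K T0), coset_lattice G (K T1), coset_lattice G (K T2)]) = 260 \<and> stably_perm_lattice G F"
    by (rule resolution[where K = K and y = y and q = q and z = z]) (fact K y conj Hq C D9(1) z(1) z(3) card)+
  then show ?thesis by (simp only: K_def ty.case)
qed

end
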